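(* Let $1\to R\to F\to G\to 1$ be a presentation of a finite group $G$ by a free product $F=\langle f_1,\dots,f_d\mid f_1^{m_1},\dots,f_d^{m_d}\rangle$ of finitely many finite cyclic groups, with $f_i\notin R$ for all $i$. Let $E=F/[R,F]$, let $\pi:E\to G$ be the induced homomorphism, and let $h_i=[R,F]f_i\in E$ and $g_i=\pi(h_i)\in G$. Let $W$ and $Y$ be the cellular complexes associated to the generating systems $h_\ast=(h_1,\dots,h_d)$ of $E$ and $g_\ast=(g_1,\dots,g_d)$ of $G$. Then $\pi$ induces a continuous map $p:W\to Y$. This $p$ is a covering projection if and only if $\pi$ preserves the order of the generators, i.e. $o(h_i)=o(g_i)$ for all $i$; and in this case $E$ has minimal exponent among the covers of $G$, i.e. $\exp E\le\exp E'$ for every cover $E'$ of $G$.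
   Context: A cover of a finite group $G$ is a finite central extension $1\to A\to E\to G\to 1$ such that every projective representation $G\to\mathrm{PGL}_n(\mathbb C)$ lifts to an ordinary representation $E\to\mathrm{GL}_n(\mathbb C)$ (equivalently $[E,E]\cap A\simeq H^2(G,\mathbb C^\times)$ with trivial action). The complex associated to a generating system. Let $G$ be a group with a generating system $g_\ast=(g_1,\dots,g_d)$ such that $m_i=o(g_i)$ satisfies $1<m_i<\infty$. The associated cellular complex $Y$ is the Cayley graph (vertices $g\mathbf v$ and, for each $i$, oriented edges $g\mathbf e_i$ from $g\mathbf v$ to $gg_i\mathbf v$, $g\in G$) with, for each $i$ and each left coset $g\langle g_i\rangle$, one 2-cell $g\mathbf p_i$ (a polygon with $m_i$ sides) attached along the cycle $(g\mathbf e_i,gg_i\mathbf e_i,\dots,gg_i^{m_i-1}\mathbf e_i)$. Subdividing each polygon barycentrically, $Y$ is also the 2-dimensional complex (simplices glued along faces, a $\Delta$-complex) with vertices $g\mathbf v$ ($g\in G$) and $g\mathbf c_i$ (with $g\mathbf c_i=g'\mathbf c_i$ iff $g\langle g_i\rangle=g'\langle g_i\rangle$), edges $g\mathbf e_i=\langle g\mathbf v,gg_i\mathbf v\rangle$ and $g\mathbf r_i=\langle g\mathbf v,g\mathbf c_i\rangle$, and triangles $g\mathbf f_i=\langle g\mathbf v,gg_i\mathbf v,g\mathbf c_i\rangle$ with faces $gg_i\mathbf r_i,\ g\mathbf r_i,\ g\mathbf e_i$, for $g\in G$ and $i=1,\dots,d$; distinct $g\in G$ give distinct $g\mathbf v,g\mathbf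 e_i,g\mathbf r_i,g\mathbf f_i$, and $\mathbf p_i=\mathbf f_i\cup g_i\mathbf f_i\cup\dots\cup g_i^{m_i-1}\mathbf f_i$. The map induced by $\pi$ is the simplicial map $p(h\sigma)=\pi(h)\sigma$ for $\sigma\in\{\mathbf v,\mathbf c_i,\mathbf e_i,\mathbf r_i,\mathbf f_i\}$. A covering projection is a continuous map $p:W\to Y$ such that every point of $Y$ has a neighbourhood $U$ with $p^{-1}(U)$ a disjoint union of open subsets of $W$ each mapped homeomorphically onto $U$ by $p$. *)

theory Defs
  imports
    "HOL-Algebra.Generated_Groups"
    "HOL-Algebra.Multiplicative_Group"
    "HOL-Homology.Homology"
    "Jordan_Normal_Form.Matrix"
begin

section \<open>Groups given by generators and relations\<close>

text \<open>
  Words over a set \<open>S\<close> of generators: the letter \<open>(s, True)\<close> stands for the generator \<open>s\<close>,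
  the letter \<open>(s, False)\<close> for its formal inverse.
\<close>

definition words :: "'s set \<Rightarrow> ('s \<times> bool) list set" where
  "words S = lists (S \<times> UNIV)"

definition insertion_steps ::
    "'s set \<Rightarrow> ('s \<times> bool) list set \<Rightarrow> (('s \<times> bool) list \<times> ('s \<times> bool) list) set" where
  "insertion_steps S rels =
     {(u @ v, u @ w @ v) | u v w. u \<in> words S \<and> v \<in> words S \<and>
        w \<in> rels \<union> {[(s, b), (s, \<not> b)] | s b. s \<in> S}}"

definition word_equiv ::
    "'s set \<Rightarrow> ('s \<times> bool) list set \<Rightarrow> (('s \<times> bool) list \<times> ('s \<times> bool) list) set" where
  "word_equiv S rels = (insertion_steps S rels \<union> (insertion_steps S rels)\<inverse>)\<^sup>*"

text \<open>The group with presentation \<open>\<langle>S | rels\<rangle>\<close>; it is intended for \<open>rels \<subseteq> words S\<close>.\<close>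

definition presented_group ::
    "'s set \<Rightarrow> ('s \<times> bool) list set \<Rightarrow> ('s \<times> bool) list set monoid" where
  "presented_group S rels =
     \<lparr> carrier = words S // word_equiv S rels,
       monoid.mult = (\<lambda>A B. \<Union>a\<in>A. \<Union>b\<in>B. word_equiv S rels `` {a @ b}),
       one = word_equiv S rels `` {[]} \<rparr>"

text \<open>
  The free product of cyclic groups of orders \<open>m 0, \<dots>, m (d - 1)\<close>, presented as
  \<open>\<langle>f\<^sub>i | f\<^sub>i ^ m i\<rangle>\<close> with \<open>i < d\<close>, and its generators \<open>f\<^sub>i\<close>.
\<close>

definition cyclic_relators :: "nat \<Rightarrow> (nat \<Rightarrow> nat) \<Rightarrow> (nat \<times> bool) list set" where
  "cyclic_relators d m = {replicate (m i) (i, True) | i. i < d}"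

definition free_product_cyclic :: "nat \<Rightarrow> (nat \<Rightarrow> nat) \<Rightarrow> (nat \<times> bool) list set monoid" where
  "free_product_cyclic d m = presented_group {..<d} (cyclic_relators d m)"

definition free_product_gen :: "nat \<Rightarrow> (nat \<Rightarrow> nat) \<Rightarrow> nat \<Rightarrow> (nat \<times> bool) list set" where
  "free_product_gen d m i = word_equiv {..<d} (cyclic_relators d m) `` {[(i, True)]}"


section \<open>Commutator subgroups, induced homomorphisms, exponents\<close>

definition commutator_subgroup :: "('a, 'b) monoid_scheme \<Rightarrow> 'a set \<Rightarrow> 'a set \<Rightarrow> 'a set" where
  "commutator_subgroup G H K =
     generate G (\<Union>h\<in>H. \<Union>k\<in>K. {h \<otimes>\<^bsub>G\<^esub> k \<otimes>\<^bsub>G\<^esub> inv\<^bsub>G\<^esub> h \<otimes>\<^bsub>G\<^esub> inv\<^bsub>G\<^esub> k})"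

text \<open>
  The map induced on a quotient \<open>F Mod N\<close> by a homomorphism \<open>\<phi>\<close> of \<open>F\<close> whose kernel contains \<open>N\<close>:
  \<open>\<phi>\<close> is constant on each coset of \<open>N\<close>, and the coset is sent to that value.
\<close>

definition induced_hom :: "('a \<Rightarrow> 'b) \<Rightarrow> 'a set \<Rightarrow> 'b" where
  "induced_hom \<phi> X = the_elem (\<phi> ` X)"

definition group_exp :: "('a, 'b) monoid_scheme \<Rightarrow> nat" where
  "group_exp G = (LEAST n. 0 < n \<and> (\<forall>x\<in>carrier G. x [^]\<^bsub>G\<^esub> n = \<one>\<^bsub>G\<^esub>))"


section \<open>Projective representations and covers of a group\<close>

definition GL :: "nat \<Rightarrow> complex mat monoid" where
  "GL n = units_of (ring_mat TYPE(complex) n ())"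

definition scalar_mats :: "nat \<Rightarrow> complex mat set" where
  "scalar_mats n = {a \<cdot>\<^sub>m 1\<^sub>m n | a. a \<noteq> 0}"

definition PGL :: "nat \<Rightarrow> complex mat set monoid" where
  "PGL n = GL n Mod scalar_mats n"

text \<open>
  \<open>\<pi> : E \<rightarrow> G\<close> is a cover of \<open>G\<close> if it is a surjection with finite central kernel such that for each
  projective representation \<open>\<rho>\<close> of \<open>G\<close> there is a representation of \<open>E\<close> which becomes \<open>\<rho> \<circ> \<pi>\<close>
  after passing to cosets modulo scalar matrices.
\<close>

definition is_cover ::
    "('g, 'x) monoid_scheme \<Rightarrow> ('e, 'y) monoid_scheme \<Rightarrow> ('e \<Rightarrow> 'g) \<Rightarrow> bool" where
  "is_cover G E \<pi> \<longleftrightarrow>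
     group E \<and> \<pi> \<in> epi E G \<and>
     finite (kernel E G \<pi>) \<and>
     (\<forall>a\<in>kernel E G \<pi>. \<forall>x\<in>carrier E. a \<otimes>\<^bsub>E\<^esub> x = x \<otimes>\<^bsub>E\<^esub> a) \<and>
     (\<forall>n\<ge>1. \<forall>\<rho>\<in>hom G (PGL n). \<exists>\<rho>'\<in>hom E (GL n).
        \<forall>x\<in>carrier E. scalar_mats n #>\<^bsub>GL n\<^esub> \<rho>' x = \<rho> (\<pi> x))"


section \<open>The complex associated to a generating system\<close>

text \<open>
  The symbols \<open>v, c\<^sub>i, e\<^sub>i, r\<^sub>i, f\<^sub>i\<close> naming the orbits of simplices, and the simplices themselves.
  A center is recorded by its index and a left coset of the subgroup generated by \<open>g i\<close>, so that
  \<open>x c\<^sub>i = x' c\<^sub>i\<close> iff the two cosets agree; all other simplices are indexed freely.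
\<close>

datatype cell_symbol = Sym_v | Sym_c nat | Sym_e nat | Sym_r nat | Sym_f nat

datatype 'a cell =
  Vertex 'a | Center nat "'a set" | Edge nat 'a | Spoke nat 'a | Triangle nat 'a

definition cell_symbols :: "nat \<Rightarrow> cell_symbol set" where
  "cell_symbols d = {Sym_v} \<union> (\<Union>i\<in>{..<d}. {Sym_c i, Sym_e i, Sym_r i, Sym_f i})"

text \<open>\<open>translate G g x \<sigma>\<close> is the simplex \<open>x \<sigma>\<close> of the complex of \<open>g\<close>.\<close>

fun translate ::
    "('a, 'b) monoid_scheme \<Rightarrow> (nat \<Rightarrow> 'a) \<Rightarrow> 'a \<Rightarrow> cell_symbol \<Rightarrow> 'a cell" where
  "translate G g x Sym_v = Vertex x"
| "translate G g x (Sym_c i) = Center i (x <#\<^bsub>G\<^esub> generate G {g i})"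
| "translate G g x (Sym_e i) = Edge i x"
| "translate G g x (Sym_r i) = Spoke i x"
| "translate G g x (Sym_f i) = Triangle i x"

definition cells :: "('a, 'b) monoid_scheme \<Rightarrow> nat \<Rightarrow> (nat \<Rightarrow> 'a) \<Rightarrow> 'a cell set" where
  "cells G d g = {translate G g x \<sigma> | x \<sigma>. x \<in> carrier G \<and> \<sigma> \<in> cell_symbols d}"

fun cell_dim :: "'a cell \<Rightarrow> nat" where
  "cell_dim (Vertex x) = 0"
| "cell_dim (Center i K) = 0"
| "cell_dim (Edge i x) = 1"
| "cell_dim (Spoke i x) = 1"
| "cell_dim (Triangle i x) = 2"

text \<open>
  The face of an ordered simplex opposite to its \<open>k\<close>-th vertex, for the vertex orders
  \<open>x e\<^sub>i = \<langle>x v, x g\<^sub>i v\<rangle>\<close>, \<open>x r\<^sub>i = \<langle>x v, x c\<^sub>i\<rangle>\<close> and \<open>x f\<^sub>i = \<langle>x v, x g\<^sub>i v, x c\<^sub>i\<rangle>\<close>.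
  It is only used for simplices of positive dimension.
\<close>

fun cell_face ::
    "('a, 'b) monoid_scheme \<Rightarrow> (nat \<Rightarrow> 'a) \<Rightarrow> nat \<Rightarrow> 'a cell \<Rightarrow> 'a cell" where
  "cell_face G g k (Edge i x) =
     (if k = 0 then translate G g (x \<otimes>\<^bsub>G\<^esub> g i) Sym_v else translate G g x Sym_v)"
| "cell_face G g k (Spoke i x) =
     (if k = 0 then translate G g x (Sym_c i) else translate G g x Sym_v)"
| "cell_face G g k (Triangle i x) =
     (if k = 0 then translate G g (x \<otimes>\<^bsub>G\<^esub> g i) (Sym_r i)
      else if k = 1 then translate G g x (Sym_r i)
      else translate G g x (Sym_e i))"
| "cell_face G g k (Vertex x) = Vertex x"
| "cell_face G g k (Center i K) = Center i K"

text \<open>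
  The topological realization: the disjoint union of one standard simplex for each cell, with every
  face of a simplex glued to the corresponding cell of lower dimension. A point of the realization
  is an equivalence class of pairs of a cell and barycentric coordinates in it.
\<close>

definition gluing ::
    "('a, 'b) monoid_scheme \<Rightarrow> nat \<Rightarrow> (nat \<Rightarrow> 'a) \<Rightarrow>
       (('a cell \<times> (nat \<Rightarrow> real)) \<times> ('a cell \<times> (nat \<Rightarrow> real))) set" where
  "gluing G d g =
     {((s, simplical_face k t), (cell_face G g k s, t)) | s k t.
        s \<in> cells G d g \<and> 0 < cell_dim s \<and> k \<le> cell_dim s \<and>
        t \<in> standard_simplex (cell_dim s - 1)}"

definition complex_point ::
    "('a, 'b) monoid_scheme \<Rightarrow> nat \<Rightarrow> (nat \<Rightarrow> 'a) \<Rightarrow>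
       'a cell \<times> (nat \<Rightarrow> real) \<Rightarrow> ('a cell \<times> (nat \<Rightarrow> real)) set" where
  "complex_point G d g z = (gluing G d g \<union> (gluing G d g)\<inverse>)\<^sup>* `` {z}"

definition quotient_topology :: "'a topology \<Rightarrow> ('a \<Rightarrow> 'b) \<Rightarrow> 'b topology" where
  "quotient_topology X q =
     topology (\<lambda>U. U \<subseteq> q ` topspace X \<and> openin X {x \<in> topspace X. q x \<in> U})"

lemma istopology_quotient:
  "istopology (\<lambda>U. U \<subseteq> q ` topspace X \<and> openin X {x \<in> topspace X. q x \<in> U})"
proof -
  have 1: "{x \<in> topspace X. q x \<in> S \<inter> T} =
      {x \<in> topspace X. q x \<in> S} \<inter> {x \<in> topspace X. q x \<in> T}" for S T
    by auto
  have 2: "{x \<in> topspace X. q x \<in> \<Union> \<K>} = (\<Union>K\<in>\<K>. {x \<in> topspace X. q x \<in> K})" for \<K>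
    by auto
  show ?thesis
    unfolding istopology_def 1 2 by blast
qed

lemma openin_quotient_topology:
  "openin (quotient_topology X q) U \<longleftrightarrow>
     U \<subseteq> q ` topspace X \<and> openin X {x \<in> topspace X. q x \<in> U}"
  by (simp add: quotient_topology_def istopology_quotient)

definition associated_complex ::
    "('a, 'b) monoid_scheme \<Rightarrow> nat \<Rightarrow> (nat \<Rightarrow> 'a) \<Rightarrow>
       ('a cell \<times> (nat \<Rightarrow> real)) set topology" where
  "associated_complex G d g =
     quotient_topology
       (sum_topology
          (\<lambda>s. subtopology (powertop_real UNIV) (standard_simplex (cell_dim s)))
          (cells G d g))
       (complex_point G d g)"

text \<open>
  The simplicial map \<open>p (x \<sigma>) = \<pi> x \<sigma>\<close>, acting on each simplex by the identity in barycentric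
  coordinates. This determines \<open>p\<close> on all points of the complex of \<open>h\<close>.
\<close>

definition induced_simplicial_map ::
    "('e, 'x) monoid_scheme \<Rightarrow> ('g, 'y) monoid_scheme \<Rightarrow> nat \<Rightarrow> (nat \<Rightarrow> 'e) \<Rightarrow> (nat \<Rightarrow> 'g) \<Rightarrow>
     ('e \<Rightarrow> 'g) \<Rightarrow>
     (('e cell \<times> (nat \<Rightarrow> real)) set \<Rightarrow> ('g cell \<times> (nat \<Rightarrow> real)) set) \<Rightarrow> bool" where
  "induced_simplicial_map E G d h g \<pi> p \<longleftrightarrow>
     (\<forall>x\<in>carrier E. \<forall>\<sigma>\<in>cell_symbols d. \<forall>t\<in>standard_simplex (cell_dim (translate E h x \<sigma>)).
        p (complex_point E d h (translate E h x \<sigma>, t)) =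
        complex_point G d g (translate G g (\<pi> x) \<sigma>, t))"


section \<open>Covering projections\<close>

text \<open>The library's \<open>covering_space\<close> is confined to type-class topologies.\<close>

definition covering_projection :: "'a topology \<Rightarrow> 'b topology \<Rightarrow> ('a \<Rightarrow> 'b) \<Rightarrow> bool" where
  "covering_projection W Y p \<longleftrightarrow>
     continuous_map W Y p \<and>
     (\<forall>y\<in>topspace Y. \<exists>U. openin Y U \<and> y \<in> U \<and>
        (\<exists>\<V>. \<Union>\<V> = {x \<in> topspace W. p x \<in> U} \<and> pairwise disjnt \<V> \<and>
           (\<forall>V\<in>\<V>. openin W V \<and>
              homeomorphic_map (subtopology W V) (subtopology Y U) p)))"

end

theory Submission
  imports Defs "HOL-Analysis.Complex_Transcendental"
begin

text \<open>
  The map \<open>p\<close> is always open, because every gluing step in \<open>Y\<close> lifts to \<open>W\<close>. The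
  open star of a vertex of \<open>Y\<close> is evenly covered by the open stars of the vertices above it as soon
  as \<open>\<pi>\<close> is injective on each \<open>\<langle>h\<^sub>i\<rangle>\<close>; otherwise \<open>p\<close> fails to be injective near a center.

  A projective representation of \<open>G\<close> lifts to \<open>F\<close> by rescaling the image of each generator, and the
  lift kills \<open>[R, F]\<close>; \<open>E\<close> is finite by Dietzmann's lemma. For the exponent, let \<open>n = exp E'\<close> and
  induce a character of \<open>ker \<pi>\<close> to a representation \<open>\<sigma>\<close> of \<open>E\<close>. Lifting the associated projective
  representation to \<open>\<rho>'\<close> on \<open>E'\<close>, the elements \<open>x\<close> with \<open>\<sigma> x = z \<rho>' y\<close> for some \<open>y\<close> over \<open>\<pi> x\<close> and
  some scalar \<open>z\<close> with \<open>z\<^sup>n = 1\<close> form a subgroup containing all \<open>h\<^sub>i\<close>, since \<open>h\<^sub>i\<^sup>n = 1\<close>. Hence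
  \<open>\<sigma> (x\<^sup>n) = 1\<close> for all \<open>x\<close>, and \<open>x\<^sup>n = 1\<close> because characters separate the points of \<open>ker \<pi>\<close>.
\<close>

section \<open>Presented groups\<close>

text \<open>A point of a realization is a class under the reflexive transitive closure of gluing and
  has no preferred representative. All topology is therefore done on representatives: properties of
  points are those preserved by each gluing step, and lifting proceeds along chains of such steps.
  Openness of \<open>p\<close> then replaces explicit local inverses, since a continuous open
  bijection is a homeomorphism. That no \<open>f i\<close> lies in \<open>R\<close> means that no
  \<open>g i\<close> is 1, so the corners of each cell of \<open>Y\<close> are distinct and the
  stars over a given star are disjoint. The order condition concerns centers only: a cell of
  \<open>W\<close> is determined by its image and a corner \<open>Vertex x\<close>, whereas at a
  center a spoke or triangle is determined only up to the kernel elements in the cyclic group of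
  \<open>h i\<close>. For the exponent, a character of the kernel need not extend to
  \<open>E\<close>, but the kernel is central, so it acts by scalars in the induced representation.
  The projective class thus lives on \<open>G\<close> and can be lifted to any other cover. Equality
  of orders enters because \<open>n\<close> annihilates the quotient \<open>G\<close> of
  \<open>E'\<close>, so the order of \<open>g i\<close> divides \<open>n\<close>.\<close>

locale presentation =
  fixes S :: "'s set" and rels :: "('s \<times> bool) list set"
  assumes rels_words: "rels \<subseteq> words S"
begin

abbreviation "cls w \<equiv> word_equiv S rels `` {w}"
abbreviation "pres \<equiv> presented_group S rels"

lemma Nil_words [simp]: "[] \<in> words S"
  and append_words [simp]: "u @ v \<in> words S \<longleftrightarrow> u \<in> words S \<and> v \<in> words S"
  and Cons_words [simp]: "x # u \<in> words S \<longleftrightarrow> fst x \<in> S \<and> u \<in> words S"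
  by (auto simp: words_def mem_Times_iff)

lemma equiv_word_equiv: "equiv UNIV (word_equiv S rels)"
  by (auto simp: equiv_def word_equiv_def refl_on_def intro!: sym_rtrancl trans_rtrancl)
    (auto simp: sym_def)

lemma cls_eq_iff: "cls u = cls v \<longleftrightarrow> (u, v) \<in> word_equiv S rels"
  using eq_equiv_class_iff[OF equiv_word_equiv] by simp

lemma word_equiv_refl [simp]: "(u, u) \<in> word_equiv S rels"
  by (simp add: word_equiv_def)

lemma word_equiv_sym: "(u, v) \<in> word_equiv S rels \<Longrightarrow> (v, u) \<in> word_equiv S rels"
  by (metis cls_eq_iff)

lemma word_equiv_trans:
  "(u, v) \<in> word_equiv S rels \<Longrightarrow> (v, w) \<in> word_equiv S rels \<Longrightarrow> (u, w) \<in> word_equiv S rels"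
  by (metis cls_eq_iff)

lemma insertion_step_append:
  assumes "(u, v) \<in> insertion_steps S rels" "a \<in> words S" "b \<in> words S"
  shows "(a @ u @ b, a @ v @ b) \<in> insertion_steps S rels"
proof -
  obtain u1 u2 w where *: "u = u1 @ u2" "v = u1 @ w @ u2" "u1 \<in> words S" "u2 \<in> words S"
      "w \<in> rels \<union> {[(s, b), (s, \<not> b)] | s b. s \<in> S}"
    using assms(1) by (auto simp: insertion_steps_def)
  then have "a @ u @ b = (a @ u1) @ (u2 @ b)" "a @ v @ b = (a @ u1) @ w @ (u2 @ b)"
      "a @ u1 \<in> words S" "u2 @ b \<in> words S"
    using assms by auto
  with *(5) show ?thesis
    unfolding insertion_steps_def by blast
qed

lemma word_equiv_append:
  assumes "(u, v) \<in> word_equiv S rels" "a \<in> words S" "b \<in> words S"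
  shows "(a @ u @ b, a @ v @ b) \<in> word_equiv S rels"
  using assms(1) unfolding word_equiv_def
proof (induction rule: rtrancl_induct)
  case (step y z)
  then have "(a @ y @ b, a @ z @ b) \<in> insertion_steps S rels \<union> (insertion_steps S rels)\<inverse>"
    using insertion_step_append assms by blast
  with step.IH show ?case
    by (rule rtrancl_into_rtrancl)
qed auto

lemma insertion_steps_words:
  assumes "(u, v) \<in> insertion_steps S rels"
  shows "u \<in> words S" "v \<in> words S"
  using assms rels_words by (auto simp: insertion_steps_def)

lemma word_equiv_words:
  assumes "(u, v) \<in> word_equiv S rels" "u \<in> words S"
  shows "v \<in> words S"
  using assms unfolding word_equiv_def
  by (induction rule: rtrancl_induct) (auto dest: insertion_steps_words)

lemma word_equiv_append2:
  assumes "(u, u') \<in> word_equiv S rels" "(v, v') \<in> word_equiv S rels" "u \<in> words S" "v \<in> words S"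
  shows "(u @ v, u' @ v') \<in> word_equiv S rels"
proof -
  have "(u @ v, u' @ v) \<in> word_equiv S rels"
    using word_equiv_append[OF assms(1), of "[]" v] assms by simp
  moreover have "(u' @ v, u' @ v') \<in> word_equiv S rels"
    using word_equiv_append[OF assms(2), of u' "[]"] word_equiv_words[OF assms(1,3)] by simp
  ultimately show ?thesis
    by (rule word_equiv_trans)
qed

lemma carrier_presented_group: "carrier pres = cls ` words S"
  by (auto simp: presented_group_def quotient_def)

lemma one_presented_group: "\<one>\<^bsub>pres\<^esub> = cls []"
  by (simp add: presented_group_def)

text \<open>The product in \<open>presented_group\<close> is a union over all pairs of
  representatives. As word equivalence is a congruence, all classes in that union coincide, and it
  collapses to one class.\<close>

lemma mult_presented_group:
  assumes "u \<in> words S" "v \<in> words S"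
  shows "cls u \<otimes>\<^bsub>pres\<^esub> cls v = cls (u @ v)"
proof -
  have "cls (a @ b) = cls (u @ v)" if "a \<in> cls u" "b \<in> cls v" for a b
    using word_equiv_append2[of u a v b] that assms by (simp add: cls_eq_iff word_equiv_sym)
  moreover have "u \<in> cls u" "v \<in> cls v"
    by auto
  ultimately show ?thesis
    unfolding presented_group_def monoid.simps by blast
qed

lemma Cons_mult_presented_group:
  assumes "x # u \<in> words S"
  shows "cls (x # u) = cls [x] \<otimes>\<^bsub>pres\<^esub> cls u"
  using assms mult_presented_group[of "[x]" u] by simp

lemma insertion_step_cls_eq:
  assumes "(u, v) \<in> insertion_steps S rels"
  shows "cls v = cls u"
proof -
  have "(u, v) \<in> word_equiv S rels"
    using assms unfolding word_equiv_def by blast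
  then show ?thesis
    using cls_eq_iff[of u v] by (simp only: simp_thms)
qed

lemma cancel_inverse_letters:
  assumes "s \<in> S"
  shows "cls [(s, b), (s, \<not> b)] = cls []"
proof -
  have "([] @ [], [] @ [(s, b), (s, \<not> b)] @ []) \<in> insertion_steps S rels"
    unfolding insertion_steps_def using assms by (blast intro: Nil_words)
  then show ?thesis
    using insertion_step_cls_eq by fastforce
qed

lemma relator_eq_one:
  assumes "w \<in> rels"
  shows "cls w = cls []"
proof -
  have "([] @ [], [] @ w @ []) \<in> insertion_steps S rels"
    unfolding insertion_steps_def using assms by (blast intro: Nil_words)
  then show ?thesis
    using insertion_step_cls_eq by fastforce
qed

text \<open>\<open>groupI\<close> asks for left inverses only. The inverse of each new first letter
  goes to the end of \<open>v\<close>, where it meets that letter.\<close>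

lemma presented_group_left_inverse:
  assumes "u \<in> words S"
  shows "\<exists>v\<in>words S. cls (v @ u) = cls []"
  using assms
proof (induction u)
  case (Cons x u)
  obtain s b where x: "x = (s, b)" by force
  obtain v where v: "v \<in> words S" "cls (v @ u) = cls []"
    using Cons by auto
  have s: "s \<in> S" using Cons.prems x by simp
  \<comment> \<open>The cancelling pair starts with \<open>\<not> b\<close>, so that its second
    letter is \<open>x\<close> itself.\<close>
  have "([(s, \<not> b), (s, \<not> \<not> b)], []) \<in> word_equiv S rels"
    using cancel_inverse_letters[OF s] by (simp only: cls_eq_iff)
  from word_equiv_append[OF this v(1), of u]
  have "(v @ [(s, \<not> b), x] @ u, v @ [] @ u) \<in> word_equiv S rels"
    using Cons.prems x by simp
  then have "cls (v @ [(s, \<not> b), x] @ u) = cls (v @ [] @ u)"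
    by (simp only: cls_eq_iff)
  with v have "cls ((v @ [(s, \<not> b)]) @ x # u) = cls []"
    by simp
  moreover have "v @ [(s, \<not> b)] \<in> words S"
    using v s by simp
  ultimately show ?case
    by blast
qed (use Nil_words in force)

lemma group_presented_group: "group pres"
proof (rule groupI)
  fix x y z
  assume "x \<in> carrier pres" "y \<in> carrier pres" "z \<in> carrier pres"
  then show "x \<otimes>\<^bsub>pres\<^esub> y \<otimes>\<^bsub>pres\<^esub> z = x \<otimes>\<^bsub>pres\<^esub> (y \<otimes>\<^bsub>pres\<^esub> z)"
    by (auto simp: carrier_presented_group mult_presented_group)
next
  fix x
  assume "x \<in> carrier pres"
  then obtain u where u: "x = cls u" "u \<in> words S"
    by (auto simp: carrier_presented_group)
  obtain v where v: "v \<in> words S" "cls (v @ u) = cls []"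
    using presented_group_left_inverse[OF u(2)] by auto
  then show "\<exists>y\<in>carrier pres. y \<otimes>\<^bsub>pres\<^esub> x = \<one>\<^bsub>pres\<^esub>"
    using u by (intro bexI[of _ "cls v"])
      (auto simp: carrier_presented_group mult_presented_group one_presented_group)
qed (auto simp: carrier_presented_group mult_presented_group one_presented_group)

lemma generate_presented_group: "generate pres ((\<lambda>s. cls [(s, True)]) ` S) = carrier pres"
  (is "?K = _")
proof
  interpret group pres by (rule group_presented_group)
  have sub: "(\<lambda>s. cls [(s, True)]) ` S \<subseteq> carrier pres"
    by (auto simp: carrier_presented_group)
  then show "?K \<subseteq> carrier pres"
    by (rule generate_incl)
  \<comment> \<open>\<open>generate\<close> adjoins inverses of the positive letters, so a negative
    letter has to be recognized as such an inverse.\<close>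
  have letter: "cls [(s, b)] \<in> ?K" if s: "s \<in> S" for s b
  proof (cases b)
    case True
    then show ?thesis using s by (auto intro: generate.incl)
  next
    case False
    have "cls [(s, False)] \<otimes>\<^bsub>pres\<^esub> cls [(s, True)] = \<one>\<^bsub>pres\<^esub>"
      using s cancel_inverse_letters[OF s, of False]
      by (simp add: mult_presented_group one_presented_group)
    moreover have "cls [(s, c)] \<in> carrier pres" for c
      using s by (auto simp: carrier_presented_group)
    ultimately have "inv\<^bsub>pres\<^esub> cls [(s, True)] = cls [(s, False)]"
      using inv_equality by blast
    then show ?thesis using s False generate.inv[of "cls [(s, True)]" _ pres] by auto
  qed
  have "cls w \<in> ?K" if "w \<in> words S" for w
    using that
  proof (induction w)
    case Nil
    show ?case
      using generate.one[of pres] by (simp add: one_presented_group)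
  next
    case (Cons x w)
    have "cls [x] \<in> ?K"
      using letter[of "fst x" "snd x"] Cons.prems by simp
    then show ?case
      using Cons by (simp add: Cons_mult_presented_group[OF Cons.prems] generate.eng)
  qed
  then show "carrier pres \<subseteq> ?K"
    by (auto simp: carrier_presented_group)
qed

end

section \<open>Universal property of a presentation\<close>

fun word_value :: "('h, 'z) monoid_scheme \<Rightarrow> ('s \<Rightarrow> 'h) \<Rightarrow> ('s \<times> bool) list \<Rightarrow> 'h" where
  "word_value H a [] = \<one>\<^bsub>H\<^esub>"
| "word_value H a ((s, b) # w) = (if b then a s else inv\<^bsub>H\<^esub> (a s)) \<otimes>\<^bsub>H\<^esub> word_value H a w"

context presentation
begin

context
  fixes H :: "('h, 'z) monoid_scheme" and a :: "'s \<Rightarrow> 'h"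
  assumes group_H: "group H" and a_closed: "\<And>s. s \<in> S \<Longrightarrow> a s \<in> carrier H"
begin

interpretation H: group H by (rule group_H)

lemma word_value_closed: "w \<in> words S \<Longrightarrow> word_value H a w \<in> carrier H"
proof (induction w)
  case (Cons x w)
  then show ?case by (cases x) (auto simp: a_closed)
qed simp

lemma word_value_append:
  "u \<in> words S \<Longrightarrow> v \<in> words S \<Longrightarrow>
    word_value H a (u @ v) = word_value H a u \<otimes>\<^bsub>H\<^esub> word_value H a v"
proof (induction u)
  case (Cons x u)
  then show ?case
    by (cases x) (auto simp: a_closed word_value_closed H.m_assoc)
qed (simp add: word_value_closed)

text \<open>An insertion step inserts a subword of value one: a relator by hypothesis, a cancelling
  pair by the inverse law.\<close>

lemma word_value_word_equiv:
  assumes rels_one: "\<And>w. w \<in> rels \<Longrightarrow> word_value H a w = \<one>\<^bsub>H\<^esub>"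
    and "(u, v) \<in> word_equiv S rels"
  shows "word_value H a u = word_value H a v"
proof -
  have step: "word_value H a u = word_value H a v" if uv: "(u, v) \<in> insertion_steps S rels" for u v
  proof -
    obtain u1 u2 w where *: "u = u1 @ u2" "v = u1 @ w @ u2" "u1 \<in> words S" "u2 \<in> words S"
      "w \<in> rels \<union> {[(s, b), (s, \<not> b)] | s b. s \<in> S}"
      using uv by (auto simp: insertion_steps_def)
    have "w \<in> words S" "word_value H a w = \<one>\<^bsub>H\<^esub>"
      using *(5) rels_words by (auto simp: rels_one a_closed)
    then show ?thesis
      using * by (simp add: word_value_append word_value_closed)
  qed
  from assms(2) show ?thesis
    unfolding word_equiv_def by (induction rule: rtrancl_induct) (auto dest!: step)
qed

lemma presented_group_universal:
  assumes rels_one: "\<And>w. w \<in> rels \<Longrightarrow> word_value H a w = \<one>\<^bsub>H\<^esub>"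
  obtains \<psi> where "\<psi> \<in> hom pres H" "\<And>s. s \<in> S \<Longrightarrow> \<psi> (cls [(s, True)]) = a s"
proof
  \<comment> \<open>Evaluation of an arbitrarily chosen representative;
    \<open>word_value_word_equiv\<close> makes the choice irrelevant.\<close>
  define \<psi> where "\<psi> X = word_value H a (SOME u. u \<in> words S \<and> X = cls u)" for X
  have \<psi>: "\<psi> (cls u) = word_value H a u" if "u \<in> words S" for u
  proof -
    let ?v = "SOME v. v \<in> words S \<and> cls u = cls v"
    have "?v \<in> words S \<and> cls u = cls ?v"
      by (rule someI[of _ u]) (use that in simp)
    then have "(u, ?v) \<in> word_equiv S rels"
      by (simp only: cls_eq_iff)
    from word_value_word_equiv[OF rels_one this] show ?thesis
      unfolding \<psi>_def by simp
  qed
  show "\<psi> \<in> hom pres H"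
    by (rule homI)
      (auto simp: carrier_presented_group \<psi> word_value_closed mult_presented_group word_value_append)
  show "\<psi> (cls [(s, True)]) = a s" if "s \<in> S" for s
    using that by (simp add: \<psi> a_closed)
qed

end

end

section \<open>Free products of cyclic groups\<close>

lemma presentation_cyclic: "presentation {..<d} (cyclic_relators d m)"
  by unfold_locales (auto simp: cyclic_relators_def words_def)

lemma group_free_product_cyclic: "group (free_product_cyclic d m)"
  unfolding free_product_cyclic_def
  by (rule presentation.group_presented_group[OF presentation_cyclic])

lemma generate_free_product_gen:
  "generate (free_product_cyclic d m) (free_product_gen d m ` {..<d}) =
     carrier (free_product_cyclic d m)"
  unfolding free_product_cyclic_def free_product_gen_def
  by (rule presentation.generate_presented_group[OF presentation_cyclic])

lemma free_product_gen_closed: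
  "i < d \<Longrightarrow> free_product_gen d m i \<in> carrier (free_product_cyclic d m)"
  using generate.incl[of "free_product_gen d m i" "free_product_gen d m ` {..<d}"
    "free_product_cyclic d m"] by (simp add: generate_free_product_gen)

lemma word_value_replicate:
  fixes n :: nat
  assumes "group H" "a s \<in> carrier H"
  shows "word_value H a (replicate n (s, True)) = a s [^]\<^bsub>H\<^esub> n"
proof -
  interpret group H by fact
  show ?thesis
    by (induction n) (use assms nat_pow_Suc2 in \<open>auto simp del: nat_pow_Suc\<close>)
qed

lemma free_product_gen_pow:
  assumes "i < d"
  shows "free_product_gen d m i [^]\<^bsub>free_product_cyclic d m\<^esub> m i = \<one>\<^bsub>free_product_cyclic d m\<^esub>"
proof -
  interpret presentation "{..<d}" "cyclic_relators d m" by (rule presentation_cyclic)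
  interpret group pres by (rule group_presented_group)
  have "cls [(i, True)] [^]\<^bsub>pres\<^esub> n = cls (replicate n (i, True))" for n :: nat
  proof (induction n)
    case (Suc n)
    have "replicate n (i, True) \<in> words {..<d}"
      using assms by (auto simp: words_def)
    with Suc show ?case
      using assms by (simp add: mult_presented_group replicate_append_same del: replicate.simps)
         (simp add: replicate_append_same)
  qed (simp add: one_presented_group)
  moreover have "replicate (m i) (i, True) \<in> cyclic_relators d m"
    using assms by (auto simp: cyclic_relators_def)
  ultimately show ?thesis
    unfolding free_product_cyclic_def free_product_gen_def
    by (simp add: relator_eq_one one_presented_group)
qed

lemma free_product_cyclic_universal:
  assumes H: "group H" and a: "\<And>i. i < d \<Longrightarrow> a i \<in> carrier H"
    and pow: "\<And>i. i < d \<Longrightarrow> a i [^]\<^bsub>H\<^esub> m i = \<one>\<^bsub>H\<^esub>"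
  obtains \<psi> where "\<psi> \<in> hom (free_product_cyclic d m) H"
    "\<And>i. i < d \<Longrightarrow> \<psi> (free_product_gen d m i) = a i"
proof -
  have "word_value H a w = \<one>\<^bsub>H\<^esub>" if "w \<in> cyclic_relators d m" for w
    using that by (auto simp: cyclic_relators_def word_value_replicate H a pow)
  then obtain \<psi> where "\<psi> \<in> hom (presented_group {..<d} (cyclic_relators d m)) H"
    "\<And>i. i \<in> {..<d} \<Longrightarrow> \<psi> (word_equiv {..<d} (cyclic_relators d m) `` {[(i, True)]}) = a i"
    using presentation.presented_group_universal[OF presentation_cyclic H, of d a m] a by auto
  then show thesis
    by (intro that) (auto simp: free_product_cyclic_def free_product_gen_def)
qed

section \<open>Finiteness of central extensions\<close>

context group
begin

definition word_prod :: "'a list \<Rightarrow> 'a" where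
  "word_prod w = foldr (\<otimes>) w \<one>"

lemma word_prod_Nil [simp]: "word_prod [] = \<one>"
  and word_prod_Cons [simp]: "word_prod (x # w) = x \<otimes> word_prod w"
  by (simp_all add: word_prod_def)

lemma word_prod_closed [simp]: "set w \<subseteq> carrier G \<Longrightarrow> word_prod w \<in> carrier G"
  by (induction w) auto

lemma word_prod_append:
  "set u \<subseteq> carrier G \<Longrightarrow> set v \<subseteq> carrier G \<Longrightarrow> word_prod (u @ v) = word_prod u \<otimes> word_prod v"
  by (induction u) (auto simp: m_assoc)

text \<open>Moving \<open>x\<close> from the back of a word to the front costs a conjugation of
  every letter. Over a conjugation-closed alphabet the result is again a word over that alphabet, of
  the same length.\<close>

lemma word_prod_conjugate:
  assumes x: "x \<in> carrier G"
  shows "set u \<subseteq> carrier G \<Longrightarrow>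
    word_prod u \<otimes> x = x \<otimes> word_prod (map (\<lambda>y. inv x \<otimes> y \<otimes> x) u)"
proof (induction u)
  case (Cons y u)
  have "word_prod (y # u) \<otimes> x = y \<otimes> (word_prod u \<otimes> x)"
    using Cons.prems x by (simp add: m_assoc)
  also have "\<dots> = y \<otimes> (x \<otimes> word_prod (map (\<lambda>y. inv x \<otimes> y \<otimes> x) u))"
    using Cons by simp
  also have "\<dots> = x \<otimes> ((inv x \<otimes> y \<otimes> x) \<otimes> word_prod (map (\<lambda>y. inv x \<otimes> y \<otimes> x) u))"
  proof -
    have c: "word_prod (map (\<lambda>y. inv x \<otimes> y \<otimes> x) u) \<in> carrier G"
      by (rule word_prod_closed) (use Cons.prems x in auto)
    have "x \<otimes> (inv x \<otimes> t) = t" if "t \<in> carrier G" for t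
      using that x by (simp add: m_assoc[symmetric])
    then show ?thesis
      using Cons.prems x c by (simp add: m_assoc)
  qed
  finally show ?case by simp
qed (use x in simp)

context
  fixes X assumes X: "X \<subseteq> carrier G"
    and conj: "\<And>x g. x \<in> X \<Longrightarrow> g \<in> carrier G \<Longrightarrow> g \<otimes> x \<otimes> inv g \<in> X"
begin

text \<open>The length equation is what matters later: once \<open>x [^] n\<close> is cancelled, a
  strictly shorter word for the same element remains.\<close>

lemma word_prod_move_to_front:
  "set w \<subseteq> X \<Longrightarrow> k \<le> count_list w x \<Longrightarrow> x \<in> X \<Longrightarrow>
    \<exists>v. set v \<subseteq> X \<and> word_prod w = x [^] k \<otimes> word_prod v \<and> length w = length v + k"
proof (induction k arbitrary: w)
  case 0
  then have "word_prod w \<in> carrier G"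
    using X by auto
  with 0 show ?case by (intro exI[of _ w]) simp
next
  case (Suc k)
  have x: "x \<in> carrier G"
    using Suc.prems X by auto
  have "x \<in> set w"
    by (rule ccontr) (use Suc.prems(2) in simp)
  \<comment> \<open>Splitting at the first occurrence keeps all other copies of \<open>x\<close> in
    \<open>v\<close>, which is left untouched when \<open>u\<close> is conjugated.\<close>
  then obtain u v where w: "w = u @ x # v" "x \<notin> set u"
    by (meson split_list_first)
  let ?u = "map (\<lambda>y. inv x \<otimes> y \<otimes> x) u"
  have u: "set ?u \<subseteq> X"
    using conj[of _ "inv x"] x Suc.prems(1) w by auto
  have uv: "set u \<subseteq> carrier G" "set v \<subseteq> carrier G" "set ?u \<subseteq> carrier G"
    using Suc.prems(1) w X u by auto
  have "k \<le> count_list (?u @ v) x"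
    using Suc.prems(2) w by simp
  moreover have "set (?u @ v) \<subseteq> X"
    using u Suc.prems(1) w by simp
  ultimately obtain t where t: "set t \<subseteq> X" "word_prod (?u @ v) = x [^] k \<otimes> word_prod t"
      "length (?u @ v) = length t + k"
    using Suc.IH Suc.prems(3) by blast
  have "word_prod w = (word_prod u \<otimes> x) \<otimes> word_prod v"
    using w uv x by (simp add: word_prod_append m_assoc)
  also have "\<dots> = x \<otimes> word_prod (?u @ v)"
    using uv x by (simp add: word_prod_conjugate word_prod_append m_assoc del: set_map)
  also have "\<dots> = (x \<otimes> x [^] k) \<otimes> word_prod t"
    using t(2) word_prod_closed[of t] t(1) X x by (simp add: m_assoc)
  also have "\<dots> = x [^] Suc k \<otimes> word_prod t"
    by (simp only: nat_pow_Suc2[OF x])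
  finally show ?case
    using t w by (intro exI[of _ t]) simp
qed

text \<open>
  Dietzmann's lemma: a shortest word for an element contains each letter fewer than \<open>n\<close> times,
  because \<open>n\<close> equal letters can be collected at the front and cancelled.
\<close>

lemma finite_generate_conjugation_closed:
  assumes fin: "finite X" and n: "0 < (n::nat)" and pow: "\<And>x. x \<in> X \<Longrightarrow> x [^] n = \<one>"
  shows "finite (generate G X)"
proof -
  have short: "\<exists>v. set v \<subseteq> X \<and> word_prod v = word_prod w \<and> length v \<le> card X * n"
    if "set w \<subseteq> X" for w
    using that
  proof (induction "length w" arbitrary: w rule: less_induct)
    case less
    show ?case
    proof (cases "\<exists>x\<in>X. n \<le> count_list w x")
      case True
      then obtain x where x: "x \<in> X" "n \<le> count_list w x" by auto
      then obtain v where v: "set v \<subseteq> X" "word_prod w = x [^] n \<otimes> word_prod v"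
          "length w = length v + n"
        using word_prod_move_to_front less.prems by blast
      have "word_prod w = word_prod v"
        using v X pow[OF x(1)] by simp
      moreover have "length v < length w"
        using v n by simp
      ultimately show ?thesis
        using less.hyps[of v] v(1) by auto
    next
      \<comment> \<open>Here each letter occurs fewer than \<open>n\<close> times, and the length is
        the sum of the multiplicities.\<close>
      case False
      then have "sum (count_list w) X \<le> card X * n"
        using sum_bounded_above[of X "count_list w" n] by fastforce
      then show ?thesis
        using sum_count_set[OF less.prems fin] less.prems by auto
    qed
  qed
  have words: "\<exists>w. set w \<subseteq> X \<and> g = word_prod w" if "g \<in> generate G X" for g
    using that
  proof (induction rule: generate.induct)
    case one
    show ?case by (intro exI[of _ "[]"]) simp
  next
    case (incl h)
    then show ?case using X by (intro exI[of _ "[h]"]) auto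
  next
    case (inv h)
    have h: "h \<in> carrier G" using inv X by auto
    \<comment> \<open>Words have positive letters only, so an inverse is spelled as the power with
      exponent \<open>n - 1\<close>.\<close>
    have "h [^] (n - 1) \<otimes> h = \<one>"
      using pow[OF inv] n nat_pow_Suc[of h "n - 1"] by simp
    then have eq: "inv h = h [^] (n - 1)"
      using h inv_equality by simp
    have "word_prod (replicate k h) = h [^] k" for k
      by (induction k) (use h nat_pow_Suc2 in \<open>auto simp del: nat_pow_Suc\<close>)
    then show ?case
      using inv eq by (intro exI[of _ "replicate (n - 1) h"]) auto
  next
    case (eng h1 h2)
    then obtain u v where "set u \<subseteq> X" "h1 = word_prod u" "set v \<subseteq> X" "h2 = word_prod v"
      by auto
    then show ?case
      using X word_prod_append[of u v] by (intro exI[of _ "u @ v"]) auto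
  qed
  have "generate G X \<subseteq> word_prod ` {w. set w \<subseteq> X \<and> length w \<le> card X * n}"
  proof
    fix g assume "g \<in> generate G X"
    then obtain w where "set w \<subseteq> X" "g = word_prod w"
      using words by blast
    with short[of w] obtain v where "set v \<subseteq> X" "g = word_prod v" "length v \<le> card X * n"
      by auto
    then show "g \<in> word_prod ` {w. set w \<subseteq> X \<and> length w \<le> card X * n}"
      by blast
  qed
  then show ?thesis
    using finite_lists_length_le[OF fin] finite_surj by blast
qed

end

end

text \<open>The kernel being central, conjugation by \<open>z\<close> depends only on
  \<open>\<pi> z\<close>. With \<open>G\<close> and \<open>H\<close> finite, the elements of
  \<open>H\<close> have finitely many conjugates, all of finite order, and Dietzmann's lemma applies
  to the set \<open>X\<close> of these conjugates.\<close>

lemma finite_central_extension: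
  assumes E: "group E" and G: "group G" "finite (carrier G)"
    and \<pi>: "\<pi> \<in> epi E G"
    and central: "\<And>a x. a \<in> kernel E G \<pi> \<Longrightarrow> x \<in> carrier E \<Longrightarrow> a \<otimes>\<^bsub>E\<^esub> x = x \<otimes>\<^bsub>E\<^esub> a"
    and gens: "generate E H = carrier E" "H \<subseteq> carrier E" "finite H"
    and torsion: "\<And>x. x \<in> H \<Longrightarrow> \<exists>n::nat. 0 < n \<and> x [^]\<^bsub>E\<^esub> n = \<one>\<^bsub>E\<^esub>"
  shows "finite (carrier E)"
proof -
  interpret E: group E by fact
  interpret group_hom E G \<pi>
    using E G \<pi> by (simp add: group_hom_def group_hom_axioms_def epi_def)
  define c where "c x z = z \<otimes>\<^bsub>E\<^esub> x \<otimes>\<^bsub>E\<^esub> inv\<^bsub>E\<^esub> z" for x z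
  have c_closed: "c x z \<in> carrier E" if "x \<in> carrier E" "z \<in> carrier E" for x z
    using that by (simp add: c_def)
  define X where "X = (\<lambda>(x, z). c x z) ` (H \<times> carrier E)"
  have c_eq: "c x z = c x z'" if "x \<in> H" "z \<in> carrier E" "z' \<in> carrier E" "\<pi> z = \<pi> z'" for x z z'
  proof -
    define a where "a = inv\<^bsub>E\<^esub> z \<otimes>\<^bsub>E\<^esub> z'"
    have x: "x \<in> carrier E" using that gens by auto
    have a: "a \<in> carrier E" "a \<in> kernel E G \<pi>"
      using that by (auto simp: a_def kernel_def)
    have z': "z' = z \<otimes>\<^bsub>E\<^esub> a"
      using that by (simp add: a_def E.m_assoc[symmetric])
    have "c x z' = z \<otimes>\<^bsub>E\<^esub> (a \<otimes>\<^bsub>E\<^esub> x \<otimes>\<^bsub>E\<^esub> inv\<^bsub>E\<^esub> a) \<otimes>\<^bsub>E\<^esub> inv\<^bsub>E\<^esub> z"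
      using x a(1) that(2) unfolding z' c_def by (simp add: E.inv_mult_group E.m_assoc)
    also have "a \<otimes>\<^bsub>E\<^esub> x \<otimes>\<^bsub>E\<^esub> inv\<^bsub>E\<^esub> a = x"
      using a x by (simp add: central[OF a(2) x] E.m_assoc)
    finally show ?thesis by (simp add: c_def)
  qed
  have "finite (c x ` carrier E)" if x: "x \<in> H" for x
  proof -
    have "c x ` carrier E \<subseteq> (\<lambda>g. c x (inv_into (carrier E) \<pi> g)) ` carrier G"
    proof
      fix y assume "y \<in> c x ` carrier E"
      then obtain z where z: "z \<in> carrier E" "y = c x z" by auto
      let ?z = "inv_into (carrier E) \<pi> (\<pi> z)"
      have "?z \<in> carrier E" "\<pi> ?z = \<pi> z"
        using z(1) by (auto intro: inv_into_into f_inv_into_f)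
      then have "y = c x ?z"
        using c_eq[OF x z(1)] z(2) by simp
      then show "y \<in> (\<lambda>g. c x (inv_into (carrier E) \<pi> g)) ` carrier G"
        using z(1) by auto
    qed
    then show ?thesis
      using G(2) finite_surj by blast
  qed
  moreover have "X = (\<Union>x\<in>H. c x ` carrier E)"
    by (auto simp: X_def)
  ultimately have finX: "finite X"
    using gens(3) by simp
  have XE: "X \<subseteq> carrier E"
    using c_closed gens(2) by (auto simp: X_def)
  have HX: "H \<subseteq> X"
  proof
    fix x assume "x \<in> H"
    then show "x \<in> X"
      using gens(2) by (auto simp: X_def c_def intro!: image_eqI[of _ _ "(x, \<one>\<^bsub>E\<^esub>)"])
  qed
  have conj: "g \<otimes>\<^bsub>E\<^esub> x \<otimes>\<^bsub>E\<^esub> inv\<^bsub>E\<^esub> g \<in> X" if x: "x \<in> X" and "g \<in> carrier E" for x g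
  proof -
    obtain y z where yz: "x = c y z" "y \<in> H" "z \<in> carrier E"
      using x by (auto simp: X_def)
    then have "g \<otimes>\<^bsub>E\<^esub> x \<otimes>\<^bsub>E\<^esub> inv\<^bsub>E\<^esub> g = c y (g \<otimes>\<^bsub>E\<^esub> z)"
      using \<open>g \<in> carrier E\<close> gens(2) by (auto simp: c_def E.inv_mult_group E.m_assoc)
    then show ?thesis
      using yz \<open>g \<in> carrier E\<close> by (auto simp: X_def)
  qed
  obtain o' where o': "\<And>x. x \<in> H \<Longrightarrow> 0 < (o' x :: nat) \<and> x [^]\<^bsub>E\<^esub> o' x = \<one>\<^bsub>E\<^esub>"
    using torsion by metis
  \<comment> \<open>A common exponent for \<open>H\<close>, inherited by all conjugates because
    powers commute with conjugation.\<close>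
  define n where "n = (\<Prod>x\<in>H. o' x)"
  have "0 < n"
    using o' by (auto simp: n_def intro: prod_pos)
  have powH: "x [^]\<^bsub>E\<^esub> n = \<one>\<^bsub>E\<^esub>" if "x \<in> H" for x
  proof -
    have "o' x dvd n"
      unfolding n_def using that gens(3) by (rule dvd_prodI[rotated])
    then obtain k where "n = o' x * k" ..
    then show ?thesis
      using o'[OF that] that gens(2) E.nat_pow_pow[of x "o' x" k] by auto
  qed
  have c_pow: "c x z [^]\<^bsub>E\<^esub> k = c (x [^]\<^bsub>E\<^esub> k) z" if "x \<in> carrier E" "z \<in> carrier E" for x z and k :: nat
  proof (induction k)
    case (Suc k)
    have "c x z [^]\<^bsub>E\<^esub> Suc k = c (x [^]\<^bsub>E\<^esub> k) z \<otimes>\<^bsub>E\<^esub> c x z"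
      using Suc by simp
    also have "\<dots> = z \<otimes>\<^bsub>E\<^esub> (x [^]\<^bsub>E\<^esub> k) \<otimes>\<^bsub>E\<^esub> (inv\<^bsub>E\<^esub> z \<otimes>\<^bsub>E\<^esub> z) \<otimes>\<^bsub>E\<^esub> x \<otimes>\<^bsub>E\<^esub> inv\<^bsub>E\<^esub> z"
      using that unfolding c_def by (simp only: E.m_assoc E.m_closed E.inv_closed E.nat_pow_closed)
    also have "\<dots> = c (x [^]\<^bsub>E\<^esub> Suc k) z"
      using that by (simp add: c_def E.m_assoc)
    finally show ?case .
  qed (use that in \<open>simp add: c_def\<close>)
  have "x [^]\<^bsub>E\<^esub> n = \<one>\<^bsub>E\<^esub>" if x: "x \<in> X" for x
  proof -
    obtain y z where yz: "x = c y z" "y \<in> H" "z \<in> carrier E"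
      using x by (auto simp: X_def)
    then show ?thesis
      using c_pow[of y z n] gens(2) powH by (auto simp: c_def)
  qed
  then have "finite (generate E X)"
    using E.finite_generate_conjugation_closed[OF XE conj finX \<open>0 < n\<close>] by blast
  moreover have "carrier E \<subseteq> generate E X"
    using E.mono_generate[OF HX] gens(1) by simp
  ultimately show ?thesis
    by (rule finite_subset[rotated])
qed

text \<open>The order of the group shows that the set minimized by \<open>LEAST\<close> is
  nonempty.\<close>

lemma (in group) finite_group_exp:
  assumes "finite (carrier G)"
  shows "0 < group_exp G" "x \<in> carrier G \<Longrightarrow> x [^] group_exp G = \<one>"
proof -
  have "0 < order G \<and> (\<forall>x\<in>carrier G. x [^] order G = \<one>)"
    using assms pow_order_eq_1 order_gt_0_iff_finite by blast
  then have *: "0 < group_exp G \<and> (\<forall>x\<in>carrier G. x [^] group_exp G = \<one>)"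
    unfolding group_exp_def by (rule LeastI)
  then show "0 < group_exp G" "x \<in> carrier G \<Longrightarrow> x [^] group_exp G = \<one>"
    by auto
qed

text \<open>Each nonempty fibre is a translate of the kernel. \<open>is_cover\<close> provides a
  finite kernel, while \<open>finite_group_exp\<close> asks for a finite group.\<close>

lemma (in group_hom) finite_carrier_if_finite_kernel:
  assumes "finite (kernel G H h)" "finite (carrier H)"
  shows "finite (carrier G)"
proof -
  have "finite {x \<in> carrier G. h x = y}" for y
  proof (cases "\<exists>z\<in>carrier G. h z = y")
    case True
    then obtain z where z: "z \<in> carrier G" "h z = y" by auto
    have "{x \<in> carrier G. h x = y} \<subseteq> (\<lambda>a. a \<otimes> z) ` kernel G H h"
    proof
      fix x assume x: "x \<in> {x \<in> carrier G. h x = y}"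
      then have "x = (x \<otimes> inv z) \<otimes> z" "x \<otimes> inv z \<in> kernel G H h"
        using z by (auto simp: kernel_def G.m_assoc)
      then show "x \<in> (\<lambda>a. a \<otimes> z) ` kernel G H h" by blast
    qed
    then show ?thesis
      using assms(1) finite_surj by blast
  next
    case False
    then have "{x \<in> carrier G. h x = y} = {}" by blast
    then show ?thesis by (simp only: finite.emptyI)
  qed
  moreover have "carrier G \<subseteq> (\<Union>y\<in>carrier H. {x \<in> carrier G. h x = y})"
    by auto
  ultimately show ?thesis
    using assms(2) by (meson finite_UN finite_subset)
qed

section \<open>Characters\<close>

text \<open>Characters of a subgroup \<open>B\<close>, as total functions with arbitrary values off
  \<open>B\<close>. The values on \<open>B\<close> are automatically nonzero, since \<open>B\<close>
  is a group and 1 is sent to 1.\<close>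

definition partial_character :: "('a, 'b) monoid_scheme \<Rightarrow> 'a set \<Rightarrow> ('a \<Rightarrow> complex) \<Rightarrow> bool" where
  "partial_character A B \<theta> \<longleftrightarrow>
     subgroup B A \<and> \<theta> \<one>\<^bsub>A\<^esub> = 1 \<and> (\<forall>x\<in>B. \<forall>y\<in>B. \<theta> (x \<otimes>\<^bsub>A\<^esub> y) = \<theta> x * \<theta> y)"

lemma (in group) subgroup_if_submonoid:
  assumes "finite (carrier G)" "B \<subseteq> carrier G" "\<one> \<in> B"
    and closed: "\<And>x y. x \<in> B \<Longrightarrow> y \<in> B \<Longrightarrow> x \<otimes> y \<in> B"
  shows "subgroup B G"
proof (rule subgroupI)
  fix x assume x: "x \<in> B"
  then have xG: "x \<in> carrier G" using assms by auto
  have pow: "x [^] n \<in> B" for n :: nat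
    by (induction n) (auto intro: closed x assms)
  have "0 < order G"
    using assms(1) order_gt_0_iff_finite by blast
  then have "x [^] (order G - 1) \<otimes> x = \<one>"
    using pow_order_eq_1[OF xG] nat_pow_Suc[of x "order G - 1"] by simp
  then have "inv x = x [^] (order G - 1)"
    using xG inv_equality by simp
  then show "inv x \<in> B"
    using pow by simp
qed (use assms in auto)

lemma partial_character_pow:
  assumes "group A" "partial_character A B \<theta>" "x \<in> B"
  shows "\<theta> (x [^]\<^bsub>A\<^esub> (n::nat)) = \<theta> x ^ n" "x [^]\<^bsub>A\<^esub> n \<in> B"
proof -
  interpret group A by fact
  interpret subgroup B A using assms by (simp add: partial_character_def)
  have "\<theta> (x [^]\<^bsub>A\<^esub> n) = \<theta> x ^ n \<and> x [^]\<^bsub>A\<^esub> n \<in> B"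
    by (induction n) (use assms in \<open>auto simp: partial_character_def mult.commute\<close>)
  then show "\<theta> (x [^]\<^bsub>A\<^esub> n) = \<theta> x ^ n" "x [^]\<^bsub>A\<^esub> n \<in> B" by auto
qed

text \<open>One step of extending a character, to the subgroup generated by \<open>B\<close> and
  \<open>x\<close>. Here \<open>k\<close> is the order of \<open>x\<close> modulo \<open>B\<close>,
  and any \<open>k\<close>-th root of the value already fixed at \<open>x^k\<close> is admissible at
  \<open>x\<close>. The freedom in \<open>z\<close> is kept because the separating character starts
  from a particular root.\<close>

lemma partial_character_extend:
  assumes A: "comm_group A" "finite (carrier A)" and \<theta>: "partial_character A B \<theta>"
    and x: "x \<in> carrier A"
    and k: "0 < (k::nat)" "x [^]\<^bsub>A\<^esub> k \<in> B"
    and k_least: "\<And>j::nat. 0 < j \<Longrightarrow> x [^]\<^bsub>A\<^esub> j \<in> B \<Longrightarrow> k \<le> j"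
    and z: "z ^ k = \<theta> (x [^]\<^bsub>A\<^esub> k)"
  obtains B' \<theta>' where "partial_character A B' \<theta>'" "B \<subseteq> B'" "x \<in> B'" "\<theta>' x = z"
    "\<And>b. b \<in> B \<Longrightarrow> \<theta>' b = \<theta> b"
proof -
  interpret comm_group A by fact
  interpret subgroup B A using \<theta> by (simp add: partial_character_def)
  have chi: "\<theta> \<one>\<^bsub>A\<^esub> = 1" "\<And>x y. x \<in> B \<Longrightarrow> y \<in> B \<Longrightarrow> \<theta> (x \<otimes>\<^bsub>A\<^esub> y) = \<theta> x * \<theta> y"
    using \<theta> by (auto simp: partial_character_def)
  have pow: "\<theta> (x [^]\<^bsub>A\<^esub> n) = z ^ n" if n: "x [^]\<^bsub>A\<^esub> n \<in> B" for n :: nat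
  proof -
    \<comment> \<open>\<open>k\<close> divides every exponent \<open>n\<close> with
      \<open>x^n\<close> in \<open>B\<close>: a nonzero remainder would be a smaller positive
      exponent with this property.\<close>
    define q r where "q = n div k" and "r = n mod k"
    have n_eq: "n = k * q + r" by (simp add: q_def r_def)
    have q: "(x [^]\<^bsub>A\<^esub> k) [^]\<^bsub>A\<^esub> q \<in> B"
      using partial_character_pow[OF is_group \<theta> k(2)] by simp
    have "x [^]\<^bsub>A\<^esub> n = (x [^]\<^bsub>A\<^esub> k) [^]\<^bsub>A\<^esub> q \<otimes>\<^bsub>A\<^esub> x [^]\<^bsub>A\<^esub> r"
      using x by (simp add: n_eq nat_pow_pow nat_pow_mult)
    then have "x [^]\<^bsub>A\<^esub> r = inv\<^bsub>A\<^esub> ((x [^]\<^bsub>A\<^esub> k) [^]\<^bsub>A\<^esub> q) \<otimes>\<^bsub>A\<^esub> x [^]\<^bsub>A\<^esub> n"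
      using x by (simp add: m_assoc[symmetric])
    then have "x [^]\<^bsub>A\<^esub> r \<in> B"
      using q n by simp
    then have "r = 0"
      using k_least[of r] k(1) by (metis mod_less_divisor not_gr_zero not_le r_def)
    then show ?thesis
      using partial_character_pow(1)[OF is_group \<theta> k(2), of q] x z
      by (simp add: n_eq nat_pow_pow power_mult)
  qed
  define B' where "B' = {b \<otimes>\<^bsub>A\<^esub> x [^]\<^bsub>A\<^esub> j | b (j::nat). b \<in> B}"
  define \<theta>' where "\<theta>' y = (case SOME p. fst p \<in> B \<and> y = fst p \<otimes>\<^bsub>A\<^esub> x [^]\<^bsub>A\<^esub> (snd p :: nat) of
      (b, j) \<Rightarrow> \<theta> b * z ^ j)" for y
  \<comment> \<open>Two decompositions of an element differ by a power of \<open>x\<close> lying in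
    \<open>B\<close>, where \<open>pow\<close> applies. Exponents are natural numbers, hence the
    assumption \<open>i \<le> j\<close>.\<close>
  have aux: "\<theta> b * z ^ i = \<theta> b' * z ^ j"
    if "b \<in> B" "b' \<in> B" "b \<otimes>\<^bsub>A\<^esub> x [^]\<^bsub>A\<^esub> i = b' \<otimes>\<^bsub>A\<^esub> x [^]\<^bsub>A\<^esub> j" "i \<le> j" for b b' and i j :: nat
  proof -
    have bb: "b \<in> carrier A" "b' \<in> carrier A" using that by auto
    have "b \<otimes>\<^bsub>A\<^esub> x [^]\<^bsub>A\<^esub> i = b' \<otimes>\<^bsub>A\<^esub> x [^]\<^bsub>A\<^esub> (j - i) \<otimes>\<^bsub>A\<^esub> x [^]\<^bsub>A\<^esub> i"
      using that x bb by (simp add: m_assoc nat_pow_mult)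
    then have b: "b = b' \<otimes>\<^bsub>A\<^esub> x [^]\<^bsub>A\<^esub> (j - i)"
      using x bb by simp
    then have "x [^]\<^bsub>A\<^esub> (j - i) = inv\<^bsub>A\<^esub> b' \<otimes>\<^bsub>A\<^esub> b"
      using x bb by (simp add: m_assoc[symmetric])
    then have in_B: "x [^]\<^bsub>A\<^esub> (j - i) \<in> B"
      using that by simp
    have "\<theta> b = \<theta> b' * z ^ (j - i)"
      using chi(2)[OF that(2) in_B] pow[OF in_B] b by simp
    then show ?thesis
      using that(4) by (simp add: power_add[symmetric])
  qed
  have \<theta>': "\<theta>' (b \<otimes>\<^bsub>A\<^esub> x [^]\<^bsub>A\<^esub> j) = \<theta> b * z ^ j" if "b \<in> B" for b and j :: nat
  proof -
    let ?y = "b \<otimes>\<^bsub>A\<^esub> x [^]\<^bsub>A\<^esub> j"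
    let ?Q = "\<lambda>p. fst p \<in> B \<and> ?y = fst p \<otimes>\<^bsub>A\<^esub> x [^]\<^bsub>A\<^esub> (snd p :: nat)"
    obtain b' i where bi: "(SOME p. ?Q p) = (b', i)" by force
    have "?Q (SOME p. ?Q p)"
      by (rule someI[of ?Q "(b, j)"]) (use that in simp)
    then have "b' \<in> B" "?y = b' \<otimes>\<^bsub>A\<^esub> x [^]\<^bsub>A\<^esub> i"
      using bi by auto
    then have "\<theta> b * z ^ j = \<theta> b' * z ^ i"
      using aux[of b b' j i] aux[of b' b i j] that by (cases "j \<le> i") auto
    then show ?thesis
      by (simp add: \<theta>'_def bi)
  qed
  have mult: "(b \<otimes>\<^bsub>A\<^esub> x [^]\<^bsub>A\<^esub> i) \<otimes>\<^bsub>A\<^esub> (b' \<otimes>\<^bsub>A\<^esub> x [^]\<^bsub>A\<^esub> j) = (b \<otimes>\<^bsub>A\<^esub> b') \<otimes>\<^bsub>A\<^esub> x [^]\<^bsub>A\<^esub> (i + j)"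
    if "b \<in> B" "b' \<in> B" for b b' and i j :: nat
    using that x by (simp add: nat_pow_mult[symmetric] m_ac)
  have BB': "b \<in> B'" "\<theta>' b = \<theta> b" if "b \<in> B" for b
    using that \<theta>'[OF that, of 0] by (auto simp: B'_def intro!: exI[of _ b] exI[of _ 0])
  have xB': "x \<in> B'" "\<theta>' x = z"
    using x \<theta>'[OF one_closed, of 1] by (auto simp: B'_def chi intro!: exI[of _ "\<one>\<^bsub>A\<^esub>"] exI[of _ 1])
  have "subgroup B' A"
  proof (rule subgroup_if_submonoid[OF A(2)])
    show "B' \<subseteq> carrier A" using x by (auto simp: B'_def)
    show "\<one>\<^bsub>A\<^esub> \<in> B'" using BB' by simp
    show "u \<otimes>\<^bsub>A\<^esub> v \<in> B'" if "u \<in> B'" "v \<in> B'" for u v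
    proof -
      obtain b i b' j where "b \<in> B" "b' \<in> B" "u = b \<otimes>\<^bsub>A\<^esub> x [^]\<^bsub>A\<^esub> (i::nat)" "v = b' \<otimes>\<^bsub>A\<^esub> x [^]\<^bsub>A\<^esub> (j::nat)"
        using \<open>u \<in> B'\<close> \<open>v \<in> B'\<close> unfolding B'_def by blast
      then have "u \<otimes>\<^bsub>A\<^esub> v = (b \<otimes>\<^bsub>A\<^esub> b') \<otimes>\<^bsub>A\<^esub> x [^]\<^bsub>A\<^esub> (i + j)" "b \<otimes>\<^bsub>A\<^esub> b' \<in> B"
        using mult by auto
      then show ?thesis unfolding B'_def by blast
    qed
  qed
  moreover have "\<theta>' (u \<otimes>\<^bsub>A\<^esub> v) = \<theta>' u * \<theta>' v" if "u \<in> B'" "v \<in> B'" for u v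
  proof -
    obtain b i b' j where *: "b \<in> B" "b' \<in> B" "u = b \<otimes>\<^bsub>A\<^esub> x [^]\<^bsub>A\<^esub> (i::nat)" "v = b' \<otimes>\<^bsub>A\<^esub> x [^]\<^bsub>A\<^esub> (j::nat)"
      using \<open>u \<in> B'\<close> \<open>v \<in> B'\<close> unfolding B'_def by blast
    then show ?thesis
      using mult[OF *(1,2), of i j] \<theta>'[of "b \<otimes>\<^bsub>A\<^esub> b'" "i + j"]
      by (simp add: \<theta>' chi power_add)
  qed
  ultimately have "partial_character A B' \<theta>'"
    using BB'(2)[OF one_closed] chi(1) by (simp add: partial_character_def)
  with BB' xB' show thesis
    by (intro that[of B' \<theta>']) auto
qed

text \<open>Among the characters of subgroups that differ from 1 at \<open>a\<close>, one whose
  domain has maximal cardinality is defined everywhere: complex roots exist, so a proper domain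
  could be enlarged.\<close>

lemma exists_character_separating:
  assumes A: "comm_group A" "finite (carrier A)" and a: "a \<in> carrier A" "a \<noteq> \<one>\<^bsub>A\<^esub>"
  obtains \<theta> where "partial_character A (carrier A) \<theta>" "\<theta> a \<noteq> 1"
proof -
  interpret comm_group A by fact
  have least: "\<exists>k::nat. 0 < k \<and> x [^]\<^bsub>A\<^esub> k \<in> B \<and> (\<forall>j::nat. 0 < j \<longrightarrow> x [^]\<^bsub>A\<^esub> j \<in> B \<longrightarrow> k \<le> j)"
    if "subgroup B A" "x \<in> carrier A" for B x
  proof -
    have "x [^]\<^bsub>A\<^esub> order A \<in> B" "0 < order A"
      using that A(2) pow_order_eq_1[of x] subgroup.one_closed[of B A]
      by (simp_all add: order_gt_0_iff_finite)
    then have "\<exists>k::nat. 0 < k \<and> x [^]\<^bsub>A\<^esub> k \<in> B" by blast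
    then show ?thesis
      using LeastI_ex[of "\<lambda>k::nat. 0 < k \<and> x [^]\<^bsub>A\<^esub> k \<in> B"]
        Least_le[of "\<lambda>k::nat. 0 < k \<and> x [^]\<^bsub>A\<^esub> k \<in> B"] by blast
  qed
  define Q where "Q B \<longleftrightarrow> (\<exists>\<theta>. partial_character A B \<theta> \<and> a \<in> B \<and> \<theta> a \<noteq> 1)" for B
  have "\<exists>B. Q B"
  proof -
    have triv: "subgroup {\<one>\<^bsub>A\<^esub>} A"
      by (rule triv_subgroup)
    obtain k :: nat where k: "0 < k" "a [^]\<^bsub>A\<^esub> k \<in> {\<one>\<^bsub>A\<^esub>}"
        "\<And>j::nat. 0 < j \<Longrightarrow> a [^]\<^bsub>A\<^esub> j \<in> {\<one>\<^bsub>A\<^esub>} \<Longrightarrow> k \<le> j"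
      using least[OF triv a(1)] by blast
    have "k \<noteq> 1"
      using k(2) a by auto
    \<comment> \<open>The first domain is the cyclic subgroup of \<open>a\<close>. Here
      \<open>k\<close> is the order of \<open>a\<close>, and the value prescribed at
      \<open>a\<close> is a primitive \<open>k\<close>-th root of unity, different from 1 since
      \<open>k \<ge> 2\<close>.\<close>
    have z: "cis (2 * pi / k) ^ k = 1"
      using k(1) by (simp add: Complex.DeMoivre)
    have "cos (2 * pi / k) < cos 0"
      by (rule cos_monotone_0_pi) (use k(1) \<open>k \<noteq> 1\<close> in \<open>auto simp: field_simps\<close>)
    then have "cis (2 * pi / k) \<noteq> 1"
      by (auto simp: complex_eq_iff)
    have "partial_character A {\<one>\<^bsub>A\<^esub>} (\<lambda>_. 1)"
      using triv by (simp add: partial_character_def)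
    from partial_character_extend[OF A this a(1) k z] show ?thesis
      unfolding Q_def using \<open>cis (2 * pi / k) \<noteq> 1\<close> by metis
  qed
  moreover have "card B \<le> card (carrier A)" if "Q B" for B
    using that A(2) by (auto simp: Q_def partial_character_def dest: subgroup.subset intro: card_mono)
  ultimately obtain B where B: "Q B" "\<And>B'. Q B' \<Longrightarrow> card B' \<le> card B"
    using ex_has_greatest_nat[of Q _ card "Suc (card (carrier A))"]
    unfolding less_Suc_eq_le by blast
  then obtain \<theta> where \<theta>: "partial_character A B \<theta>" "a \<in> B" "\<theta> a \<noteq> 1"
    by (auto simp: Q_def)
  have BA: "subgroup B A" "B \<subseteq> carrier A"
    using \<theta>(1) by (auto simp: partial_character_def dest: subgroup.subset)
  have "B = carrier A"
  proof (rule ccontr)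
    assume "B \<noteq> carrier A"
    then obtain x where x: "x \<in> carrier A" "x \<notin> B" using BA by auto
    obtain k :: nat where k: "0 < k" "x [^]\<^bsub>A\<^esub> k \<in> B"
        "\<And>j::nat. 0 < j \<Longrightarrow> x [^]\<^bsub>A\<^esub> j \<in> B \<Longrightarrow> k \<le> j"
      using least[OF BA(1) x(1)] by blast
    obtain z where z: "\<theta> (x [^]\<^bsub>A\<^esub> k) = z ^ k"
      using exists_complex_root[of k "\<theta> (x [^]\<^bsub>A\<^esub> k)"] k(1) by auto
    obtain B' \<theta>' where B': "partial_character A B' \<theta>'" "B \<subseteq> B'" "x \<in> B'" "\<And>b. b \<in> B \<Longrightarrow> \<theta>' b = \<theta> b"
      using partial_character_extend[OF A \<theta>(1) x(1) k z[symmetric]] by metis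
    then have "Q B'"
      using \<theta> B'(2,4) unfolding Q_def by (intro exI[of _ \<theta>']) auto
    moreover have "finite B'"
      using B'(1) A(2) by (auto simp: partial_character_def dest: subgroup.subset intro: finite_subset)
    then have "card B < card B'"
      using B' x by (intro psubset_card_mono) auto
    ultimately show False
      using B(2) by fastforce
  qed
  with \<theta> show thesis by (intro that[of \<theta>]) auto
qed

section \<open>Projective linear groups\<close>

lemma mult_GL [simp]: "A \<otimes>\<^bsub>GL n\<^esub> B = A * B"
  and one_GL [simp]: "\<one>\<^bsub>GL n\<^esub> = 1\<^sub>m n"
  by (simp_all add: GL_def units_of_def ring_mat_simps)

lemma carrier_GL:
  "carrier (GL n) =
     {A \<in> carrier_mat n n. \<exists>B\<in>carrier_mat n n. B * A = 1\<^sub>m n \<and> A * B = 1\<^sub>m n}"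
  by (simp add: GL_def units_of_def ring_mat_simps Units_def)

lemma group_GL: "group (GL n)"
proof -
  interpret ring "ring_mat TYPE(complex) n ()" by (rule ring_mat)
  show ?thesis unfolding GL_def by (rule units_group)
qed

lemma scalar_mult_mat:
  assumes "A \<in> carrier_mat n n"
  shows "(a \<cdot>\<^sub>m 1\<^sub>m n) * A = a \<cdot>\<^sub>m A" "A * (a \<cdot>\<^sub>m 1\<^sub>m n) = a \<cdot>\<^sub>m (A :: complex mat)"
  using assms by (simp_all add: mult_smult_assoc_mat[of _ n n _ n] mult_smult_distrib[of _ n n _ n])

lemma scalar_mats_carrier: "scalar_mats n \<subseteq> carrier (GL n)"
proof
  fix A assume "A \<in> scalar_mats n"
  then obtain a where a: "A = a \<cdot>\<^sub>m 1\<^sub>m n" "a \<noteq> 0"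
    by (auto simp: scalar_mats_def)
  have "inverse a \<cdot>\<^sub>m 1\<^sub>m n * A = 1\<^sub>m n" "A * (inverse a \<cdot>\<^sub>m 1\<^sub>m n) = 1\<^sub>m n"
    using a by (auto simp: scalar_mult_mat intro!: eq_matI)
  moreover have "inverse a \<cdot>\<^sub>m 1\<^sub>m n \<in> carrier_mat n n" "A \<in> carrier_mat n n"
    using a by auto
  ultimately show "A \<in> carrier (GL n)"
    unfolding carrier_GL by blast
qed

lemma scalar_mats_central:
  assumes "z \<in> scalar_mats n" "A \<in> carrier (GL n)"
  shows "z \<otimes>\<^bsub>GL n\<^esub> A = A \<otimes>\<^bsub>GL n\<^esub> z"
  using assms by (auto simp: scalar_mats_def carrier_GL scalar_mult_mat)

lemma subgroup_scalar_mats: "subgroup (scalar_mats n) (GL n)"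
proof -
  interpret group "GL n" by (rule group_GL)
  show ?thesis
  proof (rule subgroupI[OF scalar_mats_carrier])
    show "scalar_mats n \<noteq> {}"
      by (auto simp: scalar_mats_def intro: exI[of _ 1])
    fix A assume A: "A \<in> scalar_mats n"
    then obtain a where a: "A = a \<cdot>\<^sub>m 1\<^sub>m n" "a \<noteq> 0"
      by (auto simp: scalar_mats_def)
    have inv_a: "inverse a \<cdot>\<^sub>m 1\<^sub>m n \<in> scalar_mats n"
      using a unfolding scalar_mats_def by (auto intro: exI[of _ "inverse a"])
    have "inverse a \<cdot>\<^sub>m 1\<^sub>m n * A = 1\<^sub>m n"
      using a by (auto simp: scalar_mult_mat intro!: eq_matI)
    then have "inv\<^bsub>GL n\<^esub> A = inverse a \<cdot>\<^sub>m 1\<^sub>m n"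
      using A inv_a scalar_mats_carrier by (intro inv_equality) auto
    then show "inv\<^bsub>GL n\<^esub> A \<in> scalar_mats n"
      using inv_a by simp
    fix B assume "B \<in> scalar_mats n"
    then obtain b where b: "B = b \<cdot>\<^sub>m 1\<^sub>m n" "b \<noteq> 0"
      by (auto simp: scalar_mats_def)
    have "A * B = (a * b) \<cdot>\<^sub>m 1\<^sub>m n"
      unfolding a(1) b(1) by (subst scalar_mult_mat) (auto intro!: eq_matI)
    then show "A \<otimes>\<^bsub>GL n\<^esub> B \<in> scalar_mats n"
      using a b by (auto simp: scalar_mats_def)
  qed
qed

lemma (in group) normal_if_central:
  assumes "subgroup Z G" "\<And>z x. z \<in> Z \<Longrightarrow> x \<in> carrier G \<Longrightarrow> z \<otimes> x = x \<otimes> z"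
  shows "Z \<lhd> G"
proof (rule normal_invI[OF assms(1)])
  fix x z assume *: "x \<in> carrier G" "z \<in> Z"
  then have "z \<in> carrier G" using assms(1) by (auto dest: subgroup.subset)
  then have "x \<otimes> z \<otimes> inv x = z"
    using * assms(2)[of z x, symmetric] by (simp add: m_assoc)
  then show "x \<otimes> z \<otimes> inv x \<in> Z" using * by simp
qed

lemma normal_scalar_mats: "scalar_mats n \<lhd> GL n"
  by (rule group.normal_if_central[OF group_GL subgroup_scalar_mats scalar_mats_central])

lemma group_PGL: "group (PGL n)"
  unfolding PGL_def by (rule normal.factorgroup_is_group[OF normal_scalar_mats])

lemma (in group) r_coset_eqD:
  assumes "subgroup Z G" "a \<in> carrier G" "Z #> a = Z #> b"
  shows "\<exists>z\<in>Z. a = z \<otimes> b"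
  using rcos_self[OF assms(2,1)] assms(3) by (auto simp: r_coset_def)

lemma (in group_hom) hom_eq_on_generate:
  assumes "K \<subseteq> carrier G" "k \<in> hom G H" "\<And>x. x \<in> K \<Longrightarrow> h x = k x" "x \<in> generate G K"
  shows "h x = k x"
proof -
  interpret k: group_hom G H k
    by unfold_locales (rule assms(2))
  show ?thesis
    using assms(4)
  proof (induction rule: generate.induct)
    case (inv x)
    then have "x \<in> carrier G" using assms(1) by auto
    then show ?case using inv assms(3) by simp
  next
    case (eng x y)
    then show ?case using G.generate_in_carrier[OF assms(1)] by simp
  qed (use assms(3) in auto)
qed

section \<open>Induced representations\<close>

text \<open>Serves to descend the projectivized induced representation from \<open>E\<close> to
  \<open>G\<close>.\<close>

lemma (in group_hom) exists_induced_hom_epi: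
  assumes \<pi>: "\<pi> \<in> epi G K" "group K" and ker: "kernel G K \<pi> \<subseteq> kernel G H h"
  obtains k where "k \<in> hom K H" "\<And>x. x \<in> carrier G \<Longrightarrow> k (\<pi> x) = h x"
proof -
  interpret \<pi>: group_hom G K \<pi>
    using \<pi> by (simp add: group_hom_def group_hom_axioms_def epi_def)
  have eq: "h x = h y" if "x \<in> carrier G" "y \<in> carrier G" "\<pi> x = \<pi> y" for x y
  proof -
    have "x \<otimes> inv y \<in> kernel G K \<pi>"
      using that by (simp add: kernel_def)
    then have "h (x \<otimes> inv y) = \<one>\<^bsub>H\<^esub>"
      using ker by (auto simp: kernel_def)
    then have "h x \<otimes>\<^bsub>H\<^esub> inv\<^bsub>H\<^esub> (h y) = \<one>\<^bsub>H\<^esub>"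
      using that by simp
    then show ?thesis
      using that H.inv_equality[of "h x" "inv\<^bsub>H\<^esub> (h y)"] by simp
  qed
  define k where "k y = h (inv_into (carrier G) \<pi> y)" for y
  have surj: "\<pi> ` carrier G = carrier K"
    using \<pi> by (simp add: epi_def)
  have k: "k (\<pi> x) = h x" if "x \<in> carrier G" for x
    unfolding k_def using that by (intro eq) (auto intro: inv_into_into f_inv_into_f)
  have "k \<in> hom K H"
  proof (rule homI)
    fix x y assume "x \<in> carrier K" "y \<in> carrier K"
    then obtain x' y' where "x' \<in> carrier G" "y' \<in> carrier G" "x = \<pi> x'" "y = \<pi> y'"
      using surj by (metis imageE)
    then show "k x \<in> carrier H" "k (x \<otimes>\<^bsub>K\<^esub> y) = k x \<otimes>\<^bsub>H\<^esub> k y"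
      using k[of "x' \<otimes> y'"] by (simp_all add: k)
  qed
  then show thesis using k by (rule that)
qed

text \<open>The representation induced from the central kernel, in monomial matrices: rows and
  columns are indexed by \<open>G\<close> through \<open>e\<close>, \<open>s\<close> is a
  set-theoretic section of \<open>\<pi>\<close>, and \<open>x\<close> permutes the basis by left
  multiplication with \<open>\<pi> x\<close>, weighted by \<open>\<theta>\<close> of the kernel
  element \<open>c x i j\<close>. Kernel elements permute nothing and, being central, have the same
  weight everywhere.\<close>

lemma induced_representation:
  assumes E: "group E" and G: "group G" "finite (carrier G)" and \<pi>: "\<pi> \<in> epi E G"
    and central: "\<And>a x. a \<in> kernel E G \<pi> \<Longrightarrow> x \<in> carrier E \<Longrightarrow> a \<otimes>\<^bsub>E\<^esub> x = x \<otimes>\<^bsub>E\<^esub> a"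
    and \<theta>: "\<theta> \<one>\<^bsub>E\<^esub> = (1 :: complex)"
      "\<And>a b. a \<in> kernel E G \<pi> \<Longrightarrow> b \<in> kernel E G \<pi> \<Longrightarrow> \<theta> (a \<otimes>\<^bsub>E\<^esub> b) = \<theta> a * \<theta> b"
  obtains n \<sigma> where "1 \<le> n" "\<sigma> \<in> hom E (GL n)"
    "\<And>a. a \<in> kernel E G \<pi> \<Longrightarrow> \<sigma> a = \<theta> a \<cdot>\<^sub>m 1\<^sub>m n"
proof -
  interpret E: group E by fact
  interpret group_hom E G \<pi>
    using E G \<pi> by (simp add: group_hom_def group_hom_axioms_def epi_def)
  define n where "n = card (carrier G)"
  have n1: "1 \<le> n"
    using G(2) H.order_gt_0_iff_finite by (simp add: n_def order_def)
  obtain e where e: "bij_betw e {0..<n} (carrier G)"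
    using ex_bij_betw_nat_finite[OF G(2)] by (auto simp: n_def)
  have e_closed [simp]: "e i \<in> carrier G" if "i < n" for i
    using e that by (auto simp: bij_betw_def)
  have e_inj: "e i = e j \<longleftrightarrow> i = j" if "i < n" "j < n" for i j
    using e that by (auto simp: bij_betw_def inj_on_def)
  have e_surj: "\<exists>i<n. g = e i" if "g \<in> carrier G" for g
    using e that by (force simp: bij_betw_def)
  define s where "s g = inv_into (carrier E) \<pi> g" for g
  have surj: "\<pi> ` carrier E = carrier G"
    using \<pi> by (simp add: epi_def)
  have s [simp]: "s g \<in> carrier E" "\<pi> (s g) = g" if "g \<in> carrier G" for g
    using that surj by (auto simp: s_def intro: inv_into_into f_inv_into_f)
  define c where "c x i j = inv\<^bsub>E\<^esub> (s (e i)) \<otimes>\<^bsub>E\<^esub> x \<otimes>\<^bsub>E\<^esub> s (e j)" for x i j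
  define \<sigma> where
    "\<sigma> x = mat n n (\<lambda>(i, j). if e i = \<pi> x \<otimes>\<^bsub>G\<^esub> e j then \<theta> (c x i j) else 0)" for x
  have \<sigma>_carrier [simp]: "\<sigma> x \<in> carrier_mat n n" for x
    by (simp add: \<sigma>_def)
  have c_ker: "c x i j \<in> kernel E G \<pi>"
    if "x \<in> carrier E" "i < n" "j < n" "e i = \<pi> x \<otimes>\<^bsub>G\<^esub> e j" for x i j
  proof -
    have "\<pi> (c x i j) = inv\<^bsub>G\<^esub> (e i) \<otimes>\<^bsub>G\<^esub> (\<pi> x \<otimes>\<^bsub>G\<^esub> e j)"
      using that(1-3) by (simp add: c_def H.m_assoc)
    also have "\<dots> = \<one>\<^bsub>G\<^esub>"
      using that by (metis H.l_inv e_closed)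
    finally show ?thesis
      using that by (simp add: kernel_def c_def)
  qed
  have mult: "\<sigma> (x \<otimes>\<^bsub>E\<^esub> y) = \<sigma> x * \<sigma> y" if xy: "x \<in> carrier E" "y \<in> carrier E" for x y
  proof (rule eq_matI)
    fix i j assume ij: "i < dim_row (\<sigma> x * \<sigma> y)" "j < dim_col (\<sigma> x * \<sigma> y)"
    then have ij: "i < n" "j < n" by (simp_all add: \<sigma>_def)
    obtain k where k: "k < n" "\<pi> y \<otimes>\<^bsub>G\<^esub> e j = e k"
      using e_surj[of "\<pi> y \<otimes>\<^bsub>G\<^esub> e j"] xy ij by auto
    have "(\<sigma> x * \<sigma> y) $$ (i, j) = (\<Sum>l = 0..<n. \<sigma> x $$ (i, l) * \<sigma> y $$ (l, j))"
      using ij by (simp add: scalar_prod_def \<sigma>_def)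
    \<comment> \<open>Column \<open>j\<close> of \<open>\<sigma> y\<close> vanishes outside row
      \<open>k\<close>, so one summand survives.\<close>
    also have "\<dots> = (\<Sum>l = 0..<n. if l = k then \<sigma> x $$ (i, k) * \<sigma> y $$ (k, j) else 0)"
      using ij k by (intro sum.cong) (auto simp: \<sigma>_def e_inj)
    also have "\<dots> = \<sigma> x $$ (i, k) * \<sigma> y $$ (k, j)"
      using k by simp
    also have "\<dots> = \<sigma> (x \<otimes>\<^bsub>E\<^esub> y) $$ (i, j)"
    proof (cases "e i = \<pi> x \<otimes>\<^bsub>G\<^esub> e k")
      case True
      \<comment> \<open>The values of the section in the middle cancel, so the weights multiply
        exactly and not only up to a factor.\<close>
      have "c x i k \<otimes>\<^bsub>E\<^esub> c y k j =
          inv\<^bsub>E\<^esub> (s (e i)) \<otimes>\<^bsub>E\<^esub> x \<otimes>\<^bsub>E\<^esub> (s (e k) \<otimes>\<^bsub>E\<^esub> inv\<^bsub>E\<^esub> (s (e k))) \<otimes>\<^bsub>E\<^esub> y \<otimes>\<^bsub>E\<^esub> s (e j)"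
        using xy ij k(1) unfolding c_def
        by (simp only: E.m_assoc E.m_closed E.inv_closed s e_closed)
      also have "\<dots> = c (x \<otimes>\<^bsub>E\<^esub> y) i j"
        using xy ij k(1) by (simp add: c_def E.m_assoc)
      finally have "\<theta> (c (x \<otimes>\<^bsub>E\<^esub> y) i j) = \<theta> (c x i k) * \<theta> (c y k j)"
        using \<theta>(2)[of "c x i k" "c y k j"] c_ker xy ij k True by simp
      then show ?thesis
        using True k ij xy by (simp add: \<sigma>_def H.m_assoc)
    next
      case False
      then show ?thesis
        using k ij xy by (simp add: \<sigma>_def H.m_assoc)
    qed
    finally show "\<sigma> (x \<otimes>\<^bsub>E\<^esub> y) $$ (i, j) = (\<sigma> x * \<sigma> y) $$ (i, j)" by simp
  qed (simp_all add: \<sigma>_def)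
  have scalar: "\<sigma> a = \<theta> a \<cdot>\<^sub>m 1\<^sub>m n" if a: "a \<in> kernel E G \<pi>" for a
  proof (rule eq_matI)
    have a': "a \<in> carrier E" "\<pi> a = \<one>\<^bsub>G\<^esub>"
      using a by (auto simp: kernel_def)
    fix i j assume "i < dim_row (\<theta> a \<cdot>\<^sub>m 1\<^sub>m n)" "j < dim_col (\<theta> a \<cdot>\<^sub>m 1\<^sub>m n)"
    then have ij: "i < n" "j < n" by auto
    have t: "s (e i) \<in> carrier E"
      using ij by simp
    have "c a i i = inv\<^bsub>E\<^esub> (s (e i)) \<otimes>\<^bsub>E\<^esub> (a \<otimes>\<^bsub>E\<^esub> s (e i))"
      using a' t by (simp add: c_def E.m_assoc)
    also have "\<dots> = (inv\<^bsub>E\<^esub> (s (e i)) \<otimes>\<^bsub>E\<^esub> s (e i)) \<otimes>\<^bsub>E\<^esub> a"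
      unfolding central[OF a t] using a' t by (simp add: E.m_assoc[symmetric])
    finally have "c a i i = a"
      using a' t by simp
    then show "\<sigma> a $$ (i, j) = (\<theta> a \<cdot>\<^sub>m 1\<^sub>m n) $$ (i, j)"
      using ij a' e_inj by (auto simp: \<sigma>_def)
  qed (simp_all add: \<sigma>_def)
  have "\<one>\<^bsub>E\<^esub> \<in> kernel E G \<pi>"
    by (simp add: kernel_def)
  then have one: "\<sigma> \<one>\<^bsub>E\<^esub> = 1\<^sub>m n"
    using scalar \<theta>(1) by (auto intro!: eq_matI)
  \<comment> \<open>Invertibility follows from \<open>mult\<close> and \<open>one\<close>: the
    inverse matrix is the image of the inverse element.\<close>
  have "\<sigma> x \<in> carrier (GL n)" if "x \<in> carrier E" for x
    using that mult[of x "inv\<^bsub>E\<^esub> x"] mult[of "inv\<^bsub>E\<^esub> x" x] one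
    unfolding carrier_GL by (auto intro!: bexI[of _ "\<sigma> (inv\<^bsub>E\<^esub> x)"])
  then have "\<sigma> \<in> hom E (GL n)"
    by (auto simp: hom_def mult)
  with n1 scalar show thesis
    by (intro that[of n \<sigma>]) auto
qed

section \<open>Covers\<close>

text \<open>The condition that \<open>\<sigma> x\<close> has trivial \<open>n\<close>-th power is
  not stable under products, so the induction carries a finer one: the central discrepancy
  \<open>z\<close> between \<open>\<sigma> x\<close> and \<open>\<rho> y\<close> has trivial
  \<open>n\<close>-th power. At a generator this follows by comparing \<open>n\<close>-th powers,
  and centrality of \<open>Z\<close> makes discrepancies multiply.\<close>

lemma hom_pow_eq_one_of_projectively_equal:
  fixes n :: nat
  assumes E: "group E" and E': "group E'" and H: "group H" and G: "group G"
    and \<sigma>: "\<sigma> \<in> hom E H" and \<rho>: "\<rho> \<in> hom E' H" and \<pi>: "\<pi> \<in> hom E G" and \<pi>': "\<pi>' \<in> epi E' G"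
    and Z: "subgroup Z H" and central: "\<And>z x. z \<in> Z \<Longrightarrow> x \<in> carrier H \<Longrightarrow> z \<otimes>\<^bsub>H\<^esub> x = x \<otimes>\<^bsub>H\<^esub> z"
    and proj: "\<And>x y. x \<in> carrier E \<Longrightarrow> y \<in> carrier E' \<Longrightarrow> \<pi> x = \<pi>' y \<Longrightarrow> Z #>\<^bsub>H\<^esub> \<sigma> x = Z #>\<^bsub>H\<^esub> \<rho> y"
    and K: "K \<subseteq> carrier E" "generate E K = carrier E"
    and pow_K: "\<And>x. x \<in> K \<Longrightarrow> x [^]\<^bsub>E\<^esub> n = \<one>\<^bsub>E\<^esub>"
    and pow_E': "\<And>y. y \<in> carrier E' \<Longrightarrow> y [^]\<^bsub>E'\<^esub> n = \<one>\<^bsub>E'\<^esub>"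
    and x: "x \<in> carrier E"
  shows "\<sigma> x [^]\<^bsub>H\<^esub> n = \<one>\<^bsub>H\<^esub>"
proof -
  interpret E: group E by fact
  interpret H: group H by fact
  interpret \<sigma>: group_hom E H \<sigma> using E H \<sigma> by (simp add: group_hom_def group_hom_axioms_def)
  interpret \<rho>: group_hom E' H \<rho> using E' H \<rho> by (simp add: group_hom_def group_hom_axioms_def)
  interpret \<pi>: group_hom E G \<pi> using E G \<pi> by (simp add: group_hom_def group_hom_axioms_def)
  interpret \<pi>': group_hom E' G \<pi>' using E' G \<pi>' by (simp add: group_hom_def group_hom_axioms_def epi_def)
  interpret Z: subgroup Z H by fact
  have pow_mult: "(z \<otimes>\<^bsub>H\<^esub> w) [^]\<^bsub>H\<^esub> n = z [^]\<^bsub>H\<^esub> n \<otimes>\<^bsub>H\<^esub> w [^]\<^bsub>H\<^esub> n" if "z \<in> Z" "w \<in> carrier H" for z w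
    using that central[OF that] by (intro H.pow_mult_distrib) auto
  have pow_\<rho>: "\<rho> y [^]\<^bsub>H\<^esub> n = \<one>\<^bsub>H\<^esub>" if "y \<in> carrier E'" for y
    using \<rho>.hom_nat_pow[OF that, of n] pow_E'[OF that] by simp
  have z_pow: "z [^]\<^bsub>H\<^esub> n = \<one>\<^bsub>H\<^esub>"
    if "w [^]\<^bsub>H\<^esub> n = \<one>\<^bsub>H\<^esub>" "w = z \<otimes>\<^bsub>H\<^esub> \<rho> y" "z \<in> Z" "y \<in> carrier E'" for w z y
    using that pow_mult[of z "\<rho> y"] pow_\<rho>[of y] by simp
  have surj: "\<exists>y\<in>carrier E'. \<pi>' y = g" if "g \<in> carrier G" for g
  proof -
    have "g \<in> \<pi>' ` carrier E'"
      using \<pi>' that by (simp add: epi_def)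
    then show ?thesis by blast
  qed
  have "\<exists>y\<in>carrier E'. \<exists>z\<in>Z. \<pi>' y = \<pi> x \<and> z [^]\<^bsub>H\<^esub> n = \<one>\<^bsub>H\<^esub> \<and> \<sigma> x = z \<otimes>\<^bsub>H\<^esub> \<rho> y"
    if "x \<in> generate E K" for x
    using that
  proof (induction rule: generate.induct)
    case one
    show ?case
      by (rule bexI[of _ "\<one>\<^bsub>E'\<^esub>"], rule bexI[of _ "\<one>\<^bsub>H\<^esub>"]) auto
  next
    case (incl x)
    then have xE: "x \<in> carrier E" using K by auto
    then obtain y where y: "y \<in> carrier E'" "\<pi>' y = \<pi> x"
      using surj[OF \<pi>.hom_closed[OF xE]] by blast
    obtain z where z: "z \<in> Z" "\<sigma> x = z \<otimes>\<^bsub>H\<^esub> \<rho> y"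
      using H.r_coset_eqD[OF Z \<sigma>.hom_closed[OF xE] proj[OF xE y(1) y(2)[symmetric]]] by auto
    have "\<sigma> x [^]\<^bsub>H\<^esub> n = \<one>\<^bsub>H\<^esub>"
      using \<sigma>.hom_nat_pow[OF xE, of n] pow_K[OF incl] by simp
    then have "z [^]\<^bsub>H\<^esub> n = \<one>\<^bsub>H\<^esub>"
      by (rule z_pow[OF _ z(2,1) y(1)])
    then show ?case using y z by auto
  next
    \<comment> \<open>The inverse of a generator is treated like a generator, with a discrepancy of
      its own, as its \<open>n\<close>-th power is trivial too.\<close>
    case (inv x)
    then have xE: "x \<in> carrier E" using K by auto
    then obtain y where y: "y \<in> carrier E'" "\<pi>' y = \<pi> x"
      using surj[OF \<pi>.hom_closed[OF xE]] by blast
    have inv_eq: "\<pi> (inv\<^bsub>E\<^esub> x) = \<pi>' (inv\<^bsub>E'\<^esub> y)"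
      using y xE by simp
    obtain z where z: "z \<in> Z" "\<sigma> (inv\<^bsub>E\<^esub> x) = z \<otimes>\<^bsub>H\<^esub> \<rho> (inv\<^bsub>E'\<^esub> y)"
      using H.r_coset_eqD[OF Z, of "\<sigma> (inv\<^bsub>E\<^esub> x)" "\<rho> (inv\<^bsub>E'\<^esub> y)"] proj[OF _ _ inv_eq] xE y by auto
    have "(inv\<^bsub>E\<^esub> x) [^]\<^bsub>E\<^esub> n = \<one>\<^bsub>E\<^esub>"
      using xE pow_K[OF inv] E.nat_pow_inv[of x n] by simp
    then have "\<sigma> (inv\<^bsub>E\<^esub> x) [^]\<^bsub>H\<^esub> n = \<one>\<^bsub>H\<^esub>"
      using \<sigma>.hom_nat_pow[of "inv\<^bsub>E\<^esub> x" n] xE by simp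
    then have "z [^]\<^bsub>H\<^esub> n = \<one>\<^bsub>H\<^esub>"
      by (rule z_pow[OF _ z(2,1)]) (use y in simp)
    moreover have "inv\<^bsub>E'\<^esub> y \<in> carrier E'"
      using y by simp
    ultimately show ?case
      using z inv_eq[symmetric] by blast
  next
    case (eng x1 x2)
    obtain y1 z1 where 1: "y1 \<in> carrier E'" "z1 \<in> Z" "\<pi>' y1 = \<pi> x1" "z1 [^]\<^bsub>H\<^esub> n = \<one>\<^bsub>H\<^esub>"
        "\<sigma> x1 = z1 \<otimes>\<^bsub>H\<^esub> \<rho> y1"
      using eng.IH(1) by auto
    obtain y2 z2 where 2: "y2 \<in> carrier E'" "z2 \<in> Z" "\<pi>' y2 = \<pi> x2" "z2 [^]\<^bsub>H\<^esub> n = \<one>\<^bsub>H\<^esub>"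
        "\<sigma> x2 = z2 \<otimes>\<^bsub>H\<^esub> \<rho> y2"
      using eng.IH(2) by auto
    have x12: "x1 \<in> carrier E" "x2 \<in> carrier E"
      using eng.hyps K by auto
    have "\<sigma> (x1 \<otimes>\<^bsub>E\<^esub> x2) = z1 \<otimes>\<^bsub>H\<^esub> (\<rho> y1 \<otimes>\<^bsub>H\<^esub> z2) \<otimes>\<^bsub>H\<^esub> \<rho> y2"
      using x12 1 2 by (simp add: H.m_assoc)
    also have "\<dots> = z1 \<otimes>\<^bsub>H\<^esub> z2 \<otimes>\<^bsub>H\<^esub> \<rho> (y1 \<otimes>\<^bsub>E'\<^esub> y2)"
      using 1 2 by (simp add: H.m_assoc central[of z2 "\<rho> y1", symmetric])
    finally have "\<sigma> (x1 \<otimes>\<^bsub>E\<^esub> x2) = z1 \<otimes>\<^bsub>H\<^esub> z2 \<otimes>\<^bsub>H\<^esub> \<rho> (y1 \<otimes>\<^bsub>E'\<^esub> y2)" .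
    moreover have "(z1 \<otimes>\<^bsub>H\<^esub> z2) [^]\<^bsub>H\<^esub> n = \<one>\<^bsub>H\<^esub>"
      using pow_mult[OF 1(2), of z2] 1 2 by simp
    moreover have "\<pi>' (y1 \<otimes>\<^bsub>E'\<^esub> y2) = \<pi> (x1 \<otimes>\<^bsub>E\<^esub> x2)"
      using 1 2 x12 by simp
    ultimately show ?case
      using 1 2 by (intro bexI[of _ "y1 \<otimes>\<^bsub>E'\<^esub> y2"] bexI[of _ "z1 \<otimes>\<^bsub>H\<^esub> z2"]) auto
  qed
  then obtain y z where "y \<in> carrier E'" "z \<in> Z" "z [^]\<^bsub>H\<^esub> n = \<one>\<^bsub>H\<^esub>" "\<sigma> x = z \<otimes>\<^bsub>H\<^esub> \<rho> y"
    using x K(2) by blast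
  then show ?thesis
    using pow_mult[of z "\<rho> y"] pow_\<rho>[of y] by simp
qed

lemma group_exp_le_of_cover:
  assumes E: "group E" "finite (carrier E)" and G: "group G" "finite (carrier G)"
    and \<pi>: "\<pi> \<in> epi E G"
    and central: "\<And>a x. a \<in> kernel E G \<pi> \<Longrightarrow> x \<in> carrier E \<Longrightarrow> a \<otimes>\<^bsub>E\<^esub> x = x \<otimes>\<^bsub>E\<^esub> a"
    and K: "K \<subseteq> carrier E" "generate E K = carrier E"
    and ord: "\<And>x. x \<in> K \<Longrightarrow> group.ord E x = group.ord G (\<pi> x)"
    and cover: "is_cover G E' \<pi>'"
  shows "group_exp E \<le> group_exp E'"
proof -
  interpret E: group E by fact
  interpret G: group G by fact
  interpret E': group E' using cover by (simp add: is_cover_def)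
  interpret \<pi>: group_hom E G \<pi>
    using E G \<pi> by (simp add: group_hom_def group_hom_axioms_def epi_def)
  have \<pi>': "\<pi>' \<in> epi E' G" and fin': "finite (kernel E' G \<pi>')"
    and lift: "\<And>n \<rho>. 1 \<le> n \<Longrightarrow> \<rho> \<in> hom G (PGL n) \<Longrightarrow> \<exists>\<rho>'\<in>hom E' (GL n).
        \<forall>x\<in>carrier E'. scalar_mats n #>\<^bsub>GL n\<^esub> \<rho>' x = \<rho> (\<pi>' x)"
    using cover by (auto simp: is_cover_def)
  interpret \<pi>': group_hom E' G \<pi>'
    using E'.is_group G \<pi>' by (simp add: group_hom_def group_hom_axioms_def epi_def)
  have "finite (carrier E')"
    by (rule \<pi>'.finite_carrier_if_finite_kernel[OF fin' G(2)])
  define n where "n = group_exp E'"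
  have n: "0 < n" "\<And>y. y \<in> carrier E' \<Longrightarrow> y [^]\<^bsub>E'\<^esub> n = \<one>\<^bsub>E'\<^esub>"
    using E'.finite_group_exp[OF \<open>finite (carrier E')\<close>] by (auto simp: n_def)
  have nG: "g [^]\<^bsub>G\<^esub> n = \<one>\<^bsub>G\<^esub>" if "g \<in> carrier G" for g
  proof -
    have "g \<in> \<pi>' ` carrier E'"
      using that \<pi>' by (simp add: epi_def)
    then obtain y where "y \<in> carrier E'" "g = \<pi>' y"
      by blast
    then show ?thesis
      using \<pi>'.hom_nat_pow[of y n] n(2) by simp
  qed
  \<comment> \<open>\<open>n\<close> kills \<open>G\<close>, hence is a multiple of the order of
    \<open>\<pi> x\<close>, which by \<open>ord\<close> is the order of \<open>x\<close>.\<close>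
  have nK: "x [^]\<^bsub>E\<^esub> n = \<one>\<^bsub>E\<^esub>" if "x \<in> K" for x
  proof -
    have "x \<in> carrier E" using that K by auto
    then show ?thesis
      using nG[of "\<pi> x"] ord[OF that] G.pow_eq_id[of "\<pi> x" n] E.pow_eq_id[of x n] by simp
  qed
  \<comment> \<open>By \<open>nG\<close> a nontrivial \<open>x [^] n\<close> would lie in the
    kernel, a finite abelian group, where some character separates it from 1.\<close>
  have nE: "x [^]\<^bsub>E\<^esub> n = \<one>\<^bsub>E\<^esub>" if x: "x \<in> carrier E" for x
  proof (rule ccontr)
    let ?a = "x [^]\<^bsub>E\<^esub> n" and ?A = "E\<lparr>carrier := kernel E G \<pi>\<rparr>"
    assume a: "?a \<noteq> \<one>\<^bsub>E\<^esub>"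
    have a_ker: "?a \<in> kernel E G \<pi>"
      using x nG[of "\<pi> x"] \<pi>.hom_nat_pow[OF x, of n] by (simp add: kernel_def)
    have "group ?A"
      using E.subgroup_imp_group[OF \<pi>.subgroup_kernel] .
    then have A: "comm_group ?A"
      by (rule group.group_comm_groupI) (simp add: central kernel_def)
    have finA: "finite (carrier ?A)"
      using E(2) by (auto simp: kernel_def intro: finite_subset)
    obtain \<theta> where \<theta>: "partial_character ?A (carrier ?A) \<theta>" "\<theta> ?a \<noteq> 1"
      using exists_character_separating[OF A finA, of ?a] a a_ker by auto
    then have th: "\<theta> \<one>\<^bsub>E\<^esub> = 1"
      "\<And>a b. a \<in> kernel E G \<pi> \<Longrightarrow> b \<in> kernel E G \<pi> \<Longrightarrow> \<theta> (a \<otimes>\<^bsub>E\<^esub> b) = \<theta> a * \<theta> b"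
      by (auto simp: partial_character_def)
    obtain N \<sigma> where N: "1 \<le> N" and \<sigma>: "\<sigma> \<in> hom E (GL N)"
      and scalar: "\<And>a. a \<in> kernel E G \<pi> \<Longrightarrow> \<sigma> a = \<theta> a \<cdot>\<^sub>m 1\<^sub>m N"
      using induced_representation[OF E(1) G \<pi> central th] by metis
    have \<theta>_nz: "\<theta> b \<noteq> 0" if b: "b \<in> kernel E G \<pi>" for b
    proof
      assume "\<theta> b = 0"
      have b': "inv\<^bsub>E\<^esub> b \<in> kernel E G \<pi>" "b \<in> carrier E"
        using b by (auto simp: kernel_def)
      show False
        using th(2)[OF b b'(1)] th(1) b'(2) \<open>\<theta> b = 0\<close> by simp
    qed
    let ?\<tau> = "\<lambda>x. scalar_mats N #>\<^bsub>GL N\<^esub> \<sigma> x"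
    have \<tau>: "?\<tau> \<in> hom E (PGL N)"
      using hom_compose[OF \<sigma> normal.r_coset_hom_Mod[OF normal_scalar_mats[of N]]]
      by (simp add: PGL_def comp_def)
    then interpret \<tau>: group_hom E "PGL N" ?\<tau>
      using E group_PGL by (simp add: group_hom_def group_hom_axioms_def)
    \<comment> \<open>\<open>\<sigma>\<close> is scalar on the kernel, with nonzero scalars, so
      passing to \<open>PGL N\<close> kills the kernel and leaves a projective representation of
      \<open>G\<close>.\<close>
    have ker: "kernel E G \<pi> \<subseteq> kernel E (PGL N) ?\<tau>"
    proof
      fix b assume b: "b \<in> kernel E G \<pi>"
      then have "\<sigma> b \<in> scalar_mats N"
        using scalar \<theta>_nz by (auto simp: scalar_mats_def)
      then have "?\<tau> b = scalar_mats N"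
        using subgroup_scalar_mats group_GL by (simp add: subgroup.rcos_const)
      then show "b \<in> kernel E (PGL N) ?\<tau>"
        using b by (simp add: kernel_def PGL_def)
    qed
    obtain \<rho> where \<rho>: "\<rho> \<in> hom G (PGL N)" "\<And>x. x \<in> carrier E \<Longrightarrow> \<rho> (\<pi> x) = ?\<tau> x"
      using \<tau>.exists_induced_hom_epi[OF \<pi> G(1) ker] by blast
    obtain \<rho>' where \<rho>': "\<rho>' \<in> hom E' (GL N)"
      "\<And>y. y \<in> carrier E' \<Longrightarrow> scalar_mats N #>\<^bsub>GL N\<^esub> \<rho>' y = \<rho> (\<pi>' y)"
      using lift[OF N \<rho>(1)] by blast
    interpret \<sigma>: group_hom E "GL N" \<sigma>
      using E group_GL \<sigma> by (simp add: group_hom_def group_hom_axioms_def)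
    have "\<sigma> x [^]\<^bsub>GL N\<^esub> n = \<one>\<^bsub>GL N\<^esub>"
    proof (rule hom_pow_eq_one_of_projectively_equal[OF E(1) E'.is_group group_GL G(1) \<sigma> \<rho>'(1)
          \<pi>.homh \<pi>' subgroup_scalar_mats scalar_mats_central _ K nK n(2) x])
      show "scalar_mats N #>\<^bsub>GL N\<^esub> \<sigma> u = scalar_mats N #>\<^bsub>GL N\<^esub> \<rho>' v"
        if "u \<in> carrier E" "v \<in> carrier E'" "\<pi> u = \<pi>' v" for u v
        using that \<rho>(2)[of u] \<rho>'(2)[of v] by simp
    qed
    then have "\<theta> ?a \<cdot>\<^sub>m 1\<^sub>m N = 1\<^sub>m N"
      using scalar[OF a_ker] \<sigma>.hom_nat_pow[OF x, of n] by simp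
    \<comment> \<open>Scalars are recovered from scalar matrices by comparing corner entries, which
      exist because \<open>1 \<le> N\<close>.\<close>
    then have "(\<theta> ?a \<cdot>\<^sub>m 1\<^sub>m N) $$ (0, 0) = (1\<^sub>m N :: complex mat) $$ (0, 0)"
      by simp
    then show False
      using N \<theta>(2) by simp
  qed
  show ?thesis
    unfolding group_exp_def[of E] n_def[symmetric] by (rule Least_le) (use n(1) nE in auto)
qed

section \<open>The central extension F/[R, F]\<close>

lemma (in group) commutator_subgroup_normal:
  assumes "N \<lhd> G"
  shows "commutator_subgroup G N (carrier G) \<lhd> G"
proof -
  interpret N: normal N G by fact
  show ?thesis
    unfolding commutator_subgroup_def
  proof (rule normal_generateI)
    fix c g
    assume "c \<in> (\<Union>h\<in>N. \<Union>k\<in>carrier G. {h \<otimes> k \<otimes> inv h \<otimes> inv k})" and g: "g \<in> carrier G"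
    then obtain h k where hk: "h \<in> N" "k \<in> carrier G" "c = h \<otimes> k \<otimes> inv h \<otimes> inv k"
      by auto
    have h: "h \<in> carrier G" using hk by simp
    have cancel: "inv g \<otimes> (g \<otimes> t) = t" if "t \<in> carrier G" for t
      using that g by (simp add: m_assoc[symmetric])
    \<comment> \<open>A conjugate of a commutator is the commutator of the conjugates, and
      \<open>N\<close> is stable under conjugation.\<close>
    have "g \<otimes> c \<otimes> inv g =
        (g \<otimes> h \<otimes> inv g) \<otimes> (g \<otimes> k \<otimes> inv g) \<otimes> inv (g \<otimes> h \<otimes> inv g) \<otimes> inv (g \<otimes> k \<otimes> inv g)"
      using h hk(2) g by (simp add: hk(3) inv_mult_group m_assoc cancel)
    moreover have "g \<otimes> h \<otimes> inv g \<in> N" "g \<otimes> k \<otimes> inv g \<in> carrier G"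
      using g hk N.inv_op_closed2 by auto
    ultimately show "g \<otimes> c \<otimes> inv g \<in> (\<Union>h\<in>N. \<Union>k\<in>carrier G. {h \<otimes> k \<otimes> inv h \<otimes> inv k})"
      by blast
  qed auto
qed

lemma (in group_hom) commutator_kernel_subset:
  "commutator_subgroup G (kernel G H h) (carrier G) \<subseteq> kernel G H h"
  unfolding commutator_subgroup_def
  by (rule G.generate_subgroup_incl[OF _ subgroup_kernel]) (auto simp: kernel_def)

lemma (in group) commutator_mem:
  assumes "h \<in> H" "k \<in> K"
  shows "h \<otimes> k \<otimes> inv h \<otimes> inv k \<in> commutator_subgroup G H K"
  unfolding commutator_subgroup_def using assms by (intro generate.incl) blast

context group_hom
begin

abbreviation "kernel_comm \<equiv> commutator_subgroup G (kernel G H h) (carrier G)"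

lemma normal_kernel_comm: "kernel_comm \<lhd> G"
  by (rule G.commutator_subgroup_normal[OF normal_kernel])

lemma induced_hom_kernel_comm:
  "induced_hom h \<in> hom (G Mod kernel_comm) H" "x \<in> carrier G \<Longrightarrow> induced_hom h (kernel_comm #> x) = h x"
proof -
  have eq: "induced_hom h (kernel_comm #> x) = h x" if x: "x \<in> carrier G" for x
  proof -
    interpret normal kernel_comm G by (rule normal_kernel_comm)
    have "h y = h x" if y: "y \<in> kernel_comm #> x" for y
    proof -
      obtain r where r: "r \<in> kernel_comm" "y = r \<otimes> x"
        using y by (auto simp: r_coset_def)
      then have "r \<in> kernel G H h" using commutator_kernel_subset by auto
      then show ?thesis using r x by (simp add: kernel_def)
    qed
    moreover have "x \<in> kernel_comm #> x"
      by (rule G.rcos_self[OF x subgroup_axioms])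
    ultimately show ?thesis
      unfolding induced_hom_def by (intro the_elem_image_unique) blast+
  qed
  then show "x \<in> carrier G \<Longrightarrow> induced_hom h (kernel_comm #> x) = h x" .
  show "induced_hom h \<in> hom (G Mod kernel_comm) H"
    using normal.factorgroup_is_group[OF normal_kernel_comm]
    by (auto intro!: homI simp: carrier_FactGroup eq normal.rcos_sum[OF normal_kernel_comm])
qed

lemma induced_hom_kernel_comm_epi:
  assumes "h \<in> epi G H"
  shows "induced_hom h \<in> epi (G Mod kernel_comm) H"
  using assms induced_hom_kernel_comm unfolding epi_def by (auto simp: carrier_FactGroup image_image)

text \<open>For \<open>r\<close> in the kernel, the two products of \<open>r\<close> and
  \<open>y\<close> differ by a commutator, which is precisely what has been divided out.\<close>

lemma induced_hom_kernel_comm_central: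
  assumes a: "a \<in> kernel (G Mod kernel_comm) H (induced_hom h)" and x: "x \<in> carrier (G Mod kernel_comm)"
  shows "a \<otimes>\<^bsub>G Mod kernel_comm\<^esub> x = x \<otimes>\<^bsub>G Mod kernel_comm\<^esub> a"
proof -
  interpret N: normal kernel_comm G by (rule normal_kernel_comm)
  obtain r where r: "r \<in> carrier G" "a = kernel_comm #> r"
    using a by (auto simp: kernel_def carrier_FactGroup)
  obtain y where y: "y \<in> carrier G" "x = kernel_comm #> y"
    using x by (auto simp: carrier_FactGroup)
  have "r \<in> kernel G H h"
    using a r induced_hom_kernel_comm(2)[of r] by (auto simp: kernel_def)
  then have c: "r \<otimes> y \<otimes> inv r \<otimes> inv y \<in> kernel_comm"
    using y by (intro G.commutator_mem)
  have "r \<otimes> y = (r \<otimes> y \<otimes> inv r \<otimes> inv y) \<otimes> (y \<otimes> r)"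
    using r y by (simp add: G.m_assoc G.inv_solve_left G.inv_solve_left')
  then have "kernel_comm #> (r \<otimes> y) = (kernel_comm #> (r \<otimes> y \<otimes> inv r \<otimes> inv y)) #> (y \<otimes> r)"
    using r y c N.subset by (simp add: G.coset_mult_assoc)
  also have "\<dots> = kernel_comm #> (y \<otimes> r)"
    using c by (simp add: N.rcos_const)
  finally show ?thesis
    using r y by (simp add: N.rcos_sum)
qed

end

text \<open>
  A lift of the image of each generator is determined up to a scalar, and the scalar can be chosen
  so that the relation for this generator holds because nonzero complex numbers have \<open>m i\<close>-th roots.
\<close>

lemma lift_projective_representation:
  assumes m: "\<And>i. i < d \<Longrightarrow> 0 < m i" and \<rho>: "\<rho> \<in> hom (free_product_cyclic d m) (PGL n)"
  obtains \<psi> where "\<psi> \<in> hom (free_product_cyclic d m) (GL n)"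
    "\<And>x. x \<in> carrier (free_product_cyclic d m) \<Longrightarrow> scalar_mats n #>\<^bsub>GL n\<^esub> \<psi> x = \<rho> x"
proof -
  let ?F = "free_product_cyclic d m" and ?f = "free_product_gen d m"
  interpret F: group ?F by (rule group_free_product_cyclic)
  interpret GL: group "GL n" by (rule group_GL)
  interpret S: normal "scalar_mats n" "GL n" by (rule normal_scalar_mats)
  interpret \<rho>: group_hom ?F "PGL n" \<rho>
    using \<rho> group_PGL F.is_group by (simp add: group_hom_def group_hom_axioms_def)
  have "\<exists>B\<in>carrier (GL n). B [^]\<^bsub>GL n\<^esub> m i = \<one>\<^bsub>GL n\<^esub> \<and> scalar_mats n #>\<^bsub>GL n\<^esub> B = \<rho> (?f i)"
    if i: "i < d" for i
  proof -
    have f: "?f i \<in> carrier ?F"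
      by (rule free_product_gen_closed[OF i])
    obtain A where A: "A \<in> carrier (GL n)" "\<rho> (?f i) = scalar_mats n #>\<^bsub>GL n\<^esub> A"
      using \<rho>.hom_closed[OF f] by (auto simp: PGL_def carrier_FactGroup)
    have "scalar_mats n #>\<^bsub>GL n\<^esub> (A [^]\<^bsub>GL n\<^esub> m i) = \<rho> (?f i) [^]\<^bsub>PGL n\<^esub> m i"
      unfolding A(2) PGL_def using A(1) by (simp add: S.FactGroup_pow)
    also have "\<dots> = \<rho> (?f i [^]\<^bsub>?F\<^esub> m i)"
      using \<rho>.hom_nat_pow[OF f, of "m i"] by simp
    also have "\<dots> = scalar_mats n"
      using free_product_gen_pow[OF i, of m] by (simp add: PGL_def[of n])
    finally have "A [^]\<^bsub>GL n\<^esub> m i \<in> scalar_mats n"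
      using GL.rcos_self[OF GL.nat_pow_closed[OF A(1)] S.subgroup_axioms] by metis
    then obtain l where l: "A [^]\<^bsub>GL n\<^esub> m i = l \<cdot>\<^sub>m 1\<^sub>m n" "l \<noteq> 0"
      by (auto simp: scalar_mats_def)
    \<comment> \<open>The relation holds in \<open>PGL n\<close>, so the power of \<open>A\<close>
      is a scalar \<open>l\<close>. Dividing \<open>A\<close> by an \<open>m i\<close>-th root of
      \<open>l\<close>, which exists as \<open>0 < m i\<close>, makes the relation hold in
      \<open>GL n\<close> without changing the coset.\<close>
    obtain u where u: "u \<noteq> 0" "l = u ^ m i"
      using exists_complex_root_nonzero[OF l(2), of "m i"] m[OF i] by auto
    define z where "z = inverse u \<cdot>\<^sub>m 1\<^sub>m n"
    have z: "z \<in> scalar_mats n"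
      using u by (auto simp: z_def scalar_mats_def intro!: exI[of _ "inverse u"])
    then have zG: "z \<in> carrier (GL n)" by simp
    have z_pow: "z [^]\<^bsub>GL n\<^esub> k = inverse u ^ k \<cdot>\<^sub>m 1\<^sub>m n" for k :: nat
      by (induction k) (auto simp: z_def scalar_mult_mat intro!: eq_matI)
    have "(z \<otimes>\<^bsub>GL n\<^esub> A) [^]\<^bsub>GL n\<^esub> m i = z [^]\<^bsub>GL n\<^esub> m i \<otimes>\<^bsub>GL n\<^esub> A [^]\<^bsub>GL n\<^esub> m i"
      by (rule GL.pow_mult_distrib[OF scalar_mats_central[OF z A(1)] zG A(1)])
    also have "\<dots> = \<one>\<^bsub>GL n\<^esub>"
      using u by (auto simp: z_pow l scalar_mult_mat power_inverse intro!: eq_matI)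
    finally have "(z \<otimes>\<^bsub>GL n\<^esub> A) [^]\<^bsub>GL n\<^esub> m i = \<one>\<^bsub>GL n\<^esub>" .
    moreover have "scalar_mats n #>\<^bsub>GL n\<^esub> (z \<otimes>\<^bsub>GL n\<^esub> A) = \<rho> (?f i)"
      using GL.coset_mult_assoc[OF S.subset zG A(1)] S.rcos_const[OF GL.is_group z] A(2) by simp
    ultimately show ?thesis
      using zG A(1) by (intro bexI[of _ "z \<otimes>\<^bsub>GL n\<^esub> A"] conjI) (simp_all del: mult_GL)
  qed
  then obtain B where B: "\<And>i. i < d \<Longrightarrow> B i \<in> carrier (GL n)"
      "\<And>i. i < d \<Longrightarrow> B i [^]\<^bsub>GL n\<^esub> m i = \<one>\<^bsub>GL n\<^esub>"
      "\<And>i. i < d \<Longrightarrow> scalar_mats n #>\<^bsub>GL n\<^esub> B i = \<rho> (?f i)"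
    by metis
  have "\<exists>\<psi>\<in>hom ?F (GL n). \<forall>i<d. \<psi> (?f i) = B i"
    by (rule free_product_cyclic_universal[where d = d and a = B and m = m, OF group_GL]) (use B(1,2) in blast)+
  then obtain \<psi> where \<psi>: "\<psi> \<in> hom ?F (GL n)" "\<And>i. i < d \<Longrightarrow> \<psi> (?f i) = B i"
    by blast
  have hom: "(\<lambda>x. scalar_mats n #>\<^bsub>GL n\<^esub> \<psi> x) \<in> hom ?F (PGL n)"
    using hom_compose[OF \<psi>(1) S.r_coset_hom_Mod] by (simp add: PGL_def comp_def)
  have "\<rho> x = scalar_mats n #>\<^bsub>GL n\<^esub> \<psi> x" if "x \<in> carrier ?F" for x
  proof (rule \<rho>.hom_eq_on_generate[OF _ hom])
    show "?f ` {..<d} \<subseteq> carrier ?F"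
      using free_product_gen_closed by auto
    show "x \<in> generate ?F (?f ` {..<d})"
      using that by (simp add: generate_free_product_gen)
    show "\<rho> y = scalar_mats n #>\<^bsub>GL n\<^esub> \<psi> y" if "y \<in> ?f ` {..<d}" for y
      using that \<psi>(2) B(3) by auto
  qed
  with \<psi>(1) show thesis
    by (intro that[of \<psi>]) auto
qed

lemma cover_of_free_product_cyclic:
  fixes G :: "('g, 'x) monoid_scheme" and d m \<phi>
  defines "F \<equiv> free_product_cyclic d m"
  defines "N \<equiv> commutator_subgroup F (kernel F G \<phi>) (carrier F)"
  defines "h \<equiv> \<lambda>i. N #>\<^bsub>F\<^esub> free_product_gen d m i"
  assumes G: "group G" "finite (carrier G)" and m: "\<And>i. i < d \<Longrightarrow> 0 < m i" and \<phi>: "\<phi> \<in> epi F G"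
  shows "is_cover G (F Mod N) (induced_hom \<phi>)"
    and "finite (carrier (F Mod N))"
    and "h ` {..<d} \<subseteq> carrier (F Mod N)"
    and "generate (F Mod N) (h ` {..<d}) = carrier (F Mod N)"
    and "\<And>i. i < d \<Longrightarrow> induced_hom \<phi> (h i) = \<phi> (free_product_gen d m i)"
    and "\<And>i. i < d \<Longrightarrow> group.ord (F Mod N) (h i) \<noteq> 0"
proof -
  let ?E = "F Mod N" and ?\<pi> = "induced_hom \<phi>" and ?f = "free_product_gen d m"
  interpret F: group F unfolding F_def by (rule group_free_product_cyclic)
  interpret G: group G by fact
  interpret \<phi>: group_hom F G \<phi>
    using F.is_group G \<phi> by (simp add: group_hom_def group_hom_axioms_def epi_def)
  interpret N: normal N F unfolding N_def by (rule \<phi>.normal_kernel_comm)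
  interpret E: group ?E by (rule N.factorgroup_is_group)
  interpret q: group_hom F ?E "\<lambda>x. N #>\<^bsub>F\<^esub> x"
    using F.is_group E.is_group N.r_coset_hom_Mod by (simp add: group_hom_def group_hom_axioms_def)
  have f: "?f i \<in> carrier F" if "i < d" for i
    unfolding F_def by (rule free_product_gen_closed[OF that])
  show hE: "h ` {..<d} \<subseteq> carrier ?E"
    unfolding h_def using f q.hom_closed by blast
  show gen: "generate ?E (h ` {..<d}) = carrier ?E"
  proof -
    have "h ` {..<d} = (\<lambda>x. N #>\<^bsub>F\<^esub> x) ` ?f ` {..<d}"
      by (auto simp: h_def)
    moreover have "?f ` {..<d} \<subseteq> carrier F" using f by auto
    ultimately show ?thesis
      using q.generate_img[of "?f ` {..<d}"]
      by (simp add: generate_free_product_gen[of d m, folded F_def] carrier_FactGroup)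
  qed
  show "?\<pi> (h i) = \<phi> (?f i)" if "i < d" for i
    unfolding h_def N_def by (rule \<phi>.induced_hom_kernel_comm(2)[OF f[OF that]])
  have h_pow: "h i [^]\<^bsub>?E\<^esub> m i = \<one>\<^bsub>?E\<^esub>" if i: "i < d" for i
    using q.hom_nat_pow[OF f[OF i], of "m i"] free_product_gen_pow[OF i, of m]
    by (simp add: h_def F_def[symmetric])
  show "E.ord (h i) \<noteq> 0" if i: "i < d" for i
  proof -
    have "h i \<in> carrier ?E"
      using hE i by auto
    then have "E.ord (h i) dvd m i"
      using h_pow[OF i] E.pow_eq_id by blast
    then show ?thesis
      using m[OF i] by auto
  qed
  have \<pi>: "?\<pi> \<in> epi ?E G"
    unfolding N_def by (rule \<phi>.induced_hom_kernel_comm_epi[OF \<phi>])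
  have central: "a \<otimes>\<^bsub>?E\<^esub> x = x \<otimes>\<^bsub>?E\<^esub> a" if "a \<in> kernel ?E G ?\<pi>" "x \<in> carrier ?E" for a x
    using \<phi>.induced_hom_kernel_comm_central that unfolding N_def by blast
  \<comment> \<open>The relators of the free product give the generators finite order, as required
    for a central extension of a finite group to be finite.\<close>
  show fin: "finite (carrier ?E)"
  proof (rule finite_central_extension[OF E.is_group G \<pi> central gen hE])
    fix x assume "x \<in> h ` {..<d}"
    then show "\<exists>n::nat. 0 < n \<and> x [^]\<^bsub>?E\<^esub> n = \<one>\<^bsub>?E\<^esub>"
      using h_pow m by blast
  qed auto
  have lift: "\<exists>\<rho>'\<in>hom ?E (GL n). \<forall>x\<in>carrier ?E. scalar_mats n #>\<^bsub>GL n\<^esub> \<rho>' x = \<rho> (?\<pi> x)"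
    if \<rho>: "\<rho> \<in> hom G (PGL n)" for n \<rho>
  proof -
    interpret GL: group "GL n" by (rule group_GL)
    have "\<rho> \<circ> \<phi> \<in> hom (free_product_cyclic d m) (PGL n)"
      using hom_compose[OF \<phi>.homh \<rho>] by (simp add: F_def)
    from lift_projective_representation[OF m this] obtain \<psi> where \<psi>: "\<psi> \<in> hom F (GL n)"
      "\<And>x. x \<in> carrier F \<Longrightarrow> scalar_mats n #>\<^bsub>GL n\<^esub> \<psi> x = \<rho> (\<phi> x)"
      by (auto simp: F_def)
    interpret \<psi>: group_hom F "GL n" \<psi>
      using \<psi>(1) F.is_group group_GL by (simp add: group_hom_def group_hom_axioms_def)
    have \<rho>_one: "\<rho> \<one>\<^bsub>G\<^esub> = scalar_mats n"
      using hom_one[OF \<rho> G(1) group_PGL] by (simp add: PGL_def)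
    have "N \<subseteq> kernel F (GL n) \<psi>"
      unfolding N_def commutator_subgroup_def
    proof (rule F.generate_subgroup_incl[OF _ \<psi>.subgroup_kernel], rule subsetI)
      fix c assume "c \<in> (\<Union>r\<in>kernel F G \<phi>. \<Union>k\<in>carrier F. {r \<otimes>\<^bsub>F\<^esub> k \<otimes>\<^bsub>F\<^esub> inv\<^bsub>F\<^esub> r \<otimes>\<^bsub>F\<^esub> inv\<^bsub>F\<^esub> k})"
      then obtain r k where rk: "r \<in> carrier F" "\<phi> r = \<one>\<^bsub>G\<^esub>" "k \<in> carrier F"
          "c = r \<otimes>\<^bsub>F\<^esub> k \<otimes>\<^bsub>F\<^esub> inv\<^bsub>F\<^esub> r \<otimes>\<^bsub>F\<^esub> inv\<^bsub>F\<^esub> k"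
        by (auto simp: kernel_def)
      \<comment> \<open>\<open>\<psi>\<close> is scalar on the kernel of \<open>\<phi>\<close>, so
        its values there commute with everything and the commutators generating \<open>N\<close> are
        killed.\<close>
      have "scalar_mats n #>\<^bsub>GL n\<^esub> \<psi> r = scalar_mats n"
        using \<psi>(2)[OF rk(1)] rk(2) \<rho>_one by simp
      then have "\<psi> r \<in> scalar_mats n"
        using GL.rcos_self[OF \<psi>.hom_closed[OF rk(1)] subgroup_scalar_mats] by simp
      then have "\<psi> r \<otimes>\<^bsub>GL n\<^esub> \<psi> k = \<psi> k \<otimes>\<^bsub>GL n\<^esub> \<psi> r"
        using rk(3) by (intro scalar_mats_central) auto
      moreover have closed: "\<psi> r \<in> carrier (GL n)" "\<psi> k \<in> carrier (GL n)"
        using rk by auto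
      have "\<psi> c = \<psi> r \<otimes>\<^bsub>GL n\<^esub> \<psi> k \<otimes>\<^bsub>GL n\<^esub> inv\<^bsub>GL n\<^esub> \<psi> r \<otimes>\<^bsub>GL n\<^esub> inv\<^bsub>GL n\<^esub> \<psi> k"
        using rk by (simp del: mult_GL one_GL)
      ultimately have "\<psi> c = \<psi> k \<otimes>\<^bsub>GL n\<^esub> \<psi> r \<otimes>\<^bsub>GL n\<^esub> inv\<^bsub>GL n\<^esub> \<psi> r \<otimes>\<^bsub>GL n\<^esub> inv\<^bsub>GL n\<^esub> \<psi> k"
        by (simp del: mult_GL one_GL)
      also have "\<dots> = \<one>\<^bsub>GL n\<^esub>"
        using closed GL.m_assoc[of "\<psi> k" "\<psi> r" "inv\<^bsub>GL n\<^esub> \<psi> r"]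
        by (simp del: mult_GL one_GL)
      finally show "c \<in> kernel F (GL n) \<psi>"
        using rk by (simp add: kernel_def del: one_GL)
    qed
    from \<psi>.FactGroup_universal_kernel[OF N.normal_axioms this] obtain \<rho>' where
      \<rho>': "\<rho>' \<in> hom ?E (GL n)" "\<And>x. x \<in> carrier F \<Longrightarrow> \<rho>' (N #>\<^bsub>F\<^esub> x) = \<psi> x"
      by blast
    show ?thesis
    proof (intro bexI ballI)
      fix x assume "x \<in> carrier ?E"
      then obtain y where "y \<in> carrier F" "x = N #>\<^bsub>F\<^esub> y"
        by (auto simp: carrier_FactGroup)
      then show "scalar_mats n #>\<^bsub>GL n\<^esub> \<rho>' x = \<rho> (?\<pi> x)"
        using \<rho>'(2) \<psi>(2) \<phi>.induced_hom_kernel_comm(2)[of y] by (simp add: N_def)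
    qed (rule \<rho>')
  qed
  have "finite (kernel ?E G ?\<pi>)"
    using fin by (auto simp: kernel_def intro: finite_subset)
  then show "is_cover G ?E ?\<pi>"
    unfolding is_cover_def using E.is_group \<pi> central lift by blast
qed

section \<open>The realization\<close>

locale generating_complex = group G for G (structure) +
  fixes d :: nat and g :: "nat \<Rightarrow> 'a"
  assumes gen_closed [simp]: "\<And>i. i < d \<Longrightarrow> g i \<in> carrier G"
begin

abbreviation gen_coset :: "nat \<Rightarrow> 'a \<Rightarrow> 'a set" where
  "gen_coset i x \<equiv> x <# generate G {g i}"

lemma subgroup_gen: "i < d \<Longrightarrow> subgroup (generate G {g i}) G"
  by (rule generate_is_subgroup) simp

lemma gen_coset_eqI: "i < d \<Longrightarrow> x \<in> carrier G \<Longrightarrow> y \<in> gen_coset i x \<Longrightarrow> gen_coset i y = gen_coset i x"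
  using l_repr_independence[OF _ _ subgroup_gen] by simp

lemma gen_coset_self: "i < d \<Longrightarrow> x \<in> carrier G \<Longrightarrow> x \<in> gen_coset i x"
  using generate.one[of G "{g i}"] by (auto simp: l_coset_def intro!: bexI[of _ \<one>])

lemma gen_coset_carrier: "i < d \<Longrightarrow> x \<in> carrier G \<Longrightarrow> gen_coset i x \<subseteq> carrier G"
  using subgroup_gen by (intro l_coset_subset_G) (auto dest: subgroup.subset)

lemma gen_coset_mult [simp]:
  assumes "i < d" "x \<in> carrier G"
  shows "gen_coset i (x \<otimes> g i) = gen_coset i x"
  using assms by (intro gen_coset_eqI) (auto simp: l_coset_def intro: generate.incl)

lemma cells_simps [simp]:
  "Vertex x \<in> cells G d g \<longleftrightarrow> x \<in> carrier G"
  "Center i K \<in> cells G d g \<longleftrightarrow> i < d \<and> K \<in> gen_coset i ` carrier G"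
  "Edge i x \<in> cells G d g \<longleftrightarrow> i < d \<and> x \<in> carrier G"
  "Spoke i x \<in> cells G d g \<longleftrightarrow> i < d \<and> x \<in> carrier G"
  "Triangle i x \<in> cells G d g \<longleftrightarrow> i < d \<and> x \<in> carrier G"
proof -
  have ex: "s \<in> cells G d g \<longleftrightarrow> (\<exists>x\<in>carrier G. \<exists>\<sigma>\<in>cell_symbols d. s = translate G g x \<sigma>)" for s
    by (auto simp: cells_def)
  have sym: "(\<exists>\<sigma>\<in>cell_symbols d. Q \<sigma>) \<longleftrightarrow>
      Q Sym_v \<or> (\<exists>i<d. Q (Sym_c i) \<or> Q (Sym_e i) \<or> Q (Sym_r i) \<or> Q (Sym_f i))" for Q
    by (auto simp: cell_symbols_def)
  show "Vertex x \<in> cells G d g \<longleftrightarrow> x \<in> carrier G"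
    "Center i K \<in> cells G d g \<longleftrightarrow> i < d \<and> K \<in> gen_coset i ` carrier G"
    "Edge i x \<in> cells G d g \<longleftrightarrow> i < d \<and> x \<in> carrier G"
    "Spoke i x \<in> cells G d g \<longleftrightarrow> i < d \<and> x \<in> carrier G"
    "Triangle i x \<in> cells G d g \<longleftrightarrow> i < d \<and> x \<in> carrier G"
    unfolding ex sym by auto
qed

lemma translate_in_cells: "x \<in> carrier G \<Longrightarrow> \<sigma> \<in> cell_symbols d \<Longrightarrow> translate G g x \<sigma> \<in> cells G d g"
  by (auto simp: cells_def)

lemma cells_translate:
  assumes "s \<in> cells G d g"
  obtains x \<sigma> where "x \<in> carrier G" "\<sigma> \<in> cell_symbols d" "s = translate G g x \<sigma>"
  using assms by (auto simp: cells_def)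

lemma cell_face_in_cells:
  assumes "s \<in> cells G d g"
  shows "cell_face G g k s \<in> cells G d g"
  using assms by (cases s) auto

lemma cell_dim_face: "0 < cell_dim s \<Longrightarrow> cell_dim (cell_face H c k s) = cell_dim s - 1"
  by (cases s) auto

text \<open>The vertices of the ordered simplices; an index beyond the dimension gives the last vertex.\<close>

fun cell_vertex :: "nat \<Rightarrow> 'a cell \<Rightarrow> 'a cell" where
  "cell_vertex j (Vertex x) = Vertex x"
| "cell_vertex j (Center i K) = Center i K"
| "cell_vertex j (Edge i x) = (if j = 0 then Vertex x else Vertex (x \<otimes> g i))"
| "cell_vertex j (Spoke i x) = (if j = 0 then Vertex x else Center i (gen_coset i x))"
| "cell_vertex j (Triangle i x) =
     (if j = 0 then Vertex x else if j = 1 then Vertex (x \<otimes> g i) else Center i (gen_coset i x))"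

lemma cell_vertex_in_cells: "s \<in> cells G d g \<Longrightarrow> cell_vertex j s \<in> cells G d g"
  by (cases s) auto

lemma cell_vertex_dim_0 [simp]: "cell_dim s = 0 \<Longrightarrow> cell_vertex j s = s"
  by (cases s) auto

text \<open>Face \<open>k\<close> omits vertex \<open>k\<close> and shifts the later ones. For a
  triangle this uses that \<open>x\<close> and its product with \<open>g i\<close> lie in the same
  coset, so both spokes end at the same center.\<close>

lemma cell_vertex_face:
  assumes "s \<in> cells G d g" "0 < cell_dim s" "k \<le> cell_dim s" "j < cell_dim s"
  shows "cell_vertex j (cell_face G g k s) = cell_vertex (if j < k then j else Suc j) s"
proof (cases s)
  case (Triangle i x)
  then have "j = 0 \<or> j = 1" "k = 0 \<or> k = 1 \<or> k = 2" "i < d" "x \<in> carrier G"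
    using assms by auto
  then show ?thesis using Triangle by auto
qed (use assms in auto)

text \<open>If \<open>g i\<close> were 1, the edge of index \<open>i\<close> would be a loop, and a
  star would reach one cell from two corners.\<close>

lemma cell_vertex_eq_iff:
  assumes ne: "\<And>i. i < d \<Longrightarrow> g i \<noteq> \<one>"
    and s: "s \<in> cells G d g" and jk: "j \<le> cell_dim s" "k \<le> cell_dim s"
    and eq: "cell_vertex j s = cell_vertex k s"
  shows "j = k"
proof -
  have ne': "x \<otimes> g i \<noteq> x" "x \<noteq> x \<otimes> g i" if "i < d" "x \<in> carrier G" for i x
    using ne[OF that(1)] that by auto
  show ?thesis
  proof (cases s)
    case (Triangle i x)
    then have "j = 0 \<or> j = 1 \<or> j = 2" "k = 0 \<or> k = 1 \<or> k = 2" "i < d" "x \<in> carrier G"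
      using s jk by auto
    then show ?thesis
      using Triangle eq ne'[of i x] by auto
  next
    case (Edge i x)
    then have "j = 0 \<or> j = 1" "k = 0 \<or> k = 1" "i < d" "x \<in> carrier G"
      using s jk by auto
    then show ?thesis
      using Edge eq ne'[of i x] by auto
  next
    case (Spoke i x)
    then have "j = 0 \<or> j = 1" "k = 0 \<or> k = 1"
      using jk by auto
    then show ?thesis
      using Spoke eq by auto
  qed (use jk in auto)
qed

section \<open>Points, topology and open stars of the realization\<close>

definition complex_pairs :: "('a cell \<times> (nat \<Rightarrow> real)) set" where
  "complex_pairs = {(s, t). s \<in> cells G d g \<and> t \<in> standard_simplex (cell_dim s)}"

abbreviation sym_gluing where "sym_gluing \<equiv> gluing G d g \<union> (gluing G d g)\<inverse>"
abbreviation proj where "proj \<equiv> complex_point G d g"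

lemma proj_eq_iff: "proj z = proj z' \<longleftrightarrow> (z, z') \<in> sym_gluing\<^sup>*"
proof -
  have "equiv UNIV (sym_gluing\<^sup>*)"
    by (auto simp: equiv_def refl_on_def intro!: sym_rtrancl trans_rtrancl) (auto simp: sym_def)
  from eq_equiv_class_iff[OF this] show ?thesis
    by (simp add: complex_point_def)
qed

lemma proj_face:
  assumes "s \<in> cells G d g" "0 < cell_dim s" "k \<le> cell_dim s" "t \<in> standard_simplex (cell_dim s - 1)"
  shows "proj (s, simplical_face k t) = proj (cell_face G g k s, t)"
proof -
  have "((s, simplical_face k t), (cell_face G g k s, t)) \<in> gluing G d g"
    unfolding gluing_def using assms by blast
  then show ?thesis
    unfolding proj_eq_iff by blast
qed

abbreviation realization where "realization \<equiv> associated_complex G d g"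

lemma topspace_sum:
  "topspace (sum_topology (\<lambda>s. subtopology (powertop_real UNIV) (standard_simplex (cell_dim s)))
     (cells G d g)) = complex_pairs"
  by (auto simp: complex_pairs_def)

lemma openin_realization:
  "openin realization U \<longleftrightarrow> U \<subseteq> proj ` complex_pairs \<and>
     (\<forall>s\<in>cells G d g. openin (subtopology (powertop_real UNIV) (standard_simplex (cell_dim s)))
        {t \<in> standard_simplex (cell_dim s). proj (s, t) \<in> U})"
proof -
  have "{t. (s, t) \<in> {z \<in> complex_pairs. proj z \<in> U}} =
      {t \<in> standard_simplex (cell_dim s). proj (s, t) \<in> U}" if "s \<in> cells G d g" for s
    using that by (auto simp: complex_pairs_def)
  then show ?thesis
    unfolding associated_complex_def openin_quotient_topology topspace_sum
    by (auto simp: openin_sum_topology complex_pairs_def)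
qed

lemma topspace_realization: "topspace realization = proj ` complex_pairs"
proof
  show "topspace realization \<subseteq> proj ` complex_pairs"
    using openin_realization by blast
  have "openin realization (proj ` complex_pairs)"
  proof -
    have "{t \<in> standard_simplex (cell_dim s). proj (s, t) \<in> proj ` complex_pairs} =
        standard_simplex (cell_dim s)" if "s \<in> cells G d g" for s
      using that by (auto simp: complex_pairs_def)
    then show ?thesis
      using openin_topspace[of "subtopology (powertop_real UNIV) (standard_simplex p)" for p]
      by (simp add: openin_realization topspace_standard_simplex)
  qed
  then show "proj ` complex_pairs \<subseteq> topspace realization"
    by (rule openin_subset)
qed

text \<open>The open star of the vertex \<open>w\<close>, in terms of representatives: the
  barycentric coordinate belonging to \<open>w\<close> is positive. Stating it for pairs rather than
  classes permits checking one gluing step at a time.\<close>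

definition star_pairs :: "'a cell \<Rightarrow> ('a cell \<times> (nat \<Rightarrow> real)) set" where
  "star_pairs w = {(s, t). \<exists>j\<le>cell_dim s. cell_vertex j s = w \<and> 0 < t j}"

definition star :: "'a cell \<Rightarrow> ('a cell \<times> (nat \<Rightarrow> real)) set set" where
  "star w = proj ` (star_pairs w \<inter> complex_pairs)"

text \<open>\<open>simplical_face k\<close> inserts a zero coordinate at \<open>k\<close>, so the
  positive coordinates of the two representatives correspond, together with the vertices they belong
  to.\<close>

lemma star_pairs_gluing:
  assumes "(z, z') \<in> gluing G d g"
  shows "z \<in> star_pairs w \<longleftrightarrow> z' \<in> star_pairs w"
proof -
  obtain s k t where st: "z = (s, simplical_face k t)" "z' = (cell_face G g k s, t)"
    and s: "s \<in> cells G d g" "0 < cell_dim s" "k \<le> cell_dim s"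
    using assms by (auto simp: gluing_def)
  note vertex = cell_vertex_face[OF s]
  show ?thesis
  proof
    assume "z \<in> star_pairs w"
    then obtain j where j: "j \<le> cell_dim s" "cell_vertex j s = w" "0 < simplical_face k t j"
      by (auto simp: star_pairs_def st)
    then have "j \<noteq> k"
      by (auto simp: simplical_face_def)
    \<comment> \<open>The index within the face of vertex \<open>j\<close>; it exists because the
      coordinate inserted at \<open>k\<close> is zero, whence \<open>j \<noteq> k\<close>.\<close>
    define l where "l = (if j < k then j else j - 1)"
    have l: "l < cell_dim s" "(if l < k then l else Suc l) = j" "0 < t l"
      using j \<open>j \<noteq> k\<close> s by (auto simp: l_def simplical_face_def split: if_splits)
    then have "cell_vertex l (cell_face G g k s) = w"
      using vertex[of l] j by simp
    then show "z' \<in> star_pairs w"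
      using l s by (auto simp: star_pairs_def st cell_dim_face intro!: exI[of _ l])
  next
    assume "z' \<in> star_pairs w"
    then obtain l where l: "l \<le> cell_dim s - 1" "cell_vertex l (cell_face G g k s) = w" "0 < t l"
      using s by (auto simp: star_pairs_def st cell_dim_face)
    define j where "j = (if l < k then l else Suc l)"
    have "cell_vertex j s = w"
      using vertex[of l] l s by (simp add: j_def)
    moreover have "j \<le> cell_dim s" "0 < simplical_face k t j"
      using l s by (auto simp: j_def simplical_face_def)
    ultimately show "z \<in> star_pairs w"
      by (auto simp: star_pairs_def st)
  qed
qed

text \<open>Membership in a star is an invariant of points. It is used also to tell points
  apart.\<close>

lemma star_pairs_proj_eq:
  assumes "proj z = proj z'"
  shows "z \<in> star_pairs w \<longleftrightarrow> z' \<in> star_pairs w"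
proof -
  have "(z, z') \<in> sym_gluing\<^sup>*"
    using assms by (simp add: proj_eq_iff)
  then show ?thesis
    by (induction rule: rtrancl_induct) (auto simp: star_pairs_gluing)
qed

lemma proj_in_star_iff:
  assumes "z \<in> complex_pairs"
  shows "proj z \<in> star w \<longleftrightarrow> z \<in> star_pairs w"
proof
  assume "proj z \<in> star w"
  then obtain z' where "z' \<in> star_pairs w" "proj z = proj z'"
    by (auto simp: star_def)
  then show "z \<in> star_pairs w"
    using star_pairs_proj_eq[of z z' w] by blast
qed (use assms in \<open>auto simp: star_def\<close>)

lemma openin_star: "openin realization (star w)"
  unfolding openin_realization
proof (intro conjI ballI)
  show "star w \<subseteq> proj ` complex_pairs"
    by (auto simp: star_def)
  fix s assume s: "s \<in> cells G d g"
  let ?T = "subtopology (powertop_real UNIV) (standard_simplex (cell_dim s))"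
  let ?J = "{j. j \<le> cell_dim s \<and> cell_vertex j s = w}"
  \<comment> \<open>On a single cell the star is cut out by positivity of one coordinate, for each
    corner equal to \<open>w\<close>.\<close>
  have "{t \<in> standard_simplex (cell_dim s). proj (s, t) \<in> star w} =
      (\<Union>j\<in>?J. {t \<in> topspace ?T. t j \<in> {0<..}})"
    using s by (auto simp: proj_in_star_iff complex_pairs_def star_pairs_def)
  moreover have "openin ?T {t \<in> topspace ?T. t j \<in> {0<..}}" for j
    by (rule openin_continuous_map_preimage[where Y = euclideanreal])
      (auto intro!: continuous_map_from_subtopology continuous_map_product_projection)
  ultimately show "openin ?T {t \<in> standard_simplex (cell_dim s). proj (s, t) \<in> star w}"
    by (simp only: openin_clauses) blast
qed

end

section \<open>The map of complexes\<close>

fun map_cell :: "('a \<Rightarrow> 'b) \<Rightarrow> 'a cell \<Rightarrow> 'b cell" where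
  "map_cell f (Vertex x) = Vertex (f x)"
| "map_cell f (Center i K) = Center i (f ` K)"
| "map_cell f (Edge i x) = Edge i (f x)"
| "map_cell f (Spoke i x) = Spoke i (f x)"
| "map_cell f (Triangle i x) = Triangle i (f x)"

lemma cell_dim_map_cell [simp]: "cell_dim (map_cell f s) = cell_dim s"
  by (cases s) auto

lemma map_cell_eq_simps [simp]:
  "map_cell f s = Vertex y \<longleftrightarrow> (\<exists>x. s = Vertex x \<and> f x = y)"
  "map_cell f s = Center i L \<longleftrightarrow> (\<exists>K. s = Center i K \<and> f ` K = L)"
  "map_cell f s = Edge i y \<longleftrightarrow> (\<exists>x. s = Edge i x \<and> f x = y)"
  "map_cell f s = Spoke i y \<longleftrightarrow> (\<exists>x. s = Spoke i x \<and> f x = y)"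
  "map_cell f s = Triangle i y \<longleftrightarrow> (\<exists>x. s = Triangle i x \<and> f x = y)"
  by (cases s; auto)+

locale complex_epi =
  E: generating_complex E d h + G: generating_complex G d "\<lambda>i. \<pi> (h i)"
  for E :: "('e, 'x) monoid_scheme" and G :: "('g, 'y) monoid_scheme" and d h and \<pi> :: "'e \<Rightarrow> 'g" +
  assumes epi: "\<pi> \<in> epi E G"
begin

sublocale \<pi>: group_hom E G \<pi>
  using E.is_group G.is_group epi by (simp add: group_hom_def group_hom_axioms_def epi_def)

abbreviation "g \<equiv> \<lambda>i. \<pi> (h i)"

lemma image_gen_coset:
  assumes "i < d" "x \<in> carrier E"
  shows "\<pi> ` E.gen_coset i x = G.gen_coset i (\<pi> x)"
proof -
  have sub: "generate E {h i} \<subseteq> carrier E"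
    using assms by (intro E.generate_incl) simp
  have "generate G {g i} = \<pi> ` generate E {h i}"
    using \<pi>.generate_img[of "{h i}"] assms by simp
  then show ?thesis
    using assms sub by (force simp: l_coset_def image_iff)
qed

lemma map_cell_translate:
  assumes "x \<in> carrier E" "\<sigma> \<in> cell_symbols d"
  shows "map_cell \<pi> (translate E h x \<sigma>) = translate G g (\<pi> x) \<sigma>"
  using assms by (cases \<sigma>) (auto simp: cell_symbols_def image_gen_coset)

lemma map_cell_in_cells: "s \<in> cells E d h \<Longrightarrow> map_cell \<pi> s \<in> cells G d g"
  by (cases s) (auto simp: image_gen_coset)

lemma map_cell_face:
  "s \<in> cells E d h \<Longrightarrow> map_cell \<pi> (cell_face E h k s) = cell_face G g k (map_cell \<pi> s)"
  by (cases s) (auto simp: image_gen_coset)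

lemma map_cell_vertex:
  "s \<in> cells E d h \<Longrightarrow> map_cell \<pi> (E.cell_vertex j s) = G.cell_vertex j (map_cell \<pi> s)"
  by (cases s) (auto simp: image_gen_coset)

text \<open>The delicate case is a center: \<open>s0\<close> is given by a whole coset, but the
  image of this coset is the coset of \<open>x\<close>, so some element of it lies over
  \<open>x\<close> and names the required spoke.\<close>

lemma cell_face_lift:
  assumes s: "s \<in> cells G d g" and s0: "s0 \<in> cells E d h"
    and eq: "map_cell \<pi> s0 = cell_face G g k s" and k: "0 < cell_dim s" "k \<le> cell_dim s"
  shows "\<exists>s'\<in>cells E d h. map_cell \<pi> s' = s \<and> cell_face E h k s' = s0"
proof -
  \<comment> \<open>In edges and triangles the face opposite to vertex 0 is named by the far end of
    the edge, so its lift \<open>y\<close> has to be moved back by \<open>h i\<close>.\<close>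
  have pred: "y \<otimes>\<^bsub>E\<^esub> inv\<^bsub>E\<^esub> h i \<in> carrier E" "\<pi> (y \<otimes>\<^bsub>E\<^esub> inv\<^bsub>E\<^esub> h i) = x"
      "y \<otimes>\<^bsub>E\<^esub> inv\<^bsub>E\<^esub> h i \<otimes>\<^bsub>E\<^esub> h i = y"
    if "i < d" "y \<in> carrier E" "x \<in> carrier G" "\<pi> y = x \<otimes>\<^bsub>G\<^esub> \<pi> (h i)" for i x y
    using that by (simp_all add: E.m_assoc G.m_assoc)
  show ?thesis
  proof (cases s)
    case (Edge i x)
    then have ix: "i < d" "x \<in> carrier G" "k = 0 \<or> k = 1"
      using s k by auto
    show ?thesis
    proof (cases "k = 0")
      case True
      then obtain y where y: "s0 = Vertex y" "y \<in> carrier E" "\<pi> y = x \<otimes>\<^bsub>G\<^esub> \<pi> (h i)"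
        using eq s0 Edge by auto
      then show ?thesis
        using pred[OF ix(1) y(2) ix(2) y(3)] ix Edge True
        by (intro bexI[of _ "Edge i (y \<otimes>\<^bsub>E\<^esub> inv\<^bsub>E\<^esub> h i)"]) auto
    next
      case False
      then obtain y where y: "s0 = Vertex y" "y \<in> carrier E" "\<pi> y = x"
        using eq s0 Edge by auto
      then show ?thesis
        using ix Edge False by (intro bexI[of _ "Edge i y"]) auto
    qed
  next
    case (Spoke i x)
    then have ix: "i < d" "x \<in> carrier G" "k = 0 \<or> k = 1"
      using s k by auto
    show ?thesis
    proof (cases "k = 0")
      case True
      then obtain y where y: "s0 = Center i (E.gen_coset i y)" "y \<in> carrier E"
          "\<pi> ` E.gen_coset i y = G.gen_coset i x"
        using eq s0 Spoke by auto
      then have "x \<in> \<pi> ` E.gen_coset i y"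
        using G.gen_coset_self[OF ix(1,2)] by simp
      then obtain y' where y': "y' \<in> E.gen_coset i y" "\<pi> y' = x"
        by auto
      then have "y' \<in> carrier E" "E.gen_coset i y' = E.gen_coset i y"
        using E.gen_coset_carrier[OF ix(1) y(2)] E.gen_coset_eqI[OF ix(1) y(2) y'(1)] by auto
      then show ?thesis
        using ix Spoke True y(1) y'(2) by (intro bexI[of _ "Spoke i y'"]) auto
    next
      case False
      then obtain y where y: "s0 = Vertex y" "y \<in> carrier E" "\<pi> y = x"
        using eq s0 Spoke by auto
      then show ?thesis
        using ix Spoke False by (intro bexI[of _ "Spoke i y"]) auto
    qed
  next
    case (Triangle i x)
    then have ix: "i < d" "x \<in> carrier G" "k = 0 \<or> k = 1 \<or> k = 2"
      using s k by auto
    show ?thesis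
    proof (cases "k = 0")
      case True
      then obtain y where y: "s0 = Spoke i y" "y \<in> carrier E" "\<pi> y = x \<otimes>\<^bsub>G\<^esub> \<pi> (h i)"
        using eq s0 Triangle by auto
      then show ?thesis
        using pred[OF ix(1) y(2) ix(2) y(3)] ix Triangle True
        by (intro bexI[of _ "Triangle i (y \<otimes>\<^bsub>E\<^esub> inv\<^bsub>E\<^esub> h i)"]) auto
    next
      case False
      then obtain y where y: "s0 = (if k = 1 then Spoke i y else Edge i y)" "y \<in> carrier E" "\<pi> y = x"
        using eq s0 Triangle by (cases "k = 1") auto
      then show ?thesis
        using ix Triangle False by (intro bexI[of _ "Triangle i y"]) auto
    qed
  qed (use k in auto)
qed

text \<open>This makes \<open>p\<close> map stars onto stars. A face containing the vertex is lifted
  first, and the cell is then lifted from the face.\<close>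

lemma cell_vertex_lift:
  assumes "s \<in> cells G d g" "w \<in> cells E d h" "map_cell \<pi> w = G.cell_vertex j s" "j \<le> cell_dim s"
  shows "\<exists>s'\<in>cells E d h. map_cell \<pi> s' = s \<and> E.cell_vertex j s' = w"
  using assms
proof (induction "cell_dim s" arbitrary: s j)
  case 0
  then have "map_cell \<pi> w = s" by simp
  moreover from this have "cell_dim w = 0"
    using 0(1) cell_dim_map_cell by metis
  ultimately show ?case
    using 0 by (intro bexI[of _ w]) auto
next
  case (Suc n)
  \<comment> \<open>A face that still has vertex \<open>j\<close>: vertex 1 is dropped if
    \<open>j = 0\<close>, vertex 0 otherwise. In this face the vertex has index
    \<open>j - 1\<close>, with \<open>0 - 1 = 0\<close> covering the first case.\<close>
  define k where "k = (if j = 0 then 1 else 0 :: nat)"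
  define l where "l = j - 1"
  have l: "(if l < k then l else Suc l) = j"
    by (auto simp: k_def l_def)
  have dim: "0 < cell_dim s" "k \<le> cell_dim s" "l < cell_dim s"
    using Suc.hyps(2) Suc.prems(4) by (auto simp: k_def l_def)
  have face_dim: "n = cell_dim (cell_face G g k s)" "l \<le> cell_dim (cell_face G g k s)"
    using Suc.hyps(2) dim by (auto simp: G.cell_dim_face)
  have "map_cell \<pi> w = G.cell_vertex l (cell_face G g k s)"
    using G.cell_vertex_face[OF Suc.prems(1) dim] l Suc.prems(3) by simp
  then obtain s0 where s0: "s0 \<in> cells E d h" "map_cell \<pi> s0 = cell_face G g k s"
      "E.cell_vertex l s0 = w"
    using Suc.hyps(1)[OF face_dim(1) G.cell_face_in_cells[OF Suc.prems(1)] Suc.prems(2) _ face_dim(2)]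
    by blast
  obtain s' where s': "s' \<in> cells E d h" "map_cell \<pi> s' = s" "cell_face E h k s' = s0"
    using cell_face_lift[OF Suc.prems(1) s0(1,2) dim(1,2)] by blast
  then have "cell_dim s' = cell_dim s"
    using cell_dim_map_cell by metis
  then have "E.cell_vertex j s' = w"
    using E.cell_vertex_face[OF s'(1), of k l] s'(3) s0(3) l dim by simp
  with s' show ?case by blast
qed

section \<open>Lifting of points and properties of the simplicial map\<close>

definition map_pair :: "'e cell \<times> (nat \<Rightarrow> real) \<Rightarrow> 'g cell \<times> (nat \<Rightarrow> real)" where
  "map_pair z = (map_cell \<pi> (fst z), snd z)"

lemma map_pair_in: "z \<in> E.complex_pairs \<Longrightarrow> map_pair z \<in> G.complex_pairs"
  by (auto simp: map_pair_def E.complex_pairs_def G.complex_pairs_def map_cell_in_cells)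

lemma map_pair_gluing:
  assumes "(z, z') \<in> gluing E d h"
  shows "(map_pair z, map_pair z') \<in> gluing G d g"
proof -
  obtain s k t where "z = (s, simplical_face k t)" "z' = (cell_face E h k s, t)"
    and s: "s \<in> cells E d h" "0 < cell_dim s" "k \<le> cell_dim s" "t \<in> standard_simplex (cell_dim s - 1)"
    using assms by (auto simp: gluing_def)
  then have "map_pair z = (map_cell \<pi> s, simplical_face k t)"
    "map_pair z' = (cell_face G g k (map_cell \<pi> s), t)"
    by (simp_all add: map_pair_def map_cell_face)
  moreover have "map_cell \<pi> s \<in> cells G d g" "0 < cell_dim (map_cell \<pi> s)"
    "k \<le> cell_dim (map_cell \<pi> s)" "t \<in> standard_simplex (cell_dim (map_cell \<pi> s) - 1)"
    using s map_cell_in_cells by simp_all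
  ultimately show ?thesis
    unfolding gluing_def by blast
qed

lemma map_pair_proj_eq:
  assumes "E.proj z = E.proj z'"
  shows "G.proj (map_pair z) = G.proj (map_pair z')"
proof -
  have "(z, z') \<in> E.sym_gluing\<^sup>*"
    using assms by (simp add: E.proj_eq_iff)
  then have "(map_pair z, map_pair z') \<in> G.sym_gluing\<^sup>*"
  proof (induction rule: rtrancl_induct)
    case (step y z)
    then have "(map_pair y, map_pair z) \<in> G.sym_gluing"
      using map_pair_gluing by blast
    with step.IH show ?case
      by (rule rtrancl_into_rtrancl)
  qed simp
  then show ?thesis
    by (simp add: G.proj_eq_iff)
qed

text \<open>A step down to a face lifts because \<open>map_cell\<close> commutes with faces; a step
  up from a face to a cell is what \<open>cell_face_lift\<close> provides.\<close>

lemma gluing_lift: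
  assumes z: "z \<in> E.complex_pairs" and y: "(map_pair z, y) \<in> G.sym_gluing"
  shows "\<exists>z'\<in>E.complex_pairs. map_pair z' = y \<and> E.proj z = E.proj z'"
proof (cases "(map_pair z, y) \<in> gluing G d g")
  case True
  then obtain s k t where st: "map_pair z = (s, simplical_face k t)" "y = (cell_face G g k s, t)"
    and s: "s \<in> cells G d g" "0 < cell_dim s" "k \<le> cell_dim s" "t \<in> standard_simplex (cell_dim s - 1)"
    by (auto simp: gluing_def)
  obtain s0 where s0: "z = (s0, simplical_face k t)" "map_cell \<pi> s0 = s"
    using st(1) by (cases z) (auto simp: map_pair_def)
  then have s0': "s0 \<in> cells E d h" "cell_dim s0 = cell_dim s"
    using z by (auto simp: E.complex_pairs_def)
  let ?z = "(cell_face E h k s0, t)"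
  have "?z \<in> E.complex_pairs"
    using s s0' by (auto simp: E.complex_pairs_def E.cell_face_in_cells E.cell_dim_face)
  moreover have "map_pair ?z = y"
    using st s0 s0' by (simp add: map_pair_def map_cell_face)
  moreover have "E.proj z = E.proj ?z"
    unfolding s0(1) using s s0' by (intro E.proj_face) auto
  ultimately show ?thesis by blast
next
  case False
  then have "(y, map_pair z) \<in> gluing G d g"
    using y by blast
  then obtain s k t where st: "y = (s, simplical_face k t)" "map_pair z = (cell_face G g k s, t)"
    and s: "s \<in> cells G d g" "0 < cell_dim s" "k \<le> cell_dim s" "t \<in> standard_simplex (cell_dim s - 1)"
    by (auto simp: gluing_def)
  obtain s0 where s0: "z = (s0, t)" "map_cell \<pi> s0 = cell_face G g k s"
    using st(2) by (cases z) (auto simp: map_pair_def)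
  have "s0 \<in> cells E d h"
    using z s0 by (auto simp: E.complex_pairs_def)
  then obtain s' where s': "s' \<in> cells E d h" "map_cell \<pi> s' = s" "cell_face E h k s' = s0"
    using cell_face_lift[OF s(1) _ s0(2) s(2,3)] by blast
  then have dim: "cell_dim s' = cell_dim s"
    using cell_dim_map_cell by metis
  let ?z = "(s', simplical_face k t)"
  have "simplical_face k t \<in> standard_simplex (cell_dim s')"
    unfolding dim by (rule simplical_face_in_standard_simplex) (use s in auto)
  then have "?z \<in> E.complex_pairs"
    using s'(1) by (simp add: E.complex_pairs_def)
  moreover have "map_pair ?z = y"
    using st s' by (simp add: map_pair_def)
  moreover have "E.proj ?z = E.proj z"
    unfolding s0(1) s'(3)[symmetric] by (rule E.proj_face) (use s s'(1) in \<open>simp_all add: dim\<close>)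
  ultimately show ?thesis by metis
qed

text \<open>Chains of gluing steps lift from any prescribed starting representative. Both openness
  and injectivity of \<open>p\<close> on stars rest on this.\<close>

lemma proj_eq_lift:
  assumes z: "z \<in> E.complex_pairs" and y: "G.proj (map_pair z) = G.proj y"
  shows "\<exists>z'\<in>E.complex_pairs. map_pair z' = y \<and> E.proj z = E.proj z'"
proof -
  have "(map_pair z, y) \<in> G.sym_gluing\<^sup>*"
    using y by (simp add: G.proj_eq_iff)
  then show ?thesis
  proof (induction rule: rtrancl_induct)
    case base
    show ?case using z by blast
  next
    case (step y1 y2)
    then obtain z1 where z1: "z1 \<in> E.complex_pairs" "map_pair z1 = y1" "E.proj z = E.proj z1"
      by blast
    then obtain z2 where "z2 \<in> E.complex_pairs" "map_pair z2 = y2" "E.proj z1 = E.proj z2"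
      using gluing_lift[of z1 y2] step.hyps(2) by blast
    then show ?case using z1 by auto
  qed
qed

lemma induced_simplicial_map_iff:
  "induced_simplicial_map E G d h g \<pi> p \<longleftrightarrow>
     (\<forall>z\<in>E.complex_pairs. p (E.proj z) = G.proj (map_pair z))"
proof
  assume L: "induced_simplicial_map E G d h g \<pi> p"
  show "\<forall>z\<in>E.complex_pairs. p (E.proj z) = G.proj (map_pair z)"
  proof
    fix z assume "z \<in> E.complex_pairs"
    then obtain s t where z: "z = (s, t)" "s \<in> cells E d h" "t \<in> standard_simplex (cell_dim s)"
      by (auto simp: E.complex_pairs_def)
    obtain x \<sigma> where x: "x \<in> carrier E" "\<sigma> \<in> cell_symbols d" "s = translate E h x \<sigma>"
      using E.cells_translate[OF z(2)] .
    show "p (E.proj z) = G.proj (map_pair z)"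
      using L x z unfolding induced_simplicial_map_def
      by (simp add: map_pair_def map_cell_translate)
  qed
next
  assume R: "\<forall>z\<in>E.complex_pairs. p (E.proj z) = G.proj (map_pair z)"
  show "induced_simplicial_map E G d h g \<pi> p"
    unfolding induced_simplicial_map_def
  proof (intro ballI)
    fix x \<sigma> t
    assume x: "x \<in> carrier E" "\<sigma> \<in> cell_symbols d" "t \<in> standard_simplex (cell_dim (translate E h x \<sigma>))"
    then have "(translate E h x \<sigma>, t) \<in> E.complex_pairs"
      by (simp add: E.complex_pairs_def E.translate_in_cells)
    then show "p (E.proj (translate E h x \<sigma>, t)) = G.proj (translate G g (\<pi> x) \<sigma>, t)"
      using R x by (auto simp: map_pair_def map_cell_translate)
  qed
qed

lemma exists_induced_simplicial_map: "\<exists>p. induced_simplicial_map E G d h g \<pi> p"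
proof -
  \<comment> \<open>The value is read off from an arbitrary representative, by
    \<open>map_pair_proj_eq\<close> independently of the choice.\<close>
  define p where "p P = G.proj (map_pair (SOME z. E.proj z = P))" for P
  have "p (E.proj z) = G.proj (map_pair z)" for z
    unfolding p_def by (rule map_pair_proj_eq, rule someI[of _ z]) simp
  then show ?thesis
    unfolding induced_simplicial_map_iff by blast
qed

context
  fixes p assumes p: "induced_simplicial_map E G d h g \<pi> p"
begin

lemma p_proj: "z \<in> E.complex_pairs \<Longrightarrow> p (E.proj z) = G.proj (map_pair z)"
  using p by (simp add: induced_simplicial_map_iff)

lemma continuous_map_p: "continuous_map E.realization G.realization p"
  unfolding continuous_map_def
proof (intro conjI allI impI)
  show "p \<in> topspace E.realization \<rightarrow> topspace G.realization"
    by (auto simp: E.topspace_realization G.topspace_realization p_proj map_pair_in)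
  fix U assume U: "openin G.realization U"
  show "openin E.realization {x \<in> topspace E.realization. p x \<in> U}"
    unfolding E.openin_realization
  proof (intro conjI ballI)
    fix s assume s: "s \<in> cells E d h"
    have "{t \<in> standard_simplex (cell_dim s). E.proj (s, t) \<in> {x \<in> topspace E.realization. p x \<in> U}} =
        {t \<in> standard_simplex (cell_dim (map_cell \<pi> s)). G.proj (map_cell \<pi> s, t) \<in> U}"
      using s p_proj[of "(s, t)" for t]
      by (auto simp: E.topspace_realization E.complex_pairs_def map_pair_def)
    then show "openin (subtopology (powertop_real UNIV) (standard_simplex (cell_dim s)))
        {t \<in> standard_simplex (cell_dim s). E.proj (s, t) \<in> {x \<in> topspace E.realization. p x \<in> U}}"
      using U map_cell_in_cells[OF s] unfolding G.openin_realization by auto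
  qed (auto simp: E.topspace_realization)
qed

lemma open_map_p: "open_map E.realization G.realization p"
  unfolding open_map_def
proof (intro allI impI)
  fix V assume V: "openin E.realization V"
  then have V_sub: "V \<subseteq> E.proj ` E.complex_pairs"
    by (simp add: E.openin_realization)
  show "openin G.realization (p ` V)"
    unfolding G.openin_realization
  proof (intro conjI ballI)
    show "p ` V \<subseteq> G.proj ` G.complex_pairs"
      using V_sub by (auto simp: p_proj map_pair_in)
    fix s assume s: "s \<in> cells G d g"
    let ?T = "subtopology (powertop_real UNIV) (standard_simplex (cell_dim s))"
    let ?L = "{s' \<in> cells E d h. map_cell \<pi> s' = s}"
    \<comment> \<open>The trace of the image of \<open>V\<close> on a cell is the union of the
      traces of \<open>V\<close> on the cells above it, as coordinates are preserved. The inclusion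
      from left to right is chain lifting.\<close>
    have "{t \<in> standard_simplex (cell_dim s). G.proj (s, t) \<in> p ` V} =
        (\<Union>s'\<in>?L. {t \<in> standard_simplex (cell_dim s'). E.proj (s', t) \<in> V})"
      (is "?A = ?B")
    proof
      show "?A \<subseteq> ?B"
      proof
        fix t assume t: "t \<in> ?A"
        then obtain v where v: "v \<in> V" "G.proj (s, t) = p v" by auto
        then obtain z where z: "z \<in> E.complex_pairs" "v = E.proj z"
          using V_sub by auto
        then have "G.proj (map_pair z) = G.proj (s, t)"
          using v p_proj by simp
        then obtain z' where z': "z' \<in> E.complex_pairs" "map_pair z' = (s, t)" "E.proj z = E.proj z'"
          using proj_eq_lift[OF z(1)] by blast
        then obtain s' where "z' = (s', t)" "map_cell \<pi> s' = s"
          by (cases z') (auto simp: map_pair_def)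
        then show "t \<in> ?B"
          using z' z v by (auto simp: E.complex_pairs_def intro!: exI[of _ s'])
      qed
      show "?B \<subseteq> ?A"
      proof
        fix t assume "t \<in> ?B"
        then obtain s' where s': "s' \<in> cells E d h" "map_cell \<pi> s' = s"
            "t \<in> standard_simplex (cell_dim s')" "E.proj (s', t) \<in> V"
          by auto
        then have "p (E.proj (s', t)) = G.proj (s, t)"
          by (simp add: p_proj E.complex_pairs_def map_pair_def)
        then have "G.proj (s, t) \<in> p ` V"
          using s'(4) by (metis imageI)
        then show "t \<in> ?A"
          using s' by auto
      qed
    qed
    moreover have "openin ?T {t \<in> standard_simplex (cell_dim s'). E.proj (s', t) \<in> V}" if "s' \<in> ?L" for s'
    proof -
      have "cell_dim s' = cell_dim s"
        using that by auto
      then show ?thesis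
        using V that unfolding E.openin_realization by auto
    qed
    ultimately show "openin ?T {t \<in> standard_simplex (cell_dim s). G.proj (s, t) \<in> p ` V}"
      by (simp only:) blast
  qed
qed

end

end

text \<open>Orders are sizes of cyclic subgroups, and the cyclic subgroup of \<open>h x\<close> is
  the image of that of \<open>x\<close>, so the orders agree iff \<open>h\<close> is injective
  there. \<open>ord\<close> is 0 for infinite order; excluding this makes the counting
  legitimate.\<close>

lemma (in group_hom) ord_eq_iff_trivial_kernel:
  assumes x: "x \<in> carrier G" "G.ord x \<noteq> 0"
  shows "G.ord x = H.ord (h x) \<longleftrightarrow> (\<forall>a\<in>generate G {x}. h a = \<one>\<^bsub>H\<^esub> \<longrightarrow> a = \<one>)"
proof -
  let ?C = "generate G {x}"
  interpret C: subgroup ?C G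
    using x by (intro G.generate_is_subgroup) simp
  have "card ?C \<noteq> 0"
    using x G.generate_pow_card by simp
  then have fin: "finite ?C"
    by (rule card_ge_0_finite[OF neq0_conv[THEN iffD1]])
  have "H.ord (h x) = card (h ` ?C)"
    using generate_img[of "{x}"] H.generate_pow_card[of "h x"] x by simp
  then have "G.ord x = H.ord (h x) \<longleftrightarrow> inj_on h ?C"
    using G.generate_pow_card[OF x(1)] fin by (metis card_image eq_card_imp_inj_on)
  also have "\<dots> \<longleftrightarrow> (\<forall>a\<in>?C. h a = \<one>\<^bsub>H\<^esub> \<longrightarrow> a = \<one>)"
  proof
    assume "inj_on h ?C"
    then show "\<forall>a\<in>?C. h a = \<one>\<^bsub>H\<^esub> \<longrightarrow> a = \<one>"
      using C.one_closed by (auto dest: inj_onD[of h ?C _ \<one>])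
  next
    assume R: "\<forall>a\<in>?C. h a = \<one>\<^bsub>H\<^esub> \<longrightarrow> a = \<one>"
    show "inj_on h ?C"
    proof (rule inj_onI)
      fix a b assume ab: "a \<in> ?C" "b \<in> ?C" "h a = h b"
      then have ab': "a \<in> carrier G" "b \<in> carrier G"
        by auto
      have "a \<otimes> inv b \<in> ?C" "h (a \<otimes> inv b) = \<one>\<^bsub>H\<^esub>"
        using ab ab' by simp_all
      then have "a \<otimes> inv b = \<one>"
        using R by blast
      then have "inv (inv b) = a"
        using ab' by (intro G.inv_equality) simp_all
      then show "a = b"
        using ab' by simp
    qed
  qed
  finally show ?thesis .
qed

section \<open>The covering criterion\<close>

context complex_epi
begin

text \<open>Uniqueness of the lift through a given corner. A corner \<open>Vertex x\<close>
  determines the cell by cancellation. At a center two candidates differ by an element of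
  \<open>generate E {h i}\<close> over the identity, which \<open>ker\<close> makes trivial.\<close>

lemma map_cell_inj_at_vertex:
  assumes ker: "\<And>i a. i < d \<Longrightarrow> a \<in> generate E {h i} \<Longrightarrow> \<pi> a = \<one>\<^bsub>G\<^esub> \<Longrightarrow> a = \<one>\<^bsub>E\<^esub>"
    and s: "s \<in> cells E d h" "s' \<in> cells E d h" "map_cell \<pi> s = map_cell \<pi> s'"
    and j: "j \<le> cell_dim s" "E.cell_vertex j s = E.cell_vertex j s'"
  shows "s = s'"
proof -
  have cancel: "x = y"
    if "i < d" "x \<in> carrier E" "y \<in> carrier E" "x \<otimes>\<^bsub>E\<^esub> h i = y \<otimes>\<^bsub>E\<^esub> h i" for i x y
    using that by simp
  have coset: "x = y"
    if i: "i < d" and xy: "x \<in> carrier E" "y \<in> carrier E" "E.gen_coset i x = E.gen_coset i y" "\<pi> x = \<pi> y"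
    for i x y
  proof -
    have "y \<in> E.gen_coset i x"
      using E.gen_coset_self[OF i xy(2)] xy(3) by simp
    then obtain a where a: "a \<in> generate E {h i}" "y = x \<otimes>\<^bsub>E\<^esub> a"
      by (auto simp: l_coset_def)
    have aE: "a \<in> carrier E"
      using a(1) subgroup.subset[OF E.subgroup_gen[OF i]] by auto
    have "\<pi> a = \<one>\<^bsub>G\<^esub>"
      using xy a aE by simp
    then show ?thesis
      using ker[OF i a(1)] a xy by simp
  qed
  show ?thesis
  proof (cases s)
    case (Triangle i x)
    then obtain y where "s' = Triangle i y" "\<pi> x = \<pi> y"
      using s(3) by (metis map_cell.simps(5) map_cell_eq_simps(5))
    moreover from this have "j = 0 \<or> j = 1 \<or> j = 2" "i < d" "x \<in> carrier E" "y \<in> carrier E"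
      using Triangle s j by auto
    ultimately show ?thesis
      using Triangle j(2) cancel[of i x y] coset[of i x y] by auto
  next
    case (Edge i x)
    then obtain y where "s' = Edge i y" "\<pi> x = \<pi> y"
      using s(3) by (metis map_cell.simps(3) map_cell_eq_simps(3))
    moreover from this have "j = 0 \<or> j = 1" "i < d" "x \<in> carrier E" "y \<in> carrier E"
      using Edge s j by auto
    ultimately show ?thesis
      using Edge j(2) cancel[of i x y] by auto
  next
    case (Spoke i x)
    then obtain y where "s' = Spoke i y" "\<pi> x = \<pi> y"
      using s(3) by (metis map_cell.simps(4) map_cell_eq_simps(4))
    moreover from this have "j = 0 \<or> j = 1" "i < d" "x \<in> carrier E" "y \<in> carrier E"
      using Spoke s j by auto
    ultimately show ?thesis
      using Spoke j(2) coset[of i x y] by auto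
  next
    case (Vertex x)
    then have "cell_dim s' = 0"
      using s(3) cell_dim_map_cell by (metis cell_dim.simps(1))
    then show ?thesis
      using j(2) Vertex by simp
  next
    case (Center i K)
    then have "cell_dim s' = 0"
      using s(3) cell_dim_map_cell by (metis cell_dim.simps(2))
    then show ?thesis
      using j(2) Center by simp
  qed
qed

context
  fixes p assumes p: "induced_simplicial_map E G d h g \<pi> p"
begin

text \<open>
  The preimage of the open star of a vertex is the disjoint union of the open stars of the vertices
  above it, and triviality of the kernel on the cyclic subgroups makes the map injective near the
  centers.
\<close>

lemma covering_projection_if_trivial_kernel:
  assumes ne: "\<And>i. i < d \<Longrightarrow> g i \<noteq> \<one>\<^bsub>G\<^esub>"
    and ker: "\<And>i a. i < d \<Longrightarrow> a \<in> generate E {h i} \<Longrightarrow> \<pi> a = \<one>\<^bsub>G\<^esub> \<Longrightarrow> a = \<one>\<^bsub>E\<^esub>"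
  shows "covering_projection E.realization G.realization p"
  unfolding covering_projection_def
proof (intro conjI ballI)
  note p_proj = p_proj[OF p]
  show cont: "continuous_map E.realization G.realization p"
    by (rule continuous_map_p[OF p])
  fix y assume "y \<in> topspace G.realization"
  then obtain s t where st: "y = G.proj (s, t)" "s \<in> cells G d g" "t \<in> standard_simplex (cell_dim s)"
    by (auto simp: G.topspace_realization G.complex_pairs_def)
  \<comment> \<open>Barycentric coordinates sum to 1, so one of them is positive and the point lies
    in the star of that corner.\<close>
  have "\<exists>j\<le>cell_dim s. 0 < t j"
  proof (rule ccontr)
    assume "\<not> (\<exists>j\<le>cell_dim s. 0 < t j)"
    then have "(\<Sum>j\<le>cell_dim s. t j) \<le> 0"
      by (intro sum_nonpos) (auto simp: not_less)
    then show False
      using st(3) by (simp add: standard_simplex_def)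
  qed
  then obtain j where j: "j \<le> cell_dim s" "0 < t j" by blast
  define u where "u = G.cell_vertex j s"
  have in_star_iff: "p (E.proj (s, t)) \<in> G.star u \<longleftrightarrow>
      (\<exists>j\<le>cell_dim s. map_cell \<pi> (E.cell_vertex j s) = u \<and> 0 < t j)"
    if "(s, t) \<in> E.complex_pairs" for s t
    using that map_pair_in[OF that]
    by (auto simp: p_proj G.proj_in_star_iff map_pair_def G.star_pairs_def
        E.complex_pairs_def map_cell_vertex)
  define L where "L = {w \<in> cells E d h. map_cell \<pi> w = u}"
  let ?\<V> = "E.star ` L"
  have preimage: "\<Union>?\<V> = {x \<in> topspace E.realization. p x \<in> G.star u}"
  proof
    show "\<Union>?\<V> \<subseteq> {x \<in> topspace E.realization. p x \<in> G.star u}"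
    proof
      fix x assume "x \<in> \<Union>?\<V>"
      then obtain w s t where w: "w \<in> L" "x = E.proj (s, t)" "(s, t) \<in> E.complex_pairs"
          "(s, t) \<in> E.star_pairs w"
        by (auto simp: E.star_def)
      then have "p x \<in> G.star u"
        using in_star_iff[OF w(3)] by (auto simp: E.star_pairs_def L_def)
      then show "x \<in> {x \<in> topspace E.realization. p x \<in> G.star u}"
        using w by (auto simp: E.topspace_realization)
    qed
    show "{x \<in> topspace E.realization. p x \<in> G.star u} \<subseteq> \<Union>?\<V>"
    proof
      fix x assume "x \<in> {x \<in> topspace E.realization. p x \<in> G.star u}"
      then obtain s t where s: "x = E.proj (s, t)" "(s, t) \<in> E.complex_pairs" "p x \<in> G.star u"
        by (auto simp: E.topspace_realization)
      then obtain k where k: "k \<le> cell_dim s" "map_cell \<pi> (E.cell_vertex k s) = u" "0 < t k"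
        using in_star_iff by blast
      have "E.cell_vertex k s \<in> L"
        using s(2) k E.cell_vertex_in_cells by (auto simp: L_def E.complex_pairs_def)
      moreover have "x \<in> E.star (E.cell_vertex k s)"
        using s k by (auto simp: E.proj_in_star_iff E.star_pairs_def)
      ultimately show "x \<in> \<Union>?\<V>"
        by blast
    qed
  qed
  have disjoint: "pairwise disjnt ?\<V>"
  proof (rule pairwiseI)
    fix A B assume "A \<in> ?\<V>" "B \<in> ?\<V>" and AB: "A \<noteq> B"
    then obtain w w' where w: "w \<in> L" "A = E.star w" "w' \<in> L" "B = E.star w'"
      by blast
    show "disjnt A B"
    proof (rule ccontr)
      assume "\<not> disjnt A B"
      then obtain x where "x \<in> E.star w" "x \<in> E.star w'"
        using w by (auto simp: disjnt_def)
      then obtain s t where s: "(s, t) \<in> E.complex_pairs" "(s, t) \<in> E.star_pairs w"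
          "(s, t) \<in> E.star_pairs w'"
        using E.proj_in_star_iff by (fastforce simp: E.star_def)
      then obtain k k' where k: "k \<le> cell_dim s" "E.cell_vertex k s = w"
          "k' \<le> cell_dim s" "E.cell_vertex k' s = w'"
        by (auto simp: E.star_pairs_def)
      have sE: "s \<in> cells E d h"
        using s by (simp add: E.complex_pairs_def)
      \<comment> \<open>Both corners lie over \<open>u\<close>, and a cell of \<open>Y\<close> has
        at most one corner equal to \<open>u\<close>.\<close>
      have "G.cell_vertex k (map_cell \<pi> s) = G.cell_vertex k' (map_cell \<pi> s)"
        using w k by (simp add: map_cell_vertex[OF sE, symmetric] L_def)
      then have "k = k'"
        using G.cell_vertex_eq_iff[OF ne map_cell_in_cells[OF sE], of k k'] k by simp
      then show False
        using k w AB by auto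
    qed
  qed
  have homeo: "openin E.realization V \<and>
      homeomorphic_map (subtopology E.realization V) (subtopology G.realization (G.star u)) p"
    if V: "V \<in> ?\<V>" for V
  proof
    obtain w where w: "w \<in> L" "V = E.star w"
      using V by blast
    show V_open: "openin E.realization V"
      using w E.openin_star by simp
    have V_sub: "V \<subseteq> topspace E.realization"
      using openin_subset[OF V_open] .
    have U_sub: "G.star u \<subseteq> topspace G.realization"
      using openin_subset[OF G.openin_star] .
    have top_V: "topspace (subtopology E.realization V) = V"
      using V_sub by auto
    have top_U: "topspace (subtopology G.realization (G.star u)) = G.star u"
      using U_sub by auto
    have sub: "p ` V \<subseteq> G.star u"
      using preimage V by blast
    show "homeomorphic_map (subtopology E.realization V) (subtopology G.realization (G.star u)) p"
    proof (rule bijective_open_imp_homeomorphic_map)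
      show "continuous_map (subtopology E.realization V) (subtopology G.realization (G.star u)) p"
        using cont sub top_V
        by (auto simp: continuous_map_in_subtopology continuous_map_from_subtopology)
      show "open_map (subtopology E.realization V) (subtopology G.realization (G.star u)) p"
        using open_map_from_subtopology[OF open_map_p[OF p] V_open] sub top_V
        by (subst open_map_in_subtopology[OF G.openin_star]) auto
      show "p ` topspace (subtopology E.realization V) = topspace (subtopology G.realization (G.star u))"
        unfolding top_V top_U
      proof
        show "G.star u \<subseteq> p ` V"
        proof
          fix x assume "x \<in> G.star u"
          then obtain s t where s: "x = G.proj (s, t)" "(s, t) \<in> G.complex_pairs"
              "(s, t) \<in> G.star_pairs u"
            by (auto simp: G.star_def)
          then obtain k where k: "k \<le> cell_dim s" "G.cell_vertex k s = u" "0 < t k"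
            by (auto simp: G.star_pairs_def)
          obtain s' where s': "s' \<in> cells E d h" "map_cell \<pi> s' = s" "E.cell_vertex k s' = w"
            using cell_vertex_lift[of s w k] s k w by (auto simp: G.complex_pairs_def L_def)
          then have dim: "cell_dim s' = cell_dim s"
            using cell_dim_map_cell by metis
          have "(s', t) \<in> E.complex_pairs"
            using s'(1) s(2) dim by (simp add: E.complex_pairs_def G.complex_pairs_def)
          moreover from this have "p (E.proj (s', t)) = x"
            using s(1) s'(2) by (simp add: p_proj map_pair_def)
          moreover have "(s', t) \<in> E.star_pairs w"
            unfolding E.star_pairs_def using s' k dim by auto
          ultimately show "x \<in> p ` V"
            using w E.proj_in_star_iff by blast
        qed
      qed (rule sub)
      show "inj_on p (topspace (subtopology E.realization V))"
        unfolding top_V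
      proof (rule inj_onI)
        fix x x' assume x: "x \<in> V" "x' \<in> V" "p x = p x'"
        obtain z z' where z: "x = E.proj z" "z \<in> E.complex_pairs" "x' = E.proj z'" "z' \<in> E.complex_pairs"
          using x w by (auto simp: E.star_def)
        have "G.proj (map_pair z) = G.proj (map_pair z')"
          using x(3) z by (simp add: p_proj)
        \<comment> \<open>Replacing \<open>z\<close> by \<open>z1\<close> makes the two images equal
          as pairs and not merely as points, so that cells and coordinates can be compared.\<close>
        then obtain z1 where z1: "z1 \<in> E.complex_pairs" "map_pair z1 = map_pair z'"
            "E.proj z = E.proj z1"
          using proj_eq_lift[OF z(2)] by blast
        obtain s t where st: "z' = (s, t)" by force
        then obtain s1 where s1: "z1 = (s1, t)" "map_cell \<pi> s1 = map_cell \<pi> s"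
          using z1(2) by (cases z1) (auto simp: map_pair_def)
        have cells: "s1 \<in> cells E d h" "s \<in> cells E d h"
          using z1(1) z(4) s1 st by (auto simp: E.complex_pairs_def)
        have "z1 \<in> E.star_pairs w" "z' \<in> E.star_pairs w"
          using x w z z1 E.proj_in_star_iff by auto
        then obtain k k' where k: "k \<le> cell_dim s1" "E.cell_vertex k s1 = w"
            "k' \<le> cell_dim s" "E.cell_vertex k' s = w"
          by (auto simp: E.star_pairs_def s1 st)
        have dim: "cell_dim s1 = cell_dim s"
          using s1(2) cell_dim_map_cell by metis
        have "G.cell_vertex k (map_cell \<pi> s) = u" "G.cell_vertex k' (map_cell \<pi> s) = u"
          using map_cell_vertex[OF cells(1), of k] map_cell_vertex[OF cells(2), of k'] s1(2) k w
          by (auto simp: L_def)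
        then have "k = k'"
          using G.cell_vertex_eq_iff[OF ne map_cell_in_cells[OF cells(2)], of k k'] k dim by simp
        have "s1 = s"
        proof (rule map_cell_inj_at_vertex[OF _ cells s1(2)])
          show "k \<le> cell_dim s1" "E.cell_vertex k s1 = E.cell_vertex k s"
            using k \<open>k = k'\<close> by simp_all
        qed (rule ker)
        then show "x = x'"
          using z z1 s1 st by simp
      qed
    qed
  qed
  show "\<exists>U. openin G.realization U \<and> y \<in> U \<and>
      (\<exists>\<V>. \<Union>\<V> = {x \<in> topspace E.realization. p x \<in> U} \<and> pairwise disjnt \<V> \<and>
        (\<forall>V\<in>\<V>. openin E.realization V \<and>
          homeomorphic_map (subtopology E.realization V) (subtopology G.realization U) p))"
  proof (intro exI[of _ "G.star u"] conjI exI[of _ ?\<V>] ballI)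
    show "openin G.realization (G.star u)" by (rule G.openin_star)
    show "y \<in> G.star u"
      using st j by (auto simp: G.proj_in_star_iff G.complex_pairs_def G.star_pairs_def u_def)
  qed (use preimage disjoint homeo in auto)
qed

text \<open>
  If \<open>a \<noteq> 1\<close> is a power of \<open>h i\<close> in the kernel, the spokes of \<open>1\<close> and \<open>a\<close> have the same image and the
  same center, so no neighbourhood of this center is mapped injectively.
\<close>

lemma trivial_kernel_if_covering_projection:
  assumes cov: "covering_projection E.realization G.realization p"
    and i: "i < d" and a: "a \<in> generate E {h i}" "\<pi> a = \<one>\<^bsub>G\<^esub>"
  shows "a = \<one>\<^bsub>E\<^esub>"
proof -
  note p_proj = p_proj[OF p]
  \<comment> \<open>\<open>\<delta>\<close> is the only point of a 0-simplex, and \<open>r e\<close>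
    is the point of a spoke with weight \<open>e\<close> at its outer vertex and
    \<open>1 - e\<close> at its center.\<close>
  define \<delta> where "\<delta> = (\<lambda>j::nat. if j = 0 then 1 else 0 :: real)"
  define r where "r e = (\<lambda>j::nat. if j = 0 then e else if j = 1 then 1 - e else 0 :: real)" for e
  have aE: "a \<in> carrier E"
    using a(1) subgroup.subset[OF E.subgroup_gen[OF i]] by auto
  have r_simplex: "r e \<in> standard_simplex 1" if "e \<in> {0..1}" for e
    using that by (auto simp: r_def standard_simplex_def)
  have spoke: "(Spoke i x, r e) \<in> E.complex_pairs" if "x \<in> carrier E" "e \<in> {0..1}" for x e
    using that i r_simplex by (simp add: E.complex_pairs_def)
  define c where "c = E.proj (Center i (E.gen_coset i \<one>\<^bsub>E\<^esub>), \<delta>)"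
  have center: "E.proj (Spoke i x, r 0) = c" if x: "x \<in> E.gen_coset i \<one>\<^bsub>E\<^esub>" for x
  proof -
    have xE: "x \<in> carrier E"
      using E.gen_coset_carrier[OF i, of "\<one>\<^bsub>E\<^esub>"] x by auto
    have "\<delta> \<in> standard_simplex (cell_dim (Spoke i x) - 1)"
      by (simp add: \<delta>_def standard_simplex_0)
    then have "E.proj (Spoke i x, simplical_face 0 \<delta>) = E.proj (cell_face E h 0 (Spoke i x), \<delta>)"
      using xE i by (intro E.proj_face) auto
    moreover have "simplical_face 0 \<delta> = r 0"
      by (auto simp: simplical_face_def \<delta>_def r_def fun_eq_iff)
    ultimately show ?thesis
      using E.gen_coset_eqI[OF i _ x] by (simp add: c_def)
  qed
  have a_coset: "a \<in> E.gen_coset i \<one>\<^bsub>E\<^esub>"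
    using a(1) aE by (auto simp: l_coset_def intro!: bexI[of _ a])
  have one_coset: "\<one>\<^bsub>E\<^esub> \<in> E.gen_coset i \<one>\<^bsub>E\<^esub>"
    using E.gen_coset_self[OF i] by simp
  have c_top: "c \<in> topspace E.realization"
    using center[OF one_coset] spoke[of "\<one>\<^bsub>E\<^esub>" 0] by (auto simp: E.topspace_realization)
  then have pc: "p c \<in> topspace G.realization"
    using continuous_map_p[OF p] by (auto simp: continuous_map_def)
  from bspec[OF conjunct2[OF cov[unfolded covering_projection_def]] pc]
  obtain U \<V> where U: "p c \<in> U" and \<V>: "\<Union>\<V> = {x \<in> topspace E.realization. p x \<in> U}"
    and "\<forall>V\<in>\<V>. openin E.realization V \<and>
      homeomorphic_map (subtopology E.realization V) (subtopology G.realization U) p"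
    by (elim exE conjE)
  then have V_open: "\<And>V. V \<in> \<V> \<Longrightarrow> openin E.realization V"
    and V_homeo: "\<And>V. V \<in> \<V> \<Longrightarrow>
      homeomorphic_map (subtopology E.realization V) (subtopology G.realization U) p"
    by simp_all
  obtain V where V: "V \<in> \<V>" "c \<in> V"
    using U \<V> c_top by blast
  have inj: "inj_on p V"
    using homeomorphic_imp_injective_map[OF V_homeo[OF V(1)]] openin_subset[OF V_open[OF V(1)]]
    by (simp add: Int_absorb1)
  \<comment> \<open>\<open>V\<close> meets a spoke ending at \<open>c\<close> in a relatively open
    set, which contains the parameter \<open>0\<close> because \<open>r 0\<close> is glued to the
    center.\<close>
  have near: "\<exists>e>0. \<forall>e'\<in>{0..1}. e' < e \<longrightarrow> E.proj (Spoke i x, r e') \<in> V"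
    if x: "x \<in> E.gen_coset i \<one>\<^bsub>E\<^esub>" for x
  proof -
    have xE: "x \<in> carrier E"
      using E.gen_coset_carrier[OF i, of "\<one>\<^bsub>E\<^esub>"] x by auto
    let ?T = "subtopology (powertop_real UNIV) (standard_simplex 1)"
    let ?O = "{t \<in> standard_simplex 1. E.proj (Spoke i x, t) \<in> V}"
    have "Spoke i x \<in> cells E d h"
      using xE i by simp
    from bspec[OF conjunct2[OF V_open[OF V(1), unfolded E.openin_realization]] this]
    have open_O: "openin ?T ?O"
      by (simp only: cell_dim.simps)
    have cont: "continuous_map (top_of_set {0..1}) ?T r"
      unfolding continuous_map_in_subtopology continuous_map_componentwise_UNIV
    proof (intro conjI allI)
      fix k
      show "continuous_map (top_of_set {0..1}) euclideanreal (\<lambda>e. r e k)"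
        unfolding r_def by (cases "k = 0"; cases "k = 1") (auto intro!: continuous_intros)
      show "r \<in> topspace (top_of_set {0..1}) \<rightarrow> standard_simplex 1"
        using r_simplex by auto
    qed
    have "openin (top_of_set {0..1}) {e \<in> {0..1}. r e \<in> ?O}"
      using openin_continuous_map_preimage[OF cont open_O] by simp
    moreover have "0 \<in> {e \<in> {0..1}. r e \<in> ?O}"
      using center[OF x] V(2) r_simplex[of 0] by auto
    ultimately obtain e where "e > 0"
      "\<And>e'. e' \<in> {0..1} \<Longrightarrow> dist e' 0 < e \<Longrightarrow> e' \<in> {e \<in> {0..1}. r e \<in> ?O}"
      unfolding openin_euclidean_subtopology_iff by (metis (no_types, lifting))
    then show ?thesis
      by (intro exI[of _ e]) auto
  qed
  obtain e1 where e1: "e1 > 0" "\<And>e'. e' \<in> {0..1} \<Longrightarrow> e' < e1 \<Longrightarrow> E.proj (Spoke i \<one>\<^bsub>E\<^esub>, r e') \<in> V"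
    using near[OF one_coset] by blast
  obtain e2 where e2: "e2 > 0" "\<And>e'. e' \<in> {0..1} \<Longrightarrow> e' < e2 \<Longrightarrow> E.proj (Spoke i a, r e') \<in> V"
    using near[OF a_coset] by blast
  \<comment> \<open>Halving the minimum gives strict inequalities, and the bound \<open>1/2\<close>
    keeps \<open>e\<close> in the unit interval.\<close>
  define e where "e = min (1/2) (min e1 e2 / 2)"
  have e: "0 < e" "e \<in> {0..1}" "e < e1" "e < e2"
    using e1(1) e2(1) by (auto simp: e_def min_def)
  have "p (E.proj (Spoke i \<one>\<^bsub>E\<^esub>, r e)) = p (E.proj (Spoke i a, r e))"
    using spoke[of "\<one>\<^bsub>E\<^esub>" e] spoke[of a e] e aE a(2) by (simp add: p_proj map_pair_def)
  then have "E.proj (Spoke i \<one>\<^bsub>E\<^esub>, r e) = E.proj (Spoke i a, r e)"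
    using inj_onD[OF inj] e1(2)[OF e(2,3)] e2(2)[OF e(2,4)] by blast
  \<comment> \<open>A point in the interior of the spoke of \<open>a\<close> lies only in the stars
    of \<open>Vertex a\<close> and of a center, so equality of the two points forces
    \<open>a\<close> to be the identity.\<close>
  then have "(Spoke i \<one>\<^bsub>E\<^esub>, r e) \<in> E.star_pairs (Vertex \<one>\<^bsub>E\<^esub>) \<longleftrightarrow>
      (Spoke i a, r e) \<in> E.star_pairs (Vertex \<one>\<^bsub>E\<^esub>)"
    by (rule E.star_pairs_proj_eq)
  moreover have "(Spoke i \<one>\<^bsub>E\<^esub>, r e) \<in> E.star_pairs (Vertex \<one>\<^bsub>E\<^esub>)"
    using e by (auto simp: E.star_pairs_def r_def intro!: exI[of _ 0])
  ultimately show ?thesis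
    by (auto simp: E.star_pairs_def split: if_splits)
qed

theorem covering_projection_iff_ord:
  assumes ne: "\<And>i. i < d \<Longrightarrow> g i \<noteq> \<one>\<^bsub>G\<^esub>" and fin: "\<And>i. i < d \<Longrightarrow> E.ord (h i) \<noteq> 0"
  shows "covering_projection E.realization G.realization p \<longleftrightarrow> (\<forall>i<d. E.ord (h i) = G.ord (g i))"
proof -
  have "(\<forall>i<d. E.ord (h i) = G.ord (g i)) \<longleftrightarrow>
      (\<forall>i<d. \<forall>a\<in>generate E {h i}. \<pi> a = \<one>\<^bsub>G\<^esub> \<longrightarrow> a = \<one>\<^bsub>E\<^esub>)"
    using \<pi>.ord_eq_iff_trivial_kernel fin by simp
  also have "\<dots> \<longleftrightarrow> covering_projection E.realization G.realization p"
    using covering_projection_if_trivial_kernel[OF ne] trivial_kernel_if_covering_projection by blast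
  finally show ?thesis by simp
qed

end

end

theorem corollary1p3:
  fixes G :: "('g, 'x) monoid_scheme"
    and d :: nat
    and m :: "nat \<Rightarrow> nat"
    and F :: "(nat \<times> bool) list set monoid"
    and f :: "nat \<Rightarrow> (nat \<times> bool) list set"
    and \<phi> :: "(nat \<times> bool) list set \<Rightarrow> 'g"
    and R :: "(nat \<times> bool) list set set"
    and E :: "(nat \<times> bool) list set set monoid"
    and \<pi> :: "(nat \<times> bool) list set set \<Rightarrow> 'g"
    and h :: "nat \<Rightarrow> (nat \<times> bool) list set set"
    and g :: "nat \<Rightarrow> 'g"
    and W :: "((nat \<times> bool) list set set cell \<times> (nat \<Rightarrow> real)) set topology"
    and Y :: "('g cell \<times> (nat \<Rightarrow> real)) set topology"
  assumes "group G" and "finite (carrier G)"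
    and "\<And>i. i < d \<Longrightarrow> 0 < m i"
    and F_eq: "F = free_product_cyclic d m"
    and f_eq: "f = free_product_gen d m"
    and "\<phi> \<in> epi F G"
    and R_eq: "R = kernel F G \<phi>"
    and "\<And>i. i < d \<Longrightarrow> f i \<notin> R"
    and E_eq: "E = F Mod commutator_subgroup F R (carrier F)"
    and pi_eq: "\<pi> = induced_hom \<phi>"
    and h_eq: "h = (\<lambda>i. commutator_subgroup F R (carrier F) #>\<^bsub>F\<^esub> f i)"
    and g_eq: "g = (\<lambda>i. \<pi> (h i))"
    and W_eq: "W = associated_complex E d h"
    and Y_eq: "Y = associated_complex G d g"
  shows "(\<exists>p. induced_simplicial_map E G d h g \<pi> p) \<and>
    (\<forall>p. induced_simplicial_map E G d h g \<pi> p \<longrightarrow>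
       continuous_map W Y p \<and>
       (covering_projection W Y p \<longleftrightarrow> (\<forall>i<d. group.ord E (h i) = group.ord G (g i)))) \<and>
    ((\<forall>i<d. group.ord E (h i) = group.ord G (g i)) \<longrightarrow>
       is_cover G E \<pi> \<and>
       (\<forall>(E' :: 'e monoid) \<pi>'. is_cover G E' \<pi>' \<longrightarrow> group_exp E \<le> group_exp E'))"
proof -
  note G = assms(1,2) and m = assms(3) and \<phi> = \<open>\<phi> \<in> epi F G\<close>
  note cover = cover_of_free_product_cyclic[where d = d and m = m, OF G _ \<phi>[unfolded F_eq]]
  note eqs = E_eq pi_eq h_eq R_eq f_eq F_eq
  have E: "is_cover G E \<pi>" "finite (carrier E)" "h ` {..<d} \<subseteq> carrier E"
      "generate E (h ` {..<d}) = carrier E"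
    unfolding eqs by (rule cover(1-4), rule m, assumption)+
  have g: "\<pi> (h i) = \<phi> (f i)" and fin: "group.ord E (h i) \<noteq> 0" if "i < d" for i
    unfolding eqs using cover(5,6) m that by blast+
  have E_group: "group E" and \<pi>: "\<pi> \<in> epi E G"
    and central: "\<And>a x. a \<in> kernel E G \<pi> \<Longrightarrow> x \<in> carrier E \<Longrightarrow> a \<otimes>\<^bsub>E\<^esub> x = x \<otimes>\<^bsub>E\<^esub> a"
    using E(1) by (auto simp: is_cover_def)
  have h_closed: "h i \<in> carrier E" if "i < d" for i
    using E(3) that by auto
  \<comment> \<open>The image of \<open>f i\<close> in \<open>G\<close> is
    \<open>\<pi> (h i)\<close>, so lying outside the kernel \<open>R\<close> means exactly
    this.\<close>
  have ne: "\<pi> (h i) \<noteq> \<one>\<^bsub>G\<^esub>" if i: "i < d" for i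
    using assms(8)[OF i] g[OF i] free_product_gen_closed[OF i, of m]
    by (auto simp: R_eq kernel_def F_eq f_eq)
  interpret complex_epi E G d h \<pi>
  proof (intro complex_epi.intro generating_complex.intro generating_complex_axioms.intro
      complex_epi_axioms.intro)
    show "\<pi> (h i) \<in> carrier G" if "i < d" for i
      using \<pi> h_closed[OF that] by (auto simp: epi_def hom_def)
  qed (use E_group G \<pi> h_closed in auto)
  have exp: "group_exp E \<le> group_exp E'"
    if ord: "\<forall>i<d. group.ord E (h i) = group.ord G (g i)" and "is_cover G E' \<pi>'"
    for E' :: "'e monoid" and \<pi>'
  proof (rule group_exp_le_of_cover[OF E_group E(2) G \<pi> central E(3,4) _ that(2)])
    show "group.ord E x = group.ord G (\<pi> x)" if "x \<in> h ` {..<d}" for x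
      using that ord by (auto simp: g_eq)
  qed
  show ?thesis
    unfolding W_eq Y_eq g_eq
    using exists_induced_simplicial_map continuous_map_p covering_projection_iff_ord[OF _ ne fin]
      E(1) exp[unfolded g_eq] by blast
qed

end
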